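(* With probability one, the following holds for all $\tau_0>0$ and $p_0>0$. If $p_0$ is a (cusp) singularity of $f(\cdot,\tau_0)$, then there exists $\delta>0$ such that $f(\cdot,\tau)$ has a unique loop $L(\tau)=f(\cdot,\tau)|_{[a_\tau,b_\tau]}$ in an interval $I_\tau$ containing $p_0$ for all $\tau\in[\tau_0-\delta,\tau_0)$. Moreover, $I_\tau$ can be chosen so that it shrinks to $p_0$ as $\tau\to\tau_0$, and $L(\cdot):[\tau_0-\delta,\tau_0)\to\mathcal{M}$ is a loop evolution of $f$ starting from $f(\cdot,\tau_0-\delta)|_{[a_{\tau_0-\delta},b_{\tau_0-\delta}]}$. Furthermore, if $f=(f^1,f^2)$ in natural co-ordinates based at the cusp singularity $p_0$ of $f(\cdot,\tau_0)$, then there is $M>0$ such that the rescaling of $f$ given by $$\hat f_s(P)=\left(s^{-1}f^1(p_0+\sqrt sP,\tau_0-s),\ s^{-3/2}f^2(p_0+\sqrt sP,\tau_0-s)\right)$$ for $s\in(0,\delta]$ has a unique loop $\hat L_s$ in $[-M,M]$, which converges to a deterministic loop $\hat L_0$ in $(\mathcal{M},d)$ as $s\to0$.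
   Context: Let $W$ be a standard two-dimensional Brownian motion on $[0,\infty)$, viewed as complex valued, extended by $W(s)=0$ for $s\le0$. For $p\in\mathbb{R}$ and $\tau>0$ let $f(p,\tau)=\mathbb{E}_{Z_\tau}W(p-Z_\tau)$, where $Z_\tau$ is a real normal variable with mean $0$ and variance $\tau$ independent of $W$ and the expectation is over $Z_\tau$ only, with $W$ fixed. Attention is restricted to $p>0$, $\tau>0$. Singularities: a singularity of a curve $\gamma:\mathbb{R}\to\mathbb{C}$ is a point $t_0$ with $|\gamma'(t_0)|=0$. It is a cusp singularity if $\gamma$ is analytic in a neighbourhood of $t_0$ and there is a translation and rotation of co-ordinates of the plane taking $\gamma(t_0)$ to the origin under which $\gamma$ becomes $\gamma^*=(\gamma_1^*,\gamma_2^* )$ with $\gamma_1^*(t)=\sum_{i\ge2}a_i(t-t_0)^i$, $\gamma_2^*(t)=\sum_{i\ge3}b_i(t-t_0)^i$ for $t$ in some interval $[t_0-\delta',t_0+\delta']$, $\delta'>0$, where $a_2\neq0$, $b_3\ne0$. These transformed co-ordinates are the natural co-ordinates based at $t_0$. In the theorem, the natural co-ordinates of the curve $f(\cdot,\tau_0)$ at $p_0$ are used for $f(\cdot,\tau)$ at all $\tau$. (With probability one every singularity of every $f(\cdot,\tau_0)$ is a cusp singularity.) Loops: a loop in a continuous $\mathbb{C}$-valued curve $g$ is a restriction $g|_{[a,b]}$, $a<b$, with $g(a)=g(b)$ and $g$ injective on $[a,b)$; it is in an interval $I$ if $[a,b]\subseteq I$. Space of paths: $\mathcal{M}=\{g:[a,b]\to\mathbb{C};\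 -\infty<a<b<\infty\}$. For $g_1:[a_1,b_1]\to\mathbb{C}$ and $g_2:[a_2,b_2]\to\mathbb{C}$ in $\mathcal{M}$, $$d(g_1,g_2)=\inf\left\{\|\lambda_1-\lambda_2\|+\|g_1\circ\lambda_1-g_2\circ\lambda_2\|\ :\ \lambda_i:[0,1]\to[a_i,b_i]\text{ a homeomorphism},\ i=1,2\right\},$$ with $\|\cdot\|$ the sup-norm. Loop evolution: the evolution of a loop $L$ on $[T_1,T_2)$ is a continuous function $L(\cdot):[T_1,T_2)\to(\mathcal{M},d)$ with $L(T_1)=L$ and $L(\tau)$ a loop for every $\tau\in[T_1,T_2)$. If moreover $L(\tau)=f(\cdot,\tau)|_{[a_\tau,b_\tau]}$ for every $\tau\in[T_1,T_2)$, it is called a loop evolution of $f$ starting from $L=f(\cdot,T_1)|_{[a_{T_1},b_{T_1}]}$.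
   Formalization: The limit loop is "deterministic" as a fixed function, chosen before the randomness, of the leading cusp coefficients a_2 and b_3 in natural co-ordinates; one loop for all cusps is impossible, since the limit scales with a_2 and b_3. *)

theory Defs
  imports "HOL-Probability.Probability"
begin

text \<open>Standard two-dimensional Brownian motion on \<open>[0,\<infinity>)\<close>, started at the origin and viewed as
  complex valued. Only the values of \<open>W t\<close> for \<open>t \<ge> 0\<close> are constrained.\<close>

locale planar_brownian_motion = prob_space M for M :: "'w measure" +
  fixes W :: "real \<Rightarrow> 'w \<Rightarrow> complex"
  assumes measurable_W: "0 \<le> t \<Longrightarrow> W t \<in> borel_measurable M"
    and start_zero: "AE \<omega> in M. W 0 \<omega> = 0"
    and indep_increments:
      "\<lbrakk>0 \<le> r 0; \<And>i. i < n \<Longrightarrow> r i < r (Suc i)\<rbrakk> \<Longrightarrow>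
        indep_vars (\<lambda>_. borel) (\<lambda>i \<omega>. W (r (Suc i)) \<omega> - W (r i) \<omega>) {..<n::nat}"
    and increment_Re: "\<lbrakk>0 \<le> s; s < t\<rbrakk> \<Longrightarrow>
        distributed M lborel (\<lambda>\<omega>. Re (W t \<omega> - W s \<omega>)) (normal_density 0 (sqrt (t - s)))"
    and increment_Im: "\<lbrakk>0 \<le> s; s < t\<rbrakk> \<Longrightarrow>
        distributed M lborel (\<lambda>\<omega>. Im (W t \<omega> - W s \<omega>)) (normal_density 0 (sqrt (t - s)))"
    and indep_Re_Im: "\<lbrakk>0 \<le> s; s < t\<rbrakk> \<Longrightarrow>
        indep_var borel (\<lambda>\<omega>. Re (W t \<omega> - W s \<omega>)) borel (\<lambda>\<omega>. Im (W t \<omega> - W s \<omega>))"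
    and continuous_paths: "AE \<omega> in M. continuous_on {0..} (\<lambda>t. W t \<omega>)"

definition extend_by_zero :: "(real \<Rightarrow> complex) \<Rightarrow> real \<Rightarrow> complex" where
  "extend_by_zero w s = (if s \<le> 0 then 0 else w s)"

text \<open>\<open>smoothed w p \<tau>\<close> is the expectation of \<open>w (p - Z)\<close> for \<open>Z\<close> normal with mean \<open>0\<close> and variance
  \<open>\<tau>\<close>; \<^const>\<open>normal_density\<close> takes the standard deviation as its second argument.\<close>

definition smoothed :: "(real \<Rightarrow> complex) \<Rightarrow> real \<Rightarrow> real \<Rightarrow> complex" where
  "smoothed w p \<tau> =
     (LINT z|density lborel (normal_density 0 (sqrt \<tau>)). extend_by_zero w (p - z))"

definition singularity :: "(real \<Rightarrow> complex) \<Rightarrow> real \<Rightarrow> bool" where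
  "singularity \<gamma> t\<^sub>0 \<longleftrightarrow> (\<gamma> has_vector_derivative 0) (at t\<^sub>0)"

definition real_analytic_at :: "(real \<Rightarrow> complex) \<Rightarrow> real \<Rightarrow> bool" where
  "real_analytic_at \<gamma> t \<longleftrightarrow>
     (\<exists>c :: nat \<Rightarrow> complex. \<exists>r>0. \<forall>x. \<bar>x - t\<bar> < r \<longrightarrow> (\<lambda>n. (x - t) ^ n *\<^sub>R c n) sums \<gamma> x)"

text \<open>The rigid motion \<open>z \<mapsto> u * (z - c)\<close> with \<open>norm u = 1\<close>: translation taking \<open>c\<close> to the origin,
  followed by rotation.\<close>

definition rigid :: "complex \<Rightarrow> complex \<Rightarrow> complex \<Rightarrow> complex" where
  "rigid u c z = u * (z - c)"

text \<open>The rotation \<open>u\<close> gives natural co-ordinates for \<open>\<gamma>\<close> at \<open>t\<^sub>0\<close>, in which \<open>\<gamma>\<close> has the Taylor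
  coefficients \<open>\<alpha>\<close> (first co-ordinate) and \<open>\<beta>\<close> (second co-ordinate). Only \<open>\<alpha> i\<close> for \<open>i \<ge> 2\<close> and
  \<open>\<beta> i\<close> for \<open>i \<ge> 3\<close> are relevant. The rotation is unique up to sign.\<close>

definition natural_coordinates ::
  "(real \<Rightarrow> complex) \<Rightarrow> real \<Rightarrow> complex \<Rightarrow> (nat \<Rightarrow> real) \<Rightarrow> (nat \<Rightarrow> real) \<Rightarrow> bool" where
  "natural_coordinates \<gamma> t\<^sub>0 u \<alpha> \<beta> \<longleftrightarrow>
     norm u = 1 \<and> \<alpha> 2 \<noteq> 0 \<and> \<beta> 3 \<noteq> 0 \<and>
     (\<exists>\<delta>'>0. \<forall>t\<in>{t\<^sub>0 - \<delta>'..t\<^sub>0 + \<delta>'}.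
        (\<lambda>i. \<alpha> (i + 2) * (t - t\<^sub>0) ^ (i + 2)) sums Re (rigid u (\<gamma> t\<^sub>0) (\<gamma> t)) \<and>
        (\<lambda>i. \<beta> (i + 3) * (t - t\<^sub>0) ^ (i + 3)) sums Im (rigid u (\<gamma> t\<^sub>0) (\<gamma> t)))"

definition cusp_singularity :: "(real \<Rightarrow> complex) \<Rightarrow> real \<Rightarrow> bool" where
  "cusp_singularity \<gamma> t\<^sub>0 \<longleftrightarrow>
     singularity \<gamma> t\<^sub>0 \<and>
     (\<exists>\<epsilon>>0. \<forall>t\<in>ball t\<^sub>0 \<epsilon>. real_analytic_at \<gamma> t) \<and>
     (\<exists>u \<alpha> \<beta>. natural_coordinates \<gamma> t\<^sub>0 u \<alpha> \<beta>)"

text \<open>A path \<open>g : [a,b] \<rightarrow> \<complex>\<close> is the triple \<open>(a, b, g)\<close>, with \<open>g\<close> extensional (\<^const>\<open>undefined\<close>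
  outside \<open>[a,b]\<close>), so that equality of triples is equality of paths.\<close>

type_synonym path = "real \<times> real \<times> (real \<Rightarrow> complex)"

definition path_space :: "path set" where
  "path_space = {(a, b, g). a < b \<and> g \<in> extensional {a..b}}"

definition restr :: "(real \<Rightarrow> complex) \<Rightarrow> real \<Rightarrow> real \<Rightarrow> path" where
  "restr g a b = (a, b, restrict g {a..b})"

text \<open>Values in \<^typ>\<open>ennreal\<close>, because members of \<^const>\<open>path_space\<close> need not be bounded.\<close>

definition sup_norm :: "(real \<Rightarrow> 'a::real_normed_vector) \<Rightarrow> ennreal" where
  "sup_norm h = (SUP t\<in>{0..1}. ennreal (norm (h t)))"

definition homeos :: "real \<Rightarrow> real \<Rightarrow> (real \<Rightarrow> real) set" where
  "homeos a b = {l. \<exists>l'. homeomorphism {0..1} {a..b} l l'}"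

definition path_dist :: "path \<Rightarrow> path \<Rightarrow> ennreal" where
  "path_dist = (\<lambda>(a\<^sub>1, b\<^sub>1, g\<^sub>1) (a\<^sub>2, b\<^sub>2, g\<^sub>2).
     INF (l\<^sub>1, l\<^sub>2)\<in>homeos a\<^sub>1 b\<^sub>1 \<times> homeos a\<^sub>2 b\<^sub>2.
       sup_norm (\<lambda>t. l\<^sub>1 t - l\<^sub>2 t) + sup_norm (\<lambda>t. g\<^sub>1 (l\<^sub>1 t) - g\<^sub>2 (l\<^sub>2 t)))"

definition tends_to_path :: "('i \<Rightarrow> path) \<Rightarrow> path \<Rightarrow> 'i filter \<Rightarrow> bool" where
  "tends_to_path L L\<^sub>0 F \<longleftrightarrow> ((\<lambda>i. path_dist (L i) L\<^sub>0) \<longlongrightarrow> 0) F"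

definition is_loop :: "path \<Rightarrow> bool" where
  "is_loop L \<longleftrightarrow> L \<in> path_space \<and>
     (case L of (a, b, g) \<Rightarrow> continuous_on {a..b} g \<and> g a = g b \<and> inj_on g {a..<b})"

definition loops_in :: "(real \<Rightarrow> complex) \<Rightarrow> real set \<Rightarrow> path set" where
  "loops_in g I = {L. is_loop L \<and> (\<exists>a b. {a..b} \<subseteq> I \<and> L = restr g a b)}"

definition loop_evolution :: "path \<Rightarrow> real \<Rightarrow> real \<Rightarrow> (real \<Rightarrow> path) \<Rightarrow> bool" where
  "loop_evolution L\<^sub>1 T\<^sub>1 T\<^sub>2 L \<longleftrightarrow>
     L T\<^sub>1 = L\<^sub>1 \<and>
     (\<forall>\<tau>\<in>{T\<^sub>1..<T\<^sub>2}. is_loop (L \<tau>) \<and> tends_to_path L (L \<tau>) (at \<tau> within {T\<^sub>1..<T\<^sub>2}))"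

definition loop_evolution_of ::
  "(real \<Rightarrow> real \<Rightarrow> complex) \<Rightarrow> (real \<Rightarrow> real) \<Rightarrow> (real \<Rightarrow> real) \<Rightarrow> real \<Rightarrow> real \<Rightarrow>
     (real \<Rightarrow> path) \<Rightarrow> bool" where
  "loop_evolution_of f a b T\<^sub>1 T\<^sub>2 L \<longleftrightarrow>
     loop_evolution (restr (\<lambda>p. f p T\<^sub>1) (a T\<^sub>1) (b T\<^sub>1)) T\<^sub>1 T\<^sub>2 L \<and>
     (\<forall>\<tau>\<in>{T\<^sub>1..<T\<^sub>2}. L \<tau> = restr (\<lambda>p. f p \<tau>) (a \<tau>) (b \<tau>))"

text \<open>The rescaling of \<open>f\<close> at \<open>(p\<^sub>0, \<tau>\<^sub>0)\<close>. The co-ordinates given by \<open>u\<close> and the base point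
  \<open>f p\<^sub>0 \<tau>\<^sub>0\<close> are the same for all times \<open>\<tau>\<^sub>0 - s\<close>. Since \<open>f\<close> solves the heat equation
  \<open>\<partial>\<^sub>\<tau> f = \<partial>\<^sub>p\<^sub>p f / 2\<close>, the limiting curve is \<open>P \<mapsto> (\<alpha> 2 * (P\<^sup>2 - 1), \<beta> 3 * (P\<^sup>3 - 3 * P))\<close>: it depends
  on the sample point and the cusp through \<open>\<alpha> 2\<close> and \<open>\<beta> 3\<close>, so a limiting loop is deterministic in
  the sense of being a fixed function of these two coefficients.\<close>

definition rescaled ::
  "(real \<Rightarrow> real \<Rightarrow> complex) \<Rightarrow> complex \<Rightarrow> real \<Rightarrow> real \<Rightarrow> real \<Rightarrow> real \<Rightarrow> complex" where
  "rescaled f u p\<^sub>0 \<tau>\<^sub>0 s P =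
     (let z = rigid u (f p\<^sub>0 \<tau>\<^sub>0) (f (p\<^sub>0 + sqrt s * P) (\<tau>\<^sub>0 - s))
      in Complex (s powr (-1) * Re z) (s powr (-3/2) * Im z))"

end

theory Submission imports Defs begin

text \<open>
  The randomness enters in one place only: almost every path \<open>w\<close> of the Brownian motion is continuous
  and satisfies \<open>\<integral> \<bar>w q\<bar> e\<^sup>-\<^sup>q dq < \<infinity>\<close> (\<open>AE_exp_integrable\<close>). For each such path the assertion is a
  deterministic statement about the solution \<open>f\<close> of the heat equation with initial value \<open>w\<close>, proved
  in \<open>cusp_unfolds_into_loop\<close>.

  Integrability against \<open>e\<^sup>-\<^sup>q\<close> allows differentiation under the integral, so \<open>f\<close> has continuous
  derivatives of all orders in \<open>p\<close>, and \<open>\<partial>\<^sub>\<tau>\<close> acts on them as \<open>\<partial>\<^sub>p\<^sub>p / 2\<close>. Give \<open>p\<close> weight one and \<open>\<tau>\<close>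
  weight two. A solution whose \<open>p\<close>-derivatives of order less than \<open>n\<close> vanish at a point is of order \<open>n\<close>
  in these weights (\<open>parabolic_vanishing_order\<close>). At a cusp with coefficients \<open>A = \<alpha> 2\<close> and \<open>B = \<beta> 3\<close>
  the first natural co-ordinate agrees up to second order with the caloric polynomial
  \<open>A (x\<^sup>2 + t)\<close>, the second one up to third order with \<open>B (x\<^sup>3 + 3 x t)\<close>. At \<open>x = \<sigma> P\<close>, \<open>t = - \<sigma>\<^sup>2\<close> the
  curve, divided by \<open>A \<sigma>\<^sup>2\<close> and \<open>B \<sigma>\<^sup>3\<close>, is therefore \<open>(P\<^sup>2 - 1, P\<^sup>3 - 3 P)\<close> up to an error
  of size \<open>O(\<sigma>)\<close> whose Lipschitz constant on \<open>[-3, 3]\<close> is \<open>O(\<sigma>)\<close> as well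
  (\<open>unfolding_curve_converges\<close>).

  The limiting curve has exactly one double point, at \<open>P = \<plusminus>\<surd>3\<close>. For a curve with an \<open>\<epsilon>\<close>-Lipschitz error, dividing
  both equations of a double point \<open>(a, b)\<close> by \<open>b - a\<close> turns them into a fixed point equation for
  \<open>(a + b, b - a)\<close> whose map is a contraction when \<open>\<epsilon>\<close> is small, so there is still exactly one double
  point, within \<open>2 \<epsilon>\<close> of the old one (\<open>unique_double_point\<close>, \<open>double_point_bounds\<close>). A curve with
  exactly one double point in an interval has exactly one loop there. Undoing the
  rescaling, with the interval \<open>[p\<^sub>0 - 3 \<surd>s, p\<^sub>0 + 3 \<surd>s]\<close> at time \<open>\<tau>\<^sub>0 - s\<close>, gives the loop of \<open>f\<close>; it moves
  continuously because a unique solution in a compact set depends continuously on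
  parameters.
\<close>

section \<open>Loops and double points\<close>

definition double_point :: "(real \<Rightarrow> 'a) \<Rightarrow> real set \<Rightarrow> real \<Rightarrow> real \<Rightarrow> bool" where
  "double_point \<gamma> J a b \<longleftrightarrow> a \<in> J \<and> b \<in> J \<and> a < b \<and> \<gamma> a = \<gamma> b"

text \<open>
  The end points of a loop form a double point. Conversely, the arc between the points of the only
  double point is injective before its end, since a repetition would be another double point.
\<close>

lemma loops_in_unique_double_point:
  assumes J: "is_interval J" and cont: "continuous_on J \<gamma>" and ab: "double_point \<gamma> J a b"
    and uniq: "\<And>s t. double_point \<gamma> J s t \<Longrightarrow> s = a \<and> t = b"
  shows "loops_in \<gamma> J = {restr \<gamma> a b}"
proof -
  have sub: "{a..b} \<subseteq> J"
    using J ab unfolding double_point_def is_interval_1 by (meson atLeastAtMost_iff subsetI)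
  have "inj_on \<gamma> {a..<b}"
  proof (rule linorder_inj_onI)
    fix s t assume st: "s < t" "s \<in> {a..<b}" "t \<in> {a..<b}"
    show "\<gamma> s \<noteq> \<gamma> t"
    proof
      assume "\<gamma> s = \<gamma> t"
      then have "double_point \<gamma> J s t" using st sub by (auto simp: double_point_def)
      from uniq[OF this] st show False by simp
    qed
  qed auto
  moreover have "continuous_on {a..b} (restrict \<gamma> {a..b})"
    by (rule continuous_on_eq[OF continuous_on_subset[OF cont sub]]) simp
  moreover from \<open>inj_on \<gamma> {a..<b}\<close> have "inj_on (restrict \<gamma> {a..b}) {a..<b}"
    by (rule inj_on_cong[THEN iffD1, rotated]) simp
  ultimately have "is_loop (restr \<gamma> a b)"
    using ab by (simp add: is_loop_def restr_def path_space_def double_point_def)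
  moreover have "L = restr \<gamma> a b" if "is_loop L" "{c..d} \<subseteq> J" "L = restr \<gamma> c d" for L c d
  proof -
    have "double_point \<gamma> J c d"
      using that by (auto simp: is_loop_def restr_def path_space_def double_point_def)
    from uniq[OF this] that(3) show ?thesis by simp
  qed
  ultimately show ?thesis using sub unfolding loops_in_def by blast
qed

lemma homeos_affine:
  assumes "a < b" shows "(\<lambda>t. a + t * (b - a)) \<in> homeos a b"
proof -
  have "homeomorphism {0..1} {a..b} (\<lambda>t. a + t * (b - a)) (\<lambda>x. (x - a) / (b - a))"
  proof (rule homeomorphismI)
    show "(\<lambda>t. a + t * (b - a)) ` {0..1} \<subseteq> {a..b}"
    proof (rule image_subsetI)
      fix t :: real assume "t \<in> {0..1}"
      then have "0 \<le> t * (b - a)" "t * (b - a) \<le> 1 * (b - a)"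
        using assms by (auto intro!: mult_nonneg_nonneg mult_right_mono)
      then show "a + t * (b - a) \<in> {a..b}" by auto
    qed
  qed (use assms in \<open>auto intro!: continuous_intros simp: field_simps\<close>)
  then show ?thesis by (auto simp: homeos_def)
qed

text \<open>
  Both paths are parametrised by the affine maps of \<open>[0,1]\<close> onto their domains. These stay as close as
  the end points are.
\<close>

lemma path_dist_restr_le:
  assumes ab: "a1 < b1" "a2 < b2"
    and e: "\<bar>a1 - a2\<bar> \<le> e" "\<bar>b1 - b2\<bar> \<le> e"
    and g: "\<And>x y. x \<in> {a1..b1} \<Longrightarrow> y \<in> {a2..b2} \<Longrightarrow> \<bar>x - y\<bar> \<le> e \<Longrightarrow> dist (g1 x) (g2 y) \<le> e'"
  shows "path_dist (restr g1 a1 b1) (restr g2 a2 b2) \<le> ennreal (e + e')"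
proof -
  define l1 where "l1 t = a1 + t * (b1 - a1)" for t
  define l2 where "l2 t = a2 + t * (b2 - a2)" for t
  have h: "l1 \<in> homeos a1 b1" "l2 \<in> homeos a2 b2"
    unfolding l1_def[abs_def] l2_def[abs_def] using ab homeos_affine by auto
  have img: "l1 t \<in> {a1..b1}" "l2 t \<in> {a2..b2}" if "t \<in> {0..1}" for t
    using h that by (auto simp: homeos_def homeomorphism_def)
  have close: "\<bar>l1 t - l2 t\<bar> \<le> e" if "t \<in> {0..1}" for t
  proof -
    have "l1 t - l2 t = (1 - t) * (a1 - a2) + t * (b1 - b2)"
      by (simp add: l1_def l2_def algebra_simps)
    also have "\<bar>\<dots>\<bar> \<le> (1 - t) * \<bar>a1 - a2\<bar> + t * \<bar>b1 - b2\<bar>"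
      using that by (intro order.trans[OF abs_triangle_ineq]) (simp add: abs_mult)
    also have "\<dots> \<le> (1 - t) * e + t * e"
      using e that by (intro add_mono mult_left_mono) auto
    finally show ?thesis by (simp add: algebra_simps)
  qed
  have e0: "0 \<le> e" using e by linarith
  have 0: "(0::real) \<in> {0..1}" by simp
  have "0 \<le> e'" using g[OF img[OF 0] close[OF 0]] zero_le_dist order_trans by blast
  have "path_dist (restr g1 a1 b1) (restr g2 a2 b2) \<le>
     sup_norm (\<lambda>t. l1 t - l2 t) +
     sup_norm (\<lambda>t. restrict g1 {a1..b1} (l1 t) - restrict g2 {a2..b2} (l2 t))"
    unfolding path_dist_def restr_def using h by (auto intro!: INF_lower2[of "(l1, l2)"])
  also have "\<dots> \<le> ennreal e + ennreal e'"
  proof (unfold sup_norm_def, intro add_mono SUP_least ennreal_leI)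
    fix t :: real assume t: "t \<in> {0..1}"
    show "norm (l1 t - l2 t) \<le> e" using close[OF t] by simp
    show "norm (restrict g1 {a1..b1} (l1 t) - restrict g2 {a2..b2} (l2 t)) \<le> e'"
      using g[OF img[OF t] close[OF t]] img[OF t] by (simp add: dist_norm)
  qed
  finally show ?thesis using e0 \<open>0 \<le> e'\<close> by (simp add: ennreal_plus)
qed

text \<open>
  The uniform continuity of the limit absorbs the movement of the end points.
\<close>

lemma tends_to_path_restr:
  assumes g: "uniform_limit {A..B} g g0 F" and cont: "continuous_on {A..B} g0"
    and a: "(a \<longlongrightarrow> a0) F" and b: "(b \<longlongrightarrow> b0) F"
    and ab: "\<forall>\<^sub>F i in F. A \<le> a i \<and> a i < b i \<and> b i \<le> B" and ab0: "A \<le> a0" "a0 < b0" "b0 \<le> B"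
  shows "tends_to_path (\<lambda>i. restr (g i) (a i) (b i)) (restr g0 a0 b0) F"
  unfolding tends_to_path_def
proof (rule order_tendstoI)
  fix c :: ennreal assume "0 < c"
  then obtain d where d: "0 < d" "d < c" by (metis dense)
  then obtain r where "d = ennreal r" by (cases d) auto
  with d have r: "0 < ennreal r" "ennreal r < c" by auto
  then have r0: "0 < r" by simp
  have "uniformly_continuous_on {A..B} g0"
    using cont by (rule compact_uniformly_continuous) simp
  then obtain d where d: "0 < d"
    "\<And>x y. x \<in> {A..B} \<Longrightarrow> y \<in> {A..B} \<Longrightarrow> dist x y < d \<Longrightarrow> dist (g0 x) (g0 y) < r / 4"
    using r0 by (elim uniformly_continuous_onE[of _ _ "r / 4"]) (auto simp: dist_commute)
  define e where "e = min (d / 2) (r / 4)"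
  have e: "0 < e" "e < d" "e \<le> r / 4" using d r0 by (auto simp: e_def)
  have "\<forall>\<^sub>F i in F. \<forall>x\<in>{A..B}. dist (g i x) (g0 x) < r / 4"
    using uniform_limitD[OF g, of "r / 4"] r0 by simp
  moreover have "\<forall>\<^sub>F i in F. dist (a i) a0 < e" "\<forall>\<^sub>F i in F. dist (b i) b0 < e"
    using tendstoD[OF a e(1)] tendstoD[OF b e(1)] .
  ultimately have "\<forall>\<^sub>F i in F. path_dist (restr (g i) (a i) (b i)) (restr g0 a0 b0) \<le> ennreal (e + r / 2)"
    using ab
  proof eventually_elim
    case (elim i)
    show ?case
    proof (rule path_dist_restr_le)
      fix x y assume xy: "x \<in> {a i..b i}" "y \<in> {a0..b0}" "\<bar>x - y\<bar> \<le> e"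
      then have J: "x \<in> {A..B}" "y \<in> {A..B}" "dist x y < d"
        using elim ab0 e by (auto simp: dist_real_def)
      then have "dist (g i x) (g0 x) < r / 4" "dist (g0 x) (g0 y) < r / 4"
        using elim d by blast+
      then show "dist (g i x) (g0 y) \<le> r / 2"
        using dist_triangle[of "g i x" "g0 y" "g0 x"] by linarith
    qed (use elim ab0 in \<open>auto simp: dist_real_def\<close>)
  qed
  then show "\<forall>\<^sub>F i in F. path_dist (restr (g i) (a i) (b i)) (restr g0 a0 b0) < c"
  proof eventually_elim
    case (elim i)
    also have "ennreal (e + r / 2) \<le> ennreal r" using e r0 by (intro ennreal_leI) auto
    finally show ?case using r(2) by (rule le_less_trans)
  qed
qed simp

section \<open>Small perturbations of the limiting curve\<close>

definition divided_difference :: "(real \<Rightarrow> real) \<Rightarrow> real \<Rightarrow> real \<Rightarrow> real" where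
  "divided_difference r a b = (r b - r a) / (b - a)"

lemma abs_divided_difference_le:
  assumes "\<epsilon>-lipschitz_on J r" "a \<in> J" "b \<in> J" "a < b"
  shows "\<bar>divided_difference r a b\<bar> \<le> \<epsilon>"
  using lipschitz_onD[OF assms(1,3,2)] assms(4)
  by (auto simp: divided_difference_def dist_real_def abs_divide divide_le_eq)

text \<open>
  The quotient of differences of a function with a small Lipschitz constant is itself Lipschitz in the
  pair of its arguments with a small constant, provided that the arguments stay apart. This is why
  no second derivative of the error has to be controlled.
\<close>

lemma divided_difference_diff_le:
  assumes r: "\<epsilon>-lipschitz_on J r" and J: "a \<in> J" "b \<in> J" "a' \<in> J" "b' \<in> J"
    and d: "3 \<le> b - a" "3 \<le> b' - a'"
  shows "\<bar>divided_difference r a b - divided_difference r a' b'\<bar> \<le>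
           2 / 3 * \<epsilon> * (\<bar>a - a'\<bar> + \<bar>b - b'\<bar>)"
proof -
  define R where "R = divided_difference r a' b'"
  define u where "u = (r b - r b') - (r a - r a') + R * ((b' - a') - (b - a))"
  have \<epsilon>: "0 \<le> \<epsilon>" using r by (rule lipschitz_on_nonneg)
  have R: "\<bar>R\<bar> \<le> \<epsilon>" unfolding R_def using abs_divided_difference_le[OF r J(3,4)] d by auto
  have "\<bar>R * ((b' - a') - (b - a))\<bar> \<le> \<epsilon> * (\<bar>a - a'\<bar> + \<bar>b - b'\<bar>)"
    unfolding abs_mult using R \<epsilon> by (intro mult_mono) auto
  moreover have "\<bar>r b - r b'\<bar> \<le> \<epsilon> * \<bar>b - b'\<bar>" "\<bar>r a - r a'\<bar> \<le> \<epsilon> * \<bar>a - a'\<bar>"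
    using lipschitz_onD[OF r] J by (auto simp: dist_real_def)
  ultimately have "\<bar>u\<bar> \<le> 2 * \<epsilon> * (\<bar>a - a'\<bar> + \<bar>b - b'\<bar>)"
    unfolding u_def using \<epsilon> by (simp only: distrib_left distrib_right mult.assoc) linarith
  moreover have "divided_difference r a b - R = u / (b - a)"
  proof -
    have "R * (b' - a') = r b' - r a'" using d by (simp add: R_def divided_difference_def)
    then have "u = (r b - r a) - R * (b - a)" by (simp add: u_def algebra_simps)
    then show ?thesis using d by (simp add: divided_difference_def field_simps)
  qed
  moreover have "\<bar>u / (b - a)\<bar> \<le> \<bar>u\<bar> / 3"
    unfolding abs_divide using d by (intro divide_left_mono) auto
  ultimately show ?thesis by (simp add: R_def)
qed

context
  fixes x y :: "real \<Rightarrow> real" and \<epsilon> :: real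
  assumes x: "\<epsilon>-lipschitz_on {-3..3} (\<lambda>P. x P - P\<^sup>2)"
    and y: "\<epsilon>-lipschitz_on {-3..3} (\<lambda>P. y P - (P ^ 3 - 3 * P))"
    and \<epsilon>: "\<epsilon> \<le> 1 / 10"
begin

definition x_slope where "x_slope a b = divided_difference (\<lambda>P. x P - P\<^sup>2) a b"
definition y_slope where "y_slope a b = divided_difference (\<lambda>P. y P - (P ^ 3 - 3 * P)) a b"

text \<open>
  The equations \<open>x a = x b\<close> and \<open>y a = y b\<close> divided by \<open>b - a\<close>, in terms of the sum \<open>a + b\<close> and the
  difference \<open>b - a\<close>: for the unperturbed curve they read \<open>a + b = 0\<close> and \<open>(b - a)\<^sup>2 + 3 (a + b)\<^sup>2 = 12\<close>.
\<close>

lemma double_point_iff: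
  "double_point (\<lambda>P. (x P, y P)) {-3..3} a b \<longleftrightarrow>
     a \<in> {-3..3} \<and> b \<in> {-3..3} \<and> a < b \<and> a + b = - x_slope a b \<and>
     (b - a)\<^sup>2 = 12 - 3 * (x_slope a b)\<^sup>2 - 4 * y_slope a b" (is "?l \<longleftrightarrow> ?r")
proof (cases "a < b")
  case True
  have 1: "x b - x a = (b - a) * (a + b + x_slope a b)"
    using True by (simp add: x_slope_def divided_difference_def field_simps power2_eq_square)
  have 2: "y b - y a = (b - a) * (a\<^sup>2 + a * b + b\<^sup>2 - 3 + y_slope a b)"
    using True by (simp add: y_slope_def divided_difference_def field_simps power2_eq_square power3_eq_cube)
  have "x a = x b \<longleftrightarrow> a + b = - x_slope a b" using 1 True by auto
  moreover have "y a = y b \<longleftrightarrow> 3 * (a + b)\<^sup>2 + (b - a)\<^sup>2 = 12 - 4 * y_slope a b"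
  proof -
    have "y a = y b \<longleftrightarrow> a\<^sup>2 + a * b + b\<^sup>2 - 3 + y_slope a b = 0" using 2 True by auto
    also have "\<dots> \<longleftrightarrow> 4 * (a\<^sup>2 + a * b + b\<^sup>2) = 12 - 4 * y_slope a b"
      by argo
    also have "4 * (a\<^sup>2 + a * b + b\<^sup>2) = 3 * (a + b)\<^sup>2 + (b - a)\<^sup>2"
      by (simp add: power2_eq_square algebra_simps)
    finally show ?thesis .
  qed
  ultimately show ?thesis using True by (auto simp: double_point_def)
qed (auto simp: double_point_def)

lemma \<epsilon>_nonneg: "0 \<le> \<epsilon>" using x by (rule lipschitz_on_nonneg)

lemma slope_bounds:
  assumes "a \<in> {-3..3}" "b \<in> {-3..3}" "a < b"
  shows "\<bar>x_slope a b\<bar> \<le> \<epsilon>" "\<bar>y_slope a b\<bar> \<le> \<epsilon>" "3 * (x_slope a b)\<^sup>2 \<le> \<epsilon>"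
    "12 - 3 * (x_slope a b)\<^sup>2 - 4 * y_slope a b \<in> {3\<^sup>2..4\<^sup>2}"
proof -
  show R: "\<bar>x_slope a b\<bar> \<le> \<epsilon>" "\<bar>y_slope a b\<bar> \<le> \<epsilon>"
    using abs_divided_difference_le x y assms unfolding x_slope_def y_slope_def by blast+
  have "\<bar>x_slope a b\<bar> * \<bar>x_slope a b\<bar> \<le> \<epsilon> * (1/10)" using R \<epsilon> \<epsilon>_nonneg by (intro mult_mono) auto
  then show sq: "3 * (x_slope a b)\<^sup>2 \<le> \<epsilon>" using \<epsilon>_nonneg by (simp add: power2_eq_square abs_mult_self_eq)
  have "12 - 3 * (x_slope a b)\<^sup>2 - 4 * y_slope a b \<le> 16"
    using R(2) \<epsilon> zero_le_power2[of "x_slope a b"] by linarith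
  with R sq \<epsilon> show "12 - 3 * (x_slope a b)\<^sup>2 - 4 * y_slope a b \<in> {3\<^sup>2..4\<^sup>2}" by simp
qed

text \<open>
  From \<open>double_point_iff\<close>, the sum \<open>a + b\<close> is within \<open>\<epsilon>\<close> of \<open>0\<close>, and \<open>(b - a)\<^sup>2\<close> within \<open>5 \<epsilon>\<close> of \<open>12\<close>.
\<close>

lemma double_point_bounds:
  assumes "double_point (\<lambda>P. (x P, y P)) {-3..3} a b"
  shows "\<bar>a + sqrt 3\<bar> \<le> 2 * \<epsilon>" "\<bar>b - sqrt 3\<bar> \<le> 2 * \<epsilon>" "3 \<le> b - a" "b - a \<le> 4" "\<bar>a + b\<bar> \<le> 1"
proof -
  have ab: "a \<in> {-3..3}" "b \<in> {-3..3}" "a < b" and m: "a + b = - x_slope a b"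
    and d: "(b - a)\<^sup>2 = 12 - 3 * (x_slope a b)\<^sup>2 - 4 * y_slope a b"
    using assms by (auto simp: double_point_iff)
  note RQ = slope_bounds[OF ab]
  show "\<bar>a + b\<bar> \<le> 1" using m RQ \<epsilon> by auto
  have "3\<^sup>2 \<le> (b - a)\<^sup>2" "(b - a)\<^sup>2 \<le> 4\<^sup>2" unfolding d using RQ(4) by simp_all
  then show d3: "3 \<le> b - a" "b - a \<le> 4" using ab power2_le_imp_le by (smt (verit))+
  have s: "sqrt 3 \<ge> 0" "(sqrt 3)\<^sup>2 = 3" by auto
  have "(b - a - 2 * sqrt 3) * (b - a + 2 * sqrt 3) = (b - a)\<^sup>2 - 4 * (sqrt 3)\<^sup>2"
    by (simp add: power2_eq_square algebra_simps)
  then have "(b - a - 2 * sqrt 3) * (b - a + 2 * sqrt 3) = - 3 * (x_slope a b)\<^sup>2 - 4 * y_slope a b"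
    using d s by simp
  then have "\<bar>b - a - 2 * sqrt 3\<bar> * \<bar>b - a + 2 * sqrt 3\<bar> = \<bar>- 3 * (x_slope a b)\<^sup>2 - 4 * y_slope a b\<bar>"
    unfolding abs_mult[symmetric] by (rule arg_cong)
  also have "\<dots> \<le> 5 * \<epsilon>"
    using RQ(2,3) \<epsilon>_nonneg zero_le_power2[of "x_slope a b"] by (intro abs_leI; linarith)
  finally have "\<bar>b - a - 2 * sqrt 3\<bar> * \<bar>b - a + 2 * sqrt 3\<bar> \<le> 5 * \<epsilon>" .
  moreover have "\<bar>b - a - 2 * sqrt 3\<bar> * 3 \<le> \<bar>b - a - 2 * sqrt 3\<bar> * \<bar>b - a + 2 * sqrt 3\<bar>"
    using d3(1) s(1) by (intro mult_left_mono) linarith+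
  ultimately have "\<bar>b - a - 2 * sqrt 3\<bar> * 3 \<le> 5 * \<epsilon>" by (rule order_trans[rotated])
  also have "\<dots> \<le> (2 * \<epsilon>) * 3" using \<epsilon>_nonneg by simp
  finally have "\<bar>b - a - 2 * sqrt 3\<bar> \<le> 2 * \<epsilon>" by simp
  moreover have "\<bar>a + b\<bar> \<le> \<epsilon>" using m RQ by auto
  ultimately show "\<bar>a + sqrt 3\<bar> \<le> 2 * \<epsilon>" "\<bar>b - sqrt 3\<bar> \<le> 2 * \<epsilon>" using \<epsilon>_nonneg by linarith+
qed

text \<open>
  Double points are the fixed points of a contraction of a rectangle of pairs \<open>(a + b, b - a)\<close>, by
  \<open>double_point_iff\<close>, and Banach's fixed point theorem applies.
\<close>

theorem unique_double_point:
  "\<exists>a b. double_point (\<lambda>P. (x P, y P)) {-3..3} a b \<and>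
     (\<forall>s t. double_point (\<lambda>P. (x P, y P)) {-3..3} s t \<longrightarrow> s = a \<and> t = b)"
proof -
  \<comment> \<open>The rectangle contains all solutions by \<open>double_point_bounds\<close>; on it \<open>a\<close> and \<open>b\<close> stay in \<open>[-3, 3]\<close>.\<close>
  define S where "S = {-1..1::real} \<times> {3..4::real}"
  define T where "T = (\<lambda>(m, d). let a = (m - d) / 2; b = (m + d) / 2 in
    (- x_slope a b, sqrt (12 - 3 * (x_slope a b)\<^sup>2 - 4 * y_slope a b)))"
  have S: "(m - d) / 2 \<in> {-3..3}" "(m + d) / 2 \<in> {-3..3}" "(m - d) / 2 < (m + d) / 2"
    if "(m, d) \<in> S" for m d using that by (auto simp: S_def field_simps)
  have sqrt_in: "sqrt (12 - 3 * (x_slope a b)\<^sup>2 - 4 * y_slope a b) \<in> {3..4}"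
    if "a \<in> {-3..3}" "b \<in> {-3..3}" "a < b" for a b
    using slope_bounds(4)[OF that] by (auto intro!: real_le_rsqrt real_le_lsqrt)
  have TS: "T ` S \<subseteq> S"
  proof (rule image_subsetI)
    fix z assume "z \<in> S"
    moreover obtain m d where "z = (m, d)" by fastforce
    ultimately have md: "(m, d) \<in> S" "T z = T (m, d)" by simp_all
    show "T z \<in> S" unfolding md(2)
      using sqrt_in[OF S[OF md(1)]] slope_bounds[OF S[OF md(1)]] \<epsilon>
      by (auto simp: T_def Let_def S_def)
  qed
  have contraction: "dist (T z) (T z') \<le> 4/10 * dist z z'" if z: "z \<in> S" "z' \<in> S" for z z'
  proof -
    obtain m d m' d' where md: "z = (m, d)" "z' = (m', d')" by fastforce
    define a b a' b' where ab: "a = (m - d) / 2" "b = (m + d) / 2" "a' = (m' - d') / 2" "b' = (m' + d') / 2"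
    have J: "a \<in> {-3..3}" "b \<in> {-3..3}" "a < b" "a' \<in> {-3..3}" "b' \<in> {-3..3}" "a' < b'"
      "3 \<le> b - a" "3 \<le> b' - a'"
      using S[of m d] S[of m' d'] z by (auto simp: md ab S_def field_simps)
    define D where "D = \<bar>a - a'\<bar> + \<bar>b - b'\<bar>"
    have "D \<le> \<bar>m - m'\<bar> + \<bar>d - d'\<bar>" by (auto simp: D_def ab abs_if field_simps)
    moreover have "\<bar>m - m'\<bar> \<le> dist z z'" "\<bar>d - d'\<bar> \<le> dist z z'"
      using dist_fst_le[of z z'] dist_snd_le[of z z'] by (auto simp: md dist_real_def)
    ultimately have D: "0 \<le> D" "D \<le> 2 * dist z z'" by (auto simp: D_def)
    define \<rho> \<rho>' \<kappa> \<kappa>' where RQ: "\<rho> = x_slope a b" "\<rho>' = x_slope a' b'" "\<kappa> = y_slope a b" "\<kappa>' = y_slope a' b'"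
    have \<rho>: "\<bar>\<rho> - \<rho>'\<bar> \<le> 2 / 3 * \<epsilon> * D" and \<kappa>: "\<bar>\<kappa> - \<kappa>'\<bar> \<le> 2 / 3 * \<epsilon> * D"
      unfolding RQ x_slope_def y_slope_def D_def
      by (intro divided_difference_diff_le[OF x] divided_difference_diff_le[OF y] J)+
    define \<eta> \<eta>' where \<eta>: "\<eta> = sqrt (12 - 3 * \<rho>\<^sup>2 - 4 * \<kappa>)" "\<eta>' = sqrt (12 - 3 * \<rho>'\<^sup>2 - 4 * \<kappa>')"
    have \<eta>3: "\<eta> \<in> {3..4}" "\<eta>' \<in> {3..4}" using sqrt_in J unfolding \<eta> RQ by blast+
    have pos: "\<eta>\<^sup>2 = 12 - 3 * \<rho>\<^sup>2 - 4 * \<kappa>" "\<eta>'\<^sup>2 = 12 - 3 * \<rho>'\<^sup>2 - 4 * \<kappa>'"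
      using slope_bounds[of a b] slope_bounds[of a' b'] J \<epsilon> unfolding \<eta> RQ by auto
    have "\<bar>\<rho>\<bar> \<le> \<epsilon>" "\<bar>\<rho>'\<bar> \<le> \<epsilon>" using slope_bounds(1) J unfolding RQ by blast+
    then have small: "\<bar>3 * (\<rho> + \<rho>')\<bar> \<le> 1" using \<epsilon> by (simp add: abs_le_iff)
    have "(\<eta> - \<eta>') * (\<eta> + \<eta>') = - (3 * (\<rho> + \<rho>') * (\<rho> - \<rho>') + 4 * (\<kappa> - \<kappa>'))"
      using pos by (simp add: power2_eq_square algebra_simps)
    then have "\<bar>\<eta> - \<eta>'\<bar> * \<bar>\<eta> + \<eta>'\<bar> = \<bar>3 * (\<rho> + \<rho>') * (\<rho> - \<rho>') + 4 * (\<kappa> - \<kappa>')\<bar>"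
      unfolding abs_mult[symmetric] by simp
    also have "\<dots> \<le> \<bar>3 * (\<rho> + \<rho>')\<bar> * \<bar>\<rho> - \<rho>'\<bar> + 4 * \<bar>\<kappa> - \<kappa>'\<bar>"
      by (rule order.trans[OF abs_triangle_ineq]) (simp only: abs_mult abs_numeral order_refl)
    also have "\<dots> \<le> 1 * (2 / 3 * \<epsilon> * D) + 4 * (2 / 3 * \<epsilon> * D)"
      by (intro add_mono mult_mono small \<rho> \<kappa>) auto
    finally have "\<bar>\<eta> - \<eta>'\<bar> * \<bar>\<eta> + \<eta>'\<bar> \<le> 10 / 3 * \<epsilon> * D" by (simp add: mult_ac)
    moreover have "\<bar>\<eta> - \<eta>'\<bar> * 6 \<le> \<bar>\<eta> - \<eta>'\<bar> * \<bar>\<eta> + \<eta>'\<bar>" using \<eta>3 by (intro mult_left_mono) auto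
    ultimately have "\<bar>\<eta> - \<eta>'\<bar> * 6 \<le> 10 / 3 * \<epsilon> * D" by (rule order_trans[rotated])
    then have \<eta>d: "\<bar>\<eta> - \<eta>'\<bar> \<le> 5 / 9 * \<epsilon> * D" by (simp add: mult_ac)
    have "dist (T z) (T z') \<le> \<bar>\<rho> - \<rho>'\<bar> + \<bar>\<eta> - \<eta>'\<bar>"
      unfolding md T_def Let_def prod.case ab[symmetric] RQ[symmetric] \<eta>[symmetric] dist_Pair_Pair
      using sqrt_sum_squares_le_sum_abs[of "dist (-\<rho>) (-\<rho>')" "dist \<eta> \<eta>'"] by (simp add: dist_real_def)
    also have "\<dots> \<le> 2 / 3 * \<epsilon> * D + 5 / 9 * \<epsilon> * D" using \<rho> \<eta>d by (rule add_mono)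
    also have "\<dots> \<le> 2 * \<epsilon> * D" using mult_nonneg_nonneg[OF \<epsilon>_nonneg D(1)] by (simp add: mult_ac)
    also have "\<dots> \<le> 2 * (1/10) * (2 * dist z z')"
      using D \<epsilon> \<epsilon>_nonneg by (intro mult_mono) auto
    finally show ?thesis by simp
  qed
  have "\<exists>!z\<in>S. T z = z"
  proof (rule Banach_fix[OF compact_imp_complete, of S "4/10" T])
    show "compact S" unfolding S_def by (intro compact_Times) auto
    show "S \<noteq> {}" by (auto simp: S_def)
  qed (use TS contraction in auto)
  then obtain m d where md: "(m, d) \<in> S" "T (m, d) = (m, d)"
    and uniq: "\<And>z. z \<in> S \<Longrightarrow> T z = z \<Longrightarrow> z = (m, d)" by (metis surj_pair)
  define a b where ab: "a = (m - d) / 2" "b = (m + d) / 2"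
  have J: "a \<in> {-3..3}" "b \<in> {-3..3}" "a < b" using S[OF md(1)] unfolding ab by auto
  have "- x_slope a b = m" "sqrt (12 - 3 * (x_slope a b)\<^sup>2 - 4 * y_slope a b) = d"
    using md(2) by (auto simp: T_def Let_def ab)
  moreover have "m = a + b" "d = b - a" by (auto simp: ab field_simps)
  moreover have "0 \<le> 12 - 3 * (x_slope a b)\<^sup>2 - 4 * y_slope a b" using slope_bounds[OF J] \<epsilon> by auto
  ultimately have "double_point (\<lambda>P. (x P, y P)) {-3..3} a b"
    unfolding double_point_iff using J by (metis real_sqrt_pow2)
  moreover have "s = a \<and> t = b" if st: "double_point (\<lambda>P. (x P, y P)) {-3..3} s t" for s t
  proof -
    have "(s + t, t - s) \<in> S" using double_point_bounds[OF st] by (auto simp: S_def)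
    moreover have "T (s + t, t - s) = (s + t, t - s)"
    proof -
      have "(t - s)\<^sup>2 = 12 - 3 * (x_slope s t)\<^sup>2 - 4 * y_slope s t" "s + t = - x_slope s t" "s < t"
        using st by (auto simp: double_point_iff)
      moreover have "sqrt ((t - s)\<^sup>2) = t - s" using \<open>s < t\<close> by simp
      moreover have "(s + t - (t - s)) / 2 = s" "(s + t + (t - s)) / 2 = t" by simp_all
      ultimately show ?thesis unfolding T_def Let_def prod.case by metis
    qed
    ultimately have "(s + t, t - s) = (m, d)" by (rule uniq)
    then show ?thesis by (auto simp: ab)
  qed
  ultimately show ?thesis by blast
qed

end

section \<open>Smoothing a path by the heat kernel\<close>

text \<open>
  The filter \<open>at \<theta>0\<close> of a metric space is probed by sequences, along which dominated convergence applies.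
\<close>

lemma integral_tendsto_dominated:
  fixes K :: "'a::metric_space \<Rightarrow> 'b \<Rightarrow> complex"
  assumes meas: "\<And>\<theta>. K \<theta> \<in> borel_measurable N" and measL: "L \<in> borel_measurable N"
    and B: "integrable N B" and dom: "\<forall>\<^sub>F \<theta> in at \<theta>0. \<forall>q. norm (K \<theta> q) \<le> B q"
    and lim: "\<And>q. ((\<lambda>\<theta>. K \<theta> q) \<longlongrightarrow> L q) (at \<theta>0)"
  shows "((\<lambda>\<theta>. LINT q|N. K \<theta> q) \<longlongrightarrow> (LINT q|N. L q)) (at \<theta>0)"
  unfolding tendsto_at_iff_sequentially
proof (intro allI impI)
  fix X :: "nat \<Rightarrow> 'a" assume X: "\<forall>i. X i \<in> UNIV - {\<theta>0}" "X \<longlonglongrightarrow> \<theta>0"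
  then have F: "filterlim X (at \<theta>0) sequentially" by (auto simp: filterlim_at)
  obtain n0 where n0: "\<And>n q. n0 \<le> n \<Longrightarrow> norm (K (X n) q) \<le> B q"
    using filterlim_iff[THEN iffD1, OF F, rule_format, OF dom] by (auto simp: eventually_sequentially)
  show "((\<lambda>\<theta>. LINT q|N. K \<theta> q) \<circ> X) \<longlonglongrightarrow> (LINT q|N. L q)"
    unfolding o_def
  proof (rule LIMSEQ_offset[of _ n0], rule integral_dominated_convergence[OF measL meas B])
    show "AE q in N. (\<lambda>i. K (X (i + n0)) q) \<longlonglongrightarrow> L q"
      by (intro AE_I2 LIMSEQ_ignore_initial_segment filterlim_compose[OF lim F])
  qed (use n0 in auto)
qed

text \<open>
  A bound on the derivative of the integrand bounds its difference quotients by the mean value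
  theorem, so that they converge under the integral.
\<close>

lemma integral_has_vector_derivative_dominated:
  fixes K K' :: "real \<Rightarrow> 'b \<Rightarrow> real" and w :: "'b \<Rightarrow> complex"
  assumes r: "0 < r" and meas: "\<And>\<theta>. K \<theta> \<in> borel_measurable N" "K' \<theta>0 \<in> borel_measurable N"
    "w \<in> borel_measurable N"
    and deriv: "\<And>\<theta> q. \<theta> \<in> ball \<theta>0 r \<Longrightarrow> ((\<lambda>\<theta>. K \<theta> q) has_real_derivative K' \<theta> q) (at \<theta>)"
    and bound: "\<And>\<theta> q. \<theta> \<in> ball \<theta>0 r \<Longrightarrow> \<bar>K \<theta> q\<bar> \<le> B q" "\<And>\<theta> q. \<theta> \<in> ball \<theta>0 r \<Longrightarrow> \<bar>K' \<theta> q\<bar> \<le> B q"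
    and int: "integrable N (\<lambda>q. B q * norm (w q))"
  shows "((\<lambda>\<theta>. LINT q|N. K \<theta> q *\<^sub>R w q) has_vector_derivative (LINT q|N. K' \<theta>0 q *\<^sub>R w q)) (at \<theta>0)"
proof -
  let ?I = "\<lambda>\<theta>. LINT q|N. K \<theta> q *\<^sub>R w q"
  have "((\<lambda>\<theta>. LINT q|N. ((K \<theta> q - K \<theta>0 q) / (\<theta> - \<theta>0)) *\<^sub>R w q) \<longlongrightarrow> (LINT q|N. K' \<theta>0 q *\<^sub>R w q)) (at \<theta>0)"
  proof (rule integral_tendsto_dominated[OF _ _ int])
    have "\<forall>\<^sub>F \<theta> in at \<theta>0. \<theta> \<in> ball \<theta>0 r - {\<theta>0}"
      using r by (intro eventually_at_in_open) auto
    then show "\<forall>\<^sub>F \<theta> in at \<theta>0. \<forall>q. norm (((K \<theta> q - K \<theta>0 q) / (\<theta> - \<theta>0)) *\<^sub>R w q) \<le> B q * norm (w q)"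
    proof (eventually_elim, intro allI)
      fix \<theta> q assume \<theta>: "\<theta> \<in> ball \<theta>0 r - {\<theta>0}"
      have "norm (K \<theta> q - K \<theta>0 q) \<le> B q * norm (\<theta> - \<theta>0)"
        using \<theta> r by (intro field_differentiable_bound[of "ball \<theta>0 r" "\<lambda>\<theta>. K \<theta> q" "\<lambda>\<theta>. K' \<theta> q"])
          (auto intro!: bound intro: DERIV_subset[OF deriv])
      then have "\<bar>(K \<theta> q - K \<theta>0 q) / (\<theta> - \<theta>0)\<bar> \<le> B q"
        using \<theta> by (auto simp: abs_divide divide_le_eq)
      then show "norm (((K \<theta> q - K \<theta>0 q) / (\<theta> - \<theta>0)) *\<^sub>R w q) \<le> B q * norm (w q)"
        unfolding norm_scaleR by (rule mult_right_mono) simp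
    qed
    show "((\<lambda>\<theta>. ((K \<theta> q - K \<theta>0 q) / (\<theta> - \<theta>0)) *\<^sub>R w q) \<longlongrightarrow> K' \<theta>0 q *\<^sub>R w q) (at \<theta>0)" for q
      using deriv[of \<theta>0 q] r by (auto intro!: tendsto_intros simp: has_field_derivative_iff)
  qed (use meas in measurable)
  moreover have "\<forall>\<^sub>F \<theta> in at \<theta>0. (?I \<theta> - ?I \<theta>0) /\<^sub>R (\<theta> - \<theta>0) =
      (LINT q|N. ((K \<theta> q - K \<theta>0 q) / (\<theta> - \<theta>0)) *\<^sub>R w q)"
  proof -
    have K_int: "integrable N (\<lambda>q. K \<theta> q *\<^sub>R w q)" if "\<theta> \<in> ball \<theta>0 r" for \<theta>
      using int
    proof (rule Bochner_Integration.integrable_bound)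
      show "AE q in N. norm (K \<theta> q *\<^sub>R w q) \<le> norm (B q * norm (w q))"
        using bound(1)[OF that]
        by (intro AE_I2) (simp add: order.trans[OF mult_right_mono abs_ge_self])
    qed (use meas in measurable)
    have "\<forall>\<^sub>F \<theta> in at \<theta>0. \<theta> \<in> ball \<theta>0 r"
      using r by (intro eventually_at_in_open') auto
    then show ?thesis
    proof eventually_elim
      case (elim \<theta>)
      have "?I \<theta> - ?I \<theta>0 = (LINT q|N. K \<theta> q *\<^sub>R w q - K \<theta>0 q *\<^sub>R w q)"
        using K_int elim r by (intro Bochner_Integration.integral_diff[symmetric]) auto
      then show ?case
        by (simp add: scaleR_left_diff_distrib[symmetric] divide_inverse_commute
            flip: integral_scaleR_right scaleR_scaleR)
    qed
  qed
  ultimately have "((\<lambda>\<theta>. (?I \<theta> - ?I \<theta>0) /\<^sub>R (\<theta> - \<theta>0)) \<longlongrightarrow> (LINT q|N. K' \<theta>0 q *\<^sub>R w q)) (at \<theta>0)"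
    by (rule Lim_transform_eventually[OF _ eventually_mono]) auto
  then have "((\<lambda>\<theta>. norm ((?I \<theta> - ?I \<theta>0) /\<^sub>R (\<theta> - \<theta>0) - (LINT q|N. K' \<theta>0 q *\<^sub>R w q))) \<longlongrightarrow> 0) (at \<theta>0)"
    by (intro tendsto_norm_zero LIM_zero)
  then have "((\<lambda>\<theta>. norm (?I \<theta> - ?I \<theta>0 - (\<theta> - \<theta>0) *\<^sub>R (LINT q|N. K' \<theta>0 q *\<^sub>R w q)) / norm (\<theta> - \<theta>0)) \<longlongrightarrow> 0) (at \<theta>0)"
  proof (rule Lim_transform_eventually, unfold eventually_at_filter, intro always_eventually allI impI)
    fix \<theta> assume "\<theta> \<noteq> \<theta>0"
    then have "(?I \<theta> - ?I \<theta>0) /\<^sub>R (\<theta> - \<theta>0) - (LINT q|N. K' \<theta>0 q *\<^sub>R w q) =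
        (?I \<theta> - ?I \<theta>0 - (\<theta> - \<theta>0) *\<^sub>R (LINT q|N. K' \<theta>0 q *\<^sub>R w q)) /\<^sub>R (\<theta> - \<theta>0)"
      by (simp add: scaleR_diff_right)
    then show "norm ((?I \<theta> - ?I \<theta>0) /\<^sub>R (\<theta> - \<theta>0) - (LINT q|N. K' \<theta>0 q *\<^sub>R w q)) =
        norm (?I \<theta> - ?I \<theta>0 - (\<theta> - \<theta>0) *\<^sub>R (LINT q|N. K' \<theta>0 q *\<^sub>R w q)) / norm (\<theta> - \<theta>0)"
      by (simp add: divide_inverse_commute)
  qed
  then show ?thesis
    unfolding has_vector_derivative_def has_derivative_iff_norm
    by (simp add: bounded_linear_scaleR_left)
qed

text \<open>
  The derivative of order \<open>k\<close> in \<open>x\<close> of the centred normal density with variance \<open>\<tau>\<close>, through the recursion of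
  the Hermite polynomials. In this form the heat equation and the bounds are proved by induction on \<open>k\<close>.
\<close>

fun heat_kernel :: "nat \<Rightarrow> real \<Rightarrow> real \<Rightarrow> real" where
  "heat_kernel 0 x \<tau> = normal_density 0 (sqrt \<tau>) x"
| "heat_kernel (Suc 0) x \<tau> = - (x * normal_density 0 (sqrt \<tau>) x) / \<tau>"
| "heat_kernel (Suc (Suc k)) x \<tau> =
     - (x * heat_kernel (Suc k) x \<tau> + real (Suc k) * heat_kernel k x \<tau>) / \<tau>"

lemma normal_density_sqrt:
  "0 < \<tau> \<Longrightarrow> normal_density 0 (sqrt \<tau>) x = exp (- x\<^sup>2 / (2 * \<tau>)) / (sqrt (2 * pi) * sqrt \<tau>)"
  by (simp add: normal_density_def real_sqrt_mult)

lemma hermite_step_deriv_x: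
  fixes A B :: "real \<Rightarrow> real"
  assumes "(A has_real_derivative A') (at x)" "(B has_real_derivative B') (at x)" "\<tau> \<noteq> 0"
  shows "((\<lambda>x. - (x * A x + c * B x) / \<tau>) has_real_derivative - (A x + x * A' + c * B') / \<tau>) (at x)"
  using assms by (auto intro!: derivative_eq_intros simp: field_simps)

lemma hermite_step_deriv_t:
  fixes A B :: "real \<Rightarrow> real"
  assumes "(A has_real_derivative A') (at \<tau>)" "(B has_real_derivative B') (at \<tau>)" "\<tau> \<noteq> 0"
  shows "((\<lambda>\<tau>. - (x * A \<tau> + c * B \<tau>) / \<tau>) has_real_derivative
    - (x * A' + c * B') / \<tau> + (x * A \<tau> + c * B \<tau>) / \<tau> / \<tau>) (at \<tau>)"
  using assms by (auto intro!: derivative_eq_intros simp: field_simps)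

lemma hermite_step_t_arith:
  fixes \<tau> x :: real
  assumes "\<tau> \<noteq> 0"
  shows "- (x * (A / 2) + real (Suc k) * (B / 2)) / \<tau> + (- B) / \<tau> =
    - (x * A + real (Suc (Suc (Suc k))) * B) / \<tau> / 2"
  using assms by (simp add: field_simps)

text \<open>
  In the shape of the general step of the recursion, with a vanishing second term, so that the lemmas on
  that step cover it.
\<close>

lemma heat_kernel_1: "heat_kernel (Suc 0) x \<tau> = - (x * heat_kernel 0 x \<tau> + 0 * 0) / \<tau>"
  by simp

lemma heat_kernel_deriv_x:
  assumes "0 < \<tau>"
  shows "((\<lambda>x. heat_kernel k x \<tau>) has_real_derivative heat_kernel (Suc k) x \<tau>) (at x)" (is "?P k")
proof -
  have \<tau>: "\<tau> \<noteq> 0" using assms by simp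
  have P0: "?P 0" unfolding heat_kernel.simps normal_density_sqrt[OF assms] using assms
    by (auto intro!: derivative_eq_intros simp: field_simps power2_eq_square)
  show ?thesis
  proof (induction k rule: induct_nat_012)
    case 0
    show ?case by (rule P0)
  next
    case 1
    show ?case unfolding heat_kernel_1
      by (rule DERIV_cong[OF hermite_step_deriv_x[OF P0 DERIV_const \<tau>]])
        (simp only: heat_kernel.simps(3) heat_kernel_1, simp)
  next
    case (ge2 k)
    show ?case unfolding heat_kernel.simps(3)[of k]
      by (rule DERIV_cong[OF hermite_step_deriv_x[OF ge2.IH(2,1) \<tau>]])
        (simp only: heat_kernel.simps(3)[of "Suc k"], simp add: algebra_simps del: heat_kernel.simps)
  qed
qed

lemma heat_kernel_deriv_t:
  assumes "0 < \<tau>"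
  shows "((\<lambda>\<tau>. heat_kernel k x \<tau>) has_real_derivative heat_kernel (Suc (Suc k)) x \<tau> / 2) (at \<tau>)" (is "?P k")
proof -
  have \<tau>: "\<tau> \<noteq> 0" using assms by simp
  have sq: "sqrt \<tau> * (sqrt \<tau> * y) = \<tau> * y" "sqrt (pi * 2) * (sqrt (pi * 2) * y) = pi * 2 * y" for y
    using assms by (simp_all flip: mult.assoc)
  have "((\<lambda>\<tau>. exp (- x\<^sup>2 / (2 * \<tau>)) / (sqrt (2 * pi) * sqrt \<tau>)) has_real_derivative
      heat_kernel (Suc (Suc 0)) x \<tau> / 2) (at \<tau>)"
    using assms unfolding heat_kernel.simps normal_density_sqrt[OF assms]
    by (auto intro!: derivative_eq_intros simp: field_simps power2_eq_square sq)
  then have P0: "?P 0"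
    by (rule has_field_derivative_transform_within_open[of _ _ _ "{0<..}"])
       (use assms in \<open>auto simp: normal_density_sqrt\<close>)
  show ?thesis
  proof (induction k rule: induct_nat_012)
    case 0
    show ?case by (rule P0)
  next
    case 1
    show ?case unfolding heat_kernel_1
      by (rule DERIV_cong[OF hermite_step_deriv_t[OF P0 DERIV_const \<tau>]])
        (simp only: heat_kernel.simps(3)[of "Suc 0"] heat_kernel_1,
         use \<tau> in \<open>simp add: field_simps del: heat_kernel.simps\<close>)
  next
    case (ge2 k)
    have step: "(x * heat_kernel (Suc k) x \<tau> + real (Suc k) * heat_kernel k x \<tau>) / \<tau> =
        - heat_kernel (Suc (Suc k)) x \<tau>"
      by (simp only: heat_kernel.simps(3)[of k] minus_divide_left minus_minus)
    have "((\<lambda>\<tau>. heat_kernel (Suc (Suc k)) x \<tau>) has_real_derivative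
        - (x * (heat_kernel (Suc (Suc (Suc k))) x \<tau> / 2) +
           real (Suc k) * (heat_kernel (Suc (Suc k)) x \<tau> / 2)) / \<tau>
        + (x * heat_kernel (Suc k) x \<tau> + real (Suc k) * heat_kernel k x \<tau>) / \<tau> / \<tau>) (at \<tau>)"
      using hermite_step_deriv_t[OF ge2.IH(2,1) \<tau>, of x "real (Suc k)"]
      by (simp only: heat_kernel.simps(3)[of k])
    then show ?case
      by (rule DERIV_cong) (simp only: step heat_kernel.simps(3)[of "Suc (Suc k)"] hermite_step_t_arith[OF \<tau>])
  qed
qed

lemma abs_le_exp_abs: "\<bar>x\<bar> \<le> exp \<bar>x\<bar>" for x :: real
  using exp_ge_add_one_self[of "\<bar>x\<bar>"] by linarith

text \<open>
  Each step of the recursion costs a factor \<open>\<bar>x\<bar> \<le> e\<^sup>\<bar>\<^sup>x\<^sup>\<bar>\<close> and a division by \<open>\<tau>\<close>; absorbing powers of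
  \<open>\<bar>x\<bar>\<close> in exponentials keeps the induction free of polynomials.
\<close>

lemma heat_kernel_gaussian_bound:
  assumes "0 < \<tau>1" "\<tau>1 \<le> \<tau>2"
  shows "\<exists>C\<ge>0. \<forall>\<tau>\<in>{\<tau>1..\<tau>2}. \<forall>x.
    \<bar>heat_kernel k x \<tau>\<bar> \<le> C * (exp (real k * \<bar>x\<bar>) * exp (- x\<^sup>2 / (2 * \<tau>2)))" (is "?P k")
proof -
  have "\<bar>heat_kernel 0 x \<tau>\<bar> \<le> 1 / (sqrt (2 * pi) * sqrt \<tau>1) * exp (- x\<^sup>2 / (2 * \<tau>2))"
    if "\<tau> \<in> {\<tau>1..\<tau>2}" for \<tau> x
  proof -
    have "exp (- x\<^sup>2 / (2 * \<tau>)) / (sqrt (2 * pi) * sqrt \<tau>) \<le> exp (- x\<^sup>2 / (2 * \<tau>2)) / (sqrt (2 * pi) * sqrt \<tau>1)"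
      using that assms by (intro frac_le mult_left_mono) (auto intro!: divide_left_mono)
    then show ?thesis using that assms by (simp add: normal_density_sqrt)
  qed
  moreover have "0 \<le> 1 / (sqrt (2 * pi) * sqrt \<tau>1)" using assms by simp
  ultimately have P0: "?P 0"
    by (intro exI[of _ "1 / (sqrt (2 * pi) * sqrt \<tau>1)"]) (simp del: heat_kernel.simps)
  show "?P k"
  proof (induction k rule: induct_nat_012)
    case 0
    show ?case by (rule P0)
  next
    case 1
    obtain C where C: "0 \<le> C" "\<And>\<tau> x. \<tau> \<in> {\<tau>1..\<tau>2} \<Longrightarrow>
      \<bar>heat_kernel 0 x \<tau>\<bar> \<le> C * (exp (real 0 * \<bar>x\<bar>) * exp (- x\<^sup>2 / (2 * \<tau>2)))" using P0 by blast
    have "\<bar>heat_kernel (Suc 0) x \<tau>\<bar> \<le> C / \<tau>1 * (exp \<bar>x\<bar> * exp (- x\<^sup>2 / (2 * \<tau>2)))"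
      if "\<tau> \<in> {\<tau>1..\<tau>2}" for \<tau> x
    proof -
      have "\<bar>heat_kernel (Suc 0) x \<tau>\<bar> = \<bar>x\<bar> * \<bar>normal_density 0 (sqrt \<tau>) x\<bar> / \<tau>"
        using that assms by (simp add: abs_mult)
      also have "\<dots> \<le> exp \<bar>x\<bar> * (C * exp (- x\<^sup>2 / (2 * \<tau>2))) / \<tau>1"
        using that assms C(1) C(2)[OF that, of x] by (intro frac_le mult_mono abs_le_exp_abs) auto
      finally show ?thesis by (simp add: mult_ac)
    qed
    moreover have "0 \<le> C / \<tau>1" using C assms by simp
    ultimately show ?case by (intro exI[of _ "C / \<tau>1"]) (simp del: heat_kernel.simps)
  next
    case (ge2 k)
    define G where "G x = exp (- x\<^sup>2 / (2 * \<tau>2))" for x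
    obtain C C' where C: "0 \<le> C" "\<And>\<tau> x. \<tau> \<in> {\<tau>1..\<tau>2} \<Longrightarrow>
        \<bar>heat_kernel k x \<tau>\<bar> \<le> C * (exp (real k * \<bar>x\<bar>) * G x)"
      and C': "0 \<le> C'" "\<And>\<tau> x. \<tau> \<in> {\<tau>1..\<tau>2} \<Longrightarrow>
        \<bar>heat_kernel (Suc k) x \<tau>\<bar> \<le> C' * (exp (real (Suc k) * \<bar>x\<bar>) * G x)"
      using ge2.IH unfolding G_def by blast
    have "\<bar>heat_kernel (Suc (Suc k)) x \<tau>\<bar> \<le>
        (C' + real (Suc k) * C) / \<tau>1 * (exp (real (Suc (Suc k)) * \<bar>x\<bar>) * G x)"
      if "\<tau> \<in> {\<tau>1..\<tau>2}" for \<tau> x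
    proof -
      let ?E = "exp (real (Suc (Suc k)) * \<bar>x\<bar>) * G x"
      have G: "0 \<le> G x" by (simp add: G_def)
      have "\<bar>x * heat_kernel (Suc k) x \<tau>\<bar> \<le> exp \<bar>x\<bar> * (C' * (exp (real (Suc k) * \<bar>x\<bar>) * G x))"
        unfolding abs_mult using C' that by (intro mult_mono abs_le_exp_abs) auto
      also have "\<dots> = C' * ((exp \<bar>x\<bar> * exp (real (Suc k) * \<bar>x\<bar>)) * G x)" by (simp add: mult_ac)
      also have "exp \<bar>x\<bar> * exp (real (Suc k) * \<bar>x\<bar>) = exp (real (Suc (Suc k)) * \<bar>x\<bar>)"
        by (simp add: algebra_simps flip: exp_add)
      finally have 1: "\<bar>x * heat_kernel (Suc k) x \<tau>\<bar> \<le> C' * ?E" .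
      have "C * (exp (real k * \<bar>x\<bar>) * G x) \<le> C * ?E"
        using C G by (intro mult_left_mono mult_right_mono) (auto intro!: mult_right_mono)
      then have "\<bar>heat_kernel k x \<tau>\<bar> \<le> C * ?E" using C(2)[OF that, of x] by linarith
      then have 2: "\<bar>real (Suc k) * heat_kernel k x \<tau>\<bar> \<le> real (Suc k) * (C * ?E)"
        unfolding abs_mult by (intro mult_mono) auto
      have "\<bar>heat_kernel (Suc (Suc k)) x \<tau>\<bar> =
          \<bar>x * heat_kernel (Suc k) x \<tau> + real (Suc k) * heat_kernel k x \<tau>\<bar> / \<tau>"
        unfolding heat_kernel.simps(3) using that assms by (simp add: abs_divide)
      also have "\<dots> \<le> (C' * ?E + real (Suc k) * (C * ?E)) / \<tau>1"
        using 1 2 that assms by (intro frac_le) (linarith, linarith, simp_all)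
      finally show ?thesis by (simp add: algebra_simps add_divide_distrib)
    qed
    moreover have "0 \<le> (C' + real (Suc k) * C) / \<tau>1" using C C' assms by simp
    ultimately show ?case unfolding G_def by blast
  qed
qed

text \<open>
  Completing the square in \<open>(k + 1) \<bar>x\<bar> - x\<^sup>2 / (2 \<tau>2)\<close>.
\<close>

lemma heat_kernel_exp_bound:
  assumes "0 < \<tau>1" "\<tau>1 \<le> \<tau>2"
  shows "\<exists>C\<ge>0. \<forall>\<tau>\<in>{\<tau>1..\<tau>2}. \<forall>x. \<bar>heat_kernel k x \<tau>\<bar> \<le> C * exp (- \<bar>x\<bar>)"
proof -
  obtain C where C: "0 \<le> C" "\<And>\<tau> x. \<tau> \<in> {\<tau>1..\<tau>2} \<Longrightarrow>
      \<bar>heat_kernel k x \<tau>\<bar> \<le> C * (exp (real k * \<bar>x\<bar>) * exp (- x\<^sup>2 / (2 * \<tau>2)))"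
    using heat_kernel_gaussian_bound[OF assms] by blast
  define c where "c = exp ((real k + 1)\<^sup>2 * \<tau>2 / 2)"
  have "exp (real k * \<bar>x\<bar>) * exp (- x\<^sup>2 / (2 * \<tau>2)) \<le> c * exp (- \<bar>x\<bar>)" for x
  proof -
    have "0 \<le> (\<bar>x\<bar> - (real k + 1) * \<tau>2)\<^sup>2 / (2 * \<tau>2)" using assms by simp
    also have "\<dots> = x\<^sup>2 / (2 * \<tau>2) - (real k + 1) * \<bar>x\<bar> + (real k + 1)\<^sup>2 * \<tau>2 / 2"
      using assms by (simp add: field_simps power2_eq_square)
    finally show ?thesis unfolding c_def by (simp add: algebra_simps flip: exp_add)
  qed
  then have "C * (exp (real k * \<bar>x\<bar>) * exp (- x\<^sup>2 / (2 * \<tau>2))) \<le> C * (c * exp (- \<bar>x\<bar>))" for x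
    using C(1) by (intro mult_left_mono)
  then have "\<bar>heat_kernel k x \<tau>\<bar> \<le> (C * c) * exp (- \<bar>x\<bar>)" if "\<tau> \<in> {\<tau>1..\<tau>2}" for \<tau> x
    using C(2)[OF that] order_trans unfolding mult.assoc by blast
  moreover have "0 \<le> C * c" using C by (simp add: c_def)
  ultimately show ?thesis by blast
qed

lemma tendsto_heat_kernel:
  assumes "(f \<longlongrightarrow> x) F" "(g \<longlongrightarrow> \<tau>) F" "0 < \<tau>"
  shows "((\<lambda>z. heat_kernel k (f z) (g z)) \<longlongrightarrow> heat_kernel k x \<tau>) F"
proof -
  have [tendsto_intros]: "((\<lambda>z. normal_density 0 (sqrt (g z)) (f z)) \<longlongrightarrow> normal_density 0 (sqrt \<tau>) x) F"
    unfolding normal_density_def using assms by (intro tendsto_intros assms) auto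
  show ?thesis
  proof (induction k rule: induct_nat_012)
    case 0
    show ?case unfolding heat_kernel.simps by (rule tendsto_intros)
  next
    case 1
    show ?case unfolding heat_kernel.simps by (intro tendsto_intros assms) (use assms in simp)
  next
    case (ge2 k)
    show ?case unfolding heat_kernel.simps(3) by (intro tendsto_intros assms ge2.IH) (use assms in simp)
  qed
qed

text \<open>
  The derivative of order \<open>k\<close> in \<open>p\<close> of the path smoothed at time \<open>\<tau>\<close>.
\<close>

definition heat_flow :: "(real \<Rightarrow> complex) \<Rightarrow> nat \<Rightarrow> real \<Rightarrow> real \<Rightarrow> complex" where
  "heat_flow w k p \<tau> = (LINT q|lborel. heat_kernel k (p - q) \<tau> *\<^sub>R w q)"

lemma measurable_heat_kernel [measurable (raw)]:
  "f \<in> borel_measurable N \<Longrightarrow> (\<lambda>q. heat_kernel k (f q) \<tau>) \<in> borel_measurable N"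
  by (induction k rule: induct_nat_012) simp_all

text \<open>
  One multiple of \<open>e\<^sup>-\<^sup>\<bar>\<^sup>q\<^sup>\<bar>\<close> dominates the kernel for all \<open>(p, \<tau>)\<close> in a compact set. This is the
  majorant for every differentiation under the integral below.
\<close>

lemma heat_kernel_shift_bound:
  assumes "0 < \<tau>1" "\<tau>1 \<le> \<tau>2"
  obtains C where "\<And>\<tau> p q. \<tau> \<in> {\<tau>1..\<tau>2} \<Longrightarrow> p \<in> {-m..m} \<Longrightarrow>
    \<bar>heat_kernel k (p - q) \<tau>\<bar> \<le> C * exp (- \<bar>q\<bar>)"
proof -
  obtain C where C: "0 \<le> C" "\<And>\<tau> x. \<tau> \<in> {\<tau>1..\<tau>2} \<Longrightarrow> \<bar>heat_kernel k x \<tau>\<bar> \<le> C * exp (- \<bar>x\<bar>)"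
    using heat_kernel_exp_bound[OF assms] by blast
  have "\<bar>heat_kernel k (p - q) \<tau>\<bar> \<le> (C * exp m) * exp (- \<bar>q\<bar>)"
    if "\<tau> \<in> {\<tau>1..\<tau>2}" "p \<in> {-m..m}" for \<tau> p q
  proof -
    have "exp (- \<bar>p - q\<bar>) \<le> exp (m + - \<bar>q\<bar>)" using that(2) by (subst exp_le_cancel_iff) (simp, arith)
    then have "exp (- \<bar>p - q\<bar>) \<le> exp m * exp (- \<bar>q\<bar>)" by (simp only: exp_add)
    then have "C * exp (- \<bar>p - q\<bar>) \<le> C * (exp m * exp (- \<bar>q\<bar>))" using C by (intro mult_left_mono)
    then show ?thesis using C(2)[OF that(1), of "p - q"] by (simp add: mult_ac)
  qed
  then show ?thesis by (rule that)
qed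

context
  fixes w :: "real \<Rightarrow> complex"
  assumes w: "integrable lborel (\<lambda>q. exp (- \<bar>q\<bar>) *\<^sub>R w q)" "w \<in> borel_measurable borel"
begin

lemma integrable_exp_bound: "integrable lborel (\<lambda>q. (C * exp (- \<bar>q\<bar>)) * norm (w q))"
  using integrable_mult_right[OF integrable_norm[OF w(1)], of C] by (simp add: mult_ac)

lemma heat_flow_deriv_x:
  assumes "0 < \<tau>"
  shows "((\<lambda>p. heat_flow w k p \<tau>) has_vector_derivative heat_flow w (Suc k) p \<tau>) (at p)"
proof -
  define m where "m = \<bar>p\<bar> + 1"
  have m: "ball p 1 \<subseteq> {-m..m}" by (auto simp: m_def dist_real_def)
  obtain C where C: "\<And>\<sigma> p q. \<sigma> \<in> {\<tau>..\<tau>} \<Longrightarrow> p \<in> {-m..m} \<Longrightarrow>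
      \<bar>heat_kernel k (p - q) \<sigma>\<bar> \<le> C * exp (- \<bar>q\<bar>)"
    by (rule heat_kernel_shift_bound[OF assms order_refl, of m k]) blast
  obtain C' where C': "\<And>\<sigma> p q. \<sigma> \<in> {\<tau>..\<tau>} \<Longrightarrow> p \<in> {-m..m} \<Longrightarrow>
      \<bar>heat_kernel (Suc k) (p - q) \<sigma>\<bar> \<le> C' * exp (- \<bar>q\<bar>)"
    by (rule heat_kernel_shift_bound[OF assms order_refl, of m "Suc k"]) blast
  show ?thesis unfolding heat_flow_def
  proof (rule integral_has_vector_derivative_dominated[of 1 _ _ _ _ _ "\<lambda>q. max C C' * exp (- \<bar>q\<bar>)"])
    fix x q assume x: "x \<in> ball p 1"
    show "((\<lambda>p. heat_kernel k (p - q) \<tau>) has_real_derivative heat_kernel (Suc k) (x - q) \<tau>) (at x)"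
      using DERIV_shift[of "\<lambda>y. heat_kernel k y \<tau>" _ x "- q"] heat_kernel_deriv_x[OF assms, of k "x - q"]
      by (simp del: heat_kernel.simps)
    have C_le: "C * exp (- \<bar>q\<bar>) \<le> max C C' * exp (- \<bar>q\<bar>)" "C' * exp (- \<bar>q\<bar>) \<le> max C C' * exp (- \<bar>q\<bar>)"
      by (intro mult_right_mono; simp)+
    have x_in: "\<tau> \<in> {\<tau>..\<tau>}" "x \<in> {-m..m}" using subsetD[OF m x] by simp_all
    show "\<bar>heat_kernel k (x - q) \<tau>\<bar> \<le> max C C' * exp (- \<bar>q\<bar>)"
      by (rule order_trans[OF C[OF x_in] C_le(1)])
    show "\<bar>heat_kernel (Suc k) (x - q) \<tau>\<bar> \<le> max C C' * exp (- \<bar>q\<bar>)"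
      by (rule order_trans[OF C'[OF x_in] C_le(2)])
  qed (simp_all add: integrable_exp_bound w(2) del: heat_kernel.simps)
qed

lemma heat_flow_deriv_t:
  assumes "0 < \<tau>"
  shows "((\<lambda>\<tau>. heat_flow w k p \<tau>) has_vector_derivative (1 / 2) *\<^sub>R heat_flow w (k + 2) p \<tau>) (at \<tau>)"
proof -
  have "x \<in> {\<tau> / 2..2 * \<tau>}" if "x \<in> ball \<tau> (\<tau> / 2)" for x
  proof -
    have "\<bar>\<tau> - x\<bar> < \<tau> / 2" using that by (simp add: dist_real_def)
    then have "\<tau> / 2 \<le> x" "x \<le> 2 * \<tau>" using assms by arith+
    then show ?thesis by simp
  qed
  then have I: "ball \<tau> (\<tau> / 2) \<subseteq> {\<tau> / 2..2 * \<tau>}" "0 < \<tau> / 2" "\<tau> / 2 \<le> 2 * \<tau>" "p \<in> {-\<bar>p\<bar>..\<bar>p\<bar>}"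
    using assms by auto
  obtain C where C: "\<And>\<sigma> x q. \<sigma> \<in> {\<tau> / 2..2 * \<tau>} \<Longrightarrow> x \<in> {-\<bar>p\<bar>..\<bar>p\<bar>} \<Longrightarrow>
      \<bar>heat_kernel k (x - q) \<sigma>\<bar> \<le> C * exp (- \<bar>q\<bar>)"
    by (rule heat_kernel_shift_bound[OF I(2,3), of "\<bar>p\<bar>" k]) blast
  obtain C' where C': "\<And>\<sigma> x q. \<sigma> \<in> {\<tau> / 2..2 * \<tau>} \<Longrightarrow> x \<in> {-\<bar>p\<bar>..\<bar>p\<bar>} \<Longrightarrow>
      \<bar>heat_kernel (k + 2) (x - q) \<sigma>\<bar> \<le> C' * exp (- \<bar>q\<bar>)"
    by (rule heat_kernel_shift_bound[OF I(2,3), of "\<bar>p\<bar>" "k + 2"]) blast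
  have "((\<lambda>\<tau>. heat_flow w k p \<tau>) has_vector_derivative
      (LINT q|lborel. (heat_kernel (k + 2) (p - q) \<tau> / 2) *\<^sub>R w q)) (at \<tau>)"
    unfolding heat_flow_def
  proof (rule integral_has_vector_derivative_dominated[of "\<tau> / 2" _ _ _ _ _ "\<lambda>q. max C C' * exp (- \<bar>q\<bar>)"])
    fix x q assume x: "x \<in> ball \<tau> (\<tau> / 2)"
    then have "0 < x" using subsetD[OF I(1) x] assms by simp
    then show "((\<lambda>\<tau>. heat_kernel k (p - q) \<tau>) has_real_derivative heat_kernel (k + 2) (p - q) x / 2) (at x)"
      using heat_kernel_deriv_t by simp
    have C_le: "C * exp (- \<bar>q\<bar>) \<le> max C C' * exp (- \<bar>q\<bar>)" "C' * exp (- \<bar>q\<bar>) \<le> max C C' * exp (- \<bar>q\<bar>)"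
      by (intro mult_right_mono; simp)+
    have K: "\<bar>heat_kernel k (p - q) x\<bar> \<le> max C C' * exp (- \<bar>q\<bar>)"
      "\<bar>heat_kernel (k + 2) (p - q) x\<bar> \<le> max C C' * exp (- \<bar>q\<bar>)"
      by (rule order_trans[OF C[OF subsetD[OF I(1) x] I(4)] C_le(1)],
          rule order_trans[OF C'[OF subsetD[OF I(1) x] I(4)] C_le(2)])
    show "\<bar>heat_kernel k (p - q) x\<bar> \<le> max C C' * exp (- \<bar>q\<bar>)" by (rule K)
    have "\<bar>heat_kernel (k + 2) (p - q) x / 2\<bar> \<le> \<bar>heat_kernel (k + 2) (p - q) x\<bar>"
      by (simp del: heat_kernel.simps add: abs_divide)
    then show "\<bar>heat_kernel (k + 2) (p - q) x / 2\<bar> \<le> max C C' * exp (- \<bar>q\<bar>)"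
      using K(2) by (rule order_trans)
  qed (simp_all add: integrable_exp_bound w(2) assms del: heat_kernel.simps)
  also have "(LINT q|lborel. (heat_kernel (k + 2) (p - q) \<tau> / 2) *\<^sub>R w q) =
      (LINT q|lborel. (1 / 2) *\<^sub>R (heat_kernel (k + 2) (p - q) \<tau> *\<^sub>R w q))"
    by (simp del: heat_kernel.simps)
  also have "\<dots> = (1 / 2) *\<^sub>R heat_flow w (k + 2) p \<tau>"
    unfolding heat_flow_def by (rule integral_scaleR_right)
  finally show ?thesis .
qed

lemma continuous_on_heat_flow: "continuous_on (UNIV \<times> {0<..}) (\<lambda>(p, \<tau>). heat_flow w k p \<tau>)"
proof -
  have "isCont (\<lambda>z. heat_flow w k (fst z) (snd z)) (p, \<tau>)" if \<tau>: "0 < \<tau>" for p \<tau>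
  proof -
    define m where "m = \<bar>p\<bar> + 1"
    have I: "0 < \<tau> / 2" "\<tau> / 2 \<le> 2 * \<tau>" using \<tau> by auto
    obtain C where C: "\<And>\<sigma> x q. \<sigma> \<in> {\<tau> / 2..2 * \<tau>} \<Longrightarrow> x \<in> {-m..m} \<Longrightarrow>
        \<bar>heat_kernel k (x - q) \<sigma>\<bar> \<le> C * exp (- \<bar>q\<bar>)"
      by (rule heat_kernel_shift_bound[OF I, of m k]) blast
    show ?thesis unfolding isCont_def heat_flow_def
    proof (rule integral_tendsto_dominated[of _ _ _ "\<lambda>q. (C * exp (- \<bar>q\<bar>)) * norm (w q)"])
      have "\<forall>\<^sub>F z in at (p, \<tau>). z \<in> {-m<..<m} \<times> {\<tau> / 2<..<2 * \<tau>}"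
        using \<tau> by (intro eventually_at_in_open' open_Times) (auto simp: m_def)
      then show "\<forall>\<^sub>F z in at (p, \<tau>). \<forall>q. norm (heat_kernel k (fst z - q) (snd z) *\<^sub>R w q) \<le>
          C * exp (- \<bar>q\<bar>) * norm (w q)"
      proof (eventually_elim, intro allI)
        fix z q assume "z \<in> {-m<..<m} \<times> {\<tau> / 2<..<2 * \<tau>}"
        then have "\<bar>heat_kernel k (fst z - q) (snd z)\<bar> \<le> C * exp (- \<bar>q\<bar>)" by (intro C) auto
        then show "norm (heat_kernel k (fst z - q) (snd z) *\<^sub>R w q) \<le> C * exp (- \<bar>q\<bar>) * norm (w q)"
          unfolding norm_scaleR by (rule mult_right_mono) simp
      qed
      show "((\<lambda>z. heat_kernel k (fst z - q) (snd z) *\<^sub>R w q) \<longlongrightarrow>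
          heat_kernel k (fst (p, \<tau>) - q) (snd (p, \<tau>)) *\<^sub>R w q) (at (p, \<tau>))" for q
        by (intro tendsto_scaleR tendsto_heat_kernel tendsto_intros) (use \<tau> in auto)
    qed (use w integrable_exp_bound in simp_all)
  qed
  then have "continuous_on (UNIV \<times> {0<..}) (\<lambda>z. heat_flow w k (fst z) (snd z))"
    by (subst continuous_on_eq_continuous_at) (auto intro!: open_Times)
  then show ?thesis by (simp add: case_prod_beta')
qed

end

text \<open>
  The substitution \<open>q = p - z\<close> moves the dependence on \<open>p\<close> from the path to the kernel.
\<close>

lemma smoothed_eq_heat_flow:
  assumes "0 < \<tau>" "extend_by_zero w \<in> borel_measurable borel"
  shows "smoothed w p \<tau> = heat_flow (extend_by_zero w) 0 p \<tau>"
proof -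
  have "smoothed w p \<tau> = (LINT z|lborel. normal_density 0 (sqrt \<tau>) z *\<^sub>R extend_by_zero w (p - z))"
    unfolding smoothed_def using assms(2) by (subst integral_density) auto
  also have "\<dots> = (LINT q|lborel. normal_density 0 (sqrt \<tau>) (p + (- 1) * q) *\<^sub>R extend_by_zero w (p - (p + (- 1) * q)))"
    using lborel_integral_real_affine[of "- 1" "\<lambda>z. normal_density 0 (sqrt \<tau>) z *\<^sub>R extend_by_zero w (p - z)" p] by simp
  finally show ?thesis by (simp add: heat_flow_def)
qed

section \<open>Caloric functions under parabolic rescaling\<close>

text \<open>
  \<open>H k\<close> stands for the derivative of order \<open>k\<close> in \<open>p\<close> of a solution \<open>H 0\<close> of \<open>\<partial>\<^sub>\<tau> = \<partial>\<^sub>p\<^sub>p / 2\<close>. Carrying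
  all derivatives makes the notion stable under differentiation, which is a shift of \<open>k\<close>.
\<close>

definition caloric_jet :: "(nat \<Rightarrow> real \<Rightarrow> real \<Rightarrow> real) \<Rightarrow> bool" where
  "caloric_jet H \<longleftrightarrow>
     (\<forall>k p \<tau>. 0 < \<tau> \<longrightarrow>
        ((\<lambda>p. H k p \<tau>) has_real_derivative H (Suc k) p \<tau>) (at p) \<and>
        ((\<lambda>\<tau>. H k p \<tau>) has_real_derivative H (k + 2) p \<tau> / 2) (at \<tau>)) \<and>
     (\<forall>k. continuous_on (UNIV \<times> {0<..}) (\<lambda>(p, \<tau>). H k p \<tau>))"

lemma caloric_jet_deriv:
  assumes "caloric_jet H" "0 < \<tau>"
  shows "((\<lambda>p. H k p \<tau>) has_real_derivative H (Suc k) p \<tau>) (at p)"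
    "((\<lambda>\<tau>. H k p \<tau>) has_real_derivative H (k + 2) p \<tau> / 2) (at \<tau>)"
  using assms by (auto simp: caloric_jet_def)

lemma caloric_jet_continuous:
  "caloric_jet H \<Longrightarrow> S \<subseteq> UNIV \<times> {0<..} \<Longrightarrow> continuous_on S (\<lambda>(p, \<tau>). H k p \<tau>)"
  unfolding caloric_jet_def by (blast intro: continuous_on_subset)

lemma caloric_jet_shift:
  assumes "caloric_jet H" shows "caloric_jet (\<lambda>k. H (k + j))"
  unfolding caloric_jet_def
proof (intro conjI allI impI)
  fix k p and \<tau> :: real assume "0 < \<tau>"
  note d = caloric_jet_deriv[OF assms this]
  show "((\<lambda>p. H (k + j) p \<tau>) has_real_derivative H (Suc k + j) p \<tau>) (at p)"
    using d(1)[of "k + j" p] by simp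
  show "((\<lambda>\<tau>. H (k + j) p \<tau>) has_real_derivative H (k + 2 + j) p \<tau> / 2) (at \<tau>)"
    using d(2)[of "k + j" p] by simp
qed (rule caloric_jet_continuous[OF assms order_refl])

lemma caloric_jet_diff:
  assumes "caloric_jet H" "caloric_jet G"
  shows "caloric_jet (\<lambda>k p \<tau>. H k p \<tau> - G k p \<tau>)"
  unfolding caloric_jet_def
proof (intro conjI allI impI)
  fix k p and \<tau> :: real assume "0 < \<tau>"
  note d = caloric_jet_deriv[OF assms(1) this] caloric_jet_deriv[OF assms(2) this]
  show "((\<lambda>p. H k p \<tau> - G k p \<tau>) has_real_derivative H (Suc k) p \<tau> - G (Suc k) p \<tau>) (at p)"
    by (intro DERIV_diff d)
  show "((\<lambda>\<tau>. H k p \<tau> - G k p \<tau>) has_real_derivative (H (k + 2) p \<tau> - G (k + 2) p \<tau>) / 2) (at \<tau>)"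
    using DERIV_diff[OF d(2) d(4)] by (simp add: diff_divide_distrib)
next
  fix k
  show "continuous_on (UNIV \<times> {0<..}) (\<lambda>(p, \<tau>). H k p \<tau> - G k p \<tau>)"
    using continuous_on_diff[OF caloric_jet_continuous[OF assms(1) order_refl, of k]
        caloric_jet_continuous[OF assms(2) order_refl, of k]] by (simp add: case_prod_beta')
qed

text \<open>
  Taylor's estimate in the parabolic scaling, by induction on the order. The point \<open>(p0 + x, \<tau>0 - s)\<close>
  is reached from \<open>(p0, \<tau>0)\<close> by a step in time and a step in space. The derivative in space is a
  solution of order one less and the step has length \<open>O(\<sigma>)\<close>; the derivative in time is a solution of order two
  less and the step has length \<open>O(\<sigma>\<^sup>2)\<close>.
\<close>

lemma parabolic_vanishing_order:
  assumes "caloric_jet H" and \<tau>0: "0 < \<tau>0" and \<sigma>0: "\<sigma>0 \<le> 1" "\<sigma>0\<^sup>2 \<le> \<tau>0 / 2"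
    and "\<And>k. k < n \<Longrightarrow> H k p0 \<tau>0 = 0"
  shows "\<exists>C\<ge>0. \<forall>\<sigma>\<in>{0..\<sigma>0}. \<forall>x s. \<bar>x\<bar> \<le> 3 * \<sigma> \<longrightarrow> 0 \<le> s \<longrightarrow> s \<le> \<sigma>\<^sup>2 \<longrightarrow>
           \<bar>H 0 (p0 + x) (\<tau>0 - s)\<bar> \<le> C * \<sigma> ^ n"
  using assms(1,5)
proof (induction n arbitrary: H rule: less_induct)
  case (less n)
  have sq: "\<sigma>\<^sup>2 \<le> \<tau>0 / 2" if "\<sigma> \<in> {0..\<sigma>0}" for \<sigma>
    using that by (intro order_trans[OF power_mono \<sigma>0(2)]) auto
  show ?case
  proof (cases n)
    case 0
    have "compact ((\<lambda>(p, \<tau>). H 0 p \<tau>) ` ({p0 - 3..p0 + 3} \<times> {\<tau>0 / 2..\<tau>0}))"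
      using \<tau>0
      by (intro compact_continuous_image compact_Times caloric_jet_continuous[OF less.prems(1)]) auto
    then have "bounded ((\<lambda>(p, \<tau>). H 0 p \<tau>) ` ({p0 - 3..p0 + 3} \<times> {\<tau>0 / 2..\<tau>0}))"
      by (rule compact_imp_bounded)
    then obtain C where "0 < C" and
      bound: "\<forall>y\<in>(\<lambda>(p, \<tau>). H 0 p \<tau>) ` ({p0 - 3..p0 + 3} \<times> {\<tau>0 / 2..\<tau>0}). norm y \<le> C"
      unfolding bounded_pos by (elim exE conjE)
    have C: "\<bar>H 0 p \<tau>\<bar> \<le> C" if "p \<in> {p0 - 3..p0 + 3}" "\<tau> \<in> {\<tau>0 / 2..\<tau>0}" for p \<tau>
      using bspec[OF bound, of "H 0 p \<tau>"] that by (force simp del: image_eqI intro: image_eqI[of _ _ "(p, \<tau>)"])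
    have "\<bar>H 0 (p0 + x) (\<tau>0 - s)\<bar> \<le> C" if "\<sigma> \<in> {0..\<sigma>0}" "\<bar>x\<bar> \<le> 3 * \<sigma>" "0 \<le> s" "s \<le> \<sigma>\<^sup>2" for \<sigma> x s
      using that(2-4) sq[OF that(1)] that(1) \<sigma>0(1) by (intro C) (auto simp: abs_le_iff)
    with \<open>0 < C\<close> 0 show ?thesis by (intro exI[of _ C]) (simp add: less_imp_le)
  next
    case (Suc m)
    have "\<exists>C\<ge>0. \<forall>\<sigma>\<in>{0..\<sigma>0}. \<forall>x s. \<bar>x\<bar> \<le> 3 * \<sigma> \<longrightarrow> 0 \<le> s \<longrightarrow> s \<le> \<sigma>\<^sup>2 \<longrightarrow>
        \<bar>H (0 + 1) (p0 + x) (\<tau>0 - s)\<bar> \<le> C * \<sigma> ^ m"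
      using less.prems Suc by (intro less.IH caloric_jet_shift) auto
    then obtain C1 where C1: "0 \<le> C1" "\<And>\<sigma> x s. \<sigma> \<in> {0..\<sigma>0} \<Longrightarrow> \<bar>x\<bar> \<le> 3 * \<sigma> \<Longrightarrow> 0 \<le> s \<Longrightarrow> s \<le> \<sigma>\<^sup>2 \<Longrightarrow>
        \<bar>H (Suc 0) (p0 + x) (\<tau>0 - s)\<bar> \<le> C1 * \<sigma> ^ m" by auto
    have "\<exists>C\<ge>0. \<forall>\<sigma>\<in>{0..\<sigma>0}. \<forall>x s. \<bar>x\<bar> \<le> 3 * \<sigma> \<longrightarrow> 0 \<le> s \<longrightarrow> s \<le> \<sigma>\<^sup>2 \<longrightarrow>
        \<bar>H (0 + 2) (p0 + x) (\<tau>0 - s)\<bar> \<le> C * \<sigma> ^ (m - 1)"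
      using less.prems Suc by (intro less.IH caloric_jet_shift) auto
    \<comment> \<open>For \<open>m = 0\<close> the exponent \<open>m - 1\<close> is \<open>0\<close>; the time step then gains \<open>\<sigma>\<^sup>2 \<le> \<sigma>\<close>, which is enough.\<close>
    then obtain C2 where C2: "0 \<le> C2" "\<And>\<sigma> x s. \<sigma> \<in> {0..\<sigma>0} \<Longrightarrow> \<bar>x\<bar> \<le> 3 * \<sigma> \<Longrightarrow> 0 \<le> s \<Longrightarrow> s \<le> \<sigma>\<^sup>2 \<Longrightarrow>
        \<bar>H (0 + 2) (p0 + x) (\<tau>0 - s)\<bar> \<le> C2 * \<sigma> ^ (m - 1)" by auto
    have "\<bar>H 0 (p0 + x) (\<tau>0 - s)\<bar> \<le> (3 * C1 + C2) * \<sigma> ^ n"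
      if \<sigma>: "\<sigma> \<in> {0..\<sigma>0}" and x: "\<bar>x\<bar> \<le> 3 * \<sigma>" and s: "0 \<le> s" "s \<le> \<sigma>\<^sup>2" for \<sigma> x s
    proof -
      have pos: "0 < \<tau>0 - t" if "t \<le> \<sigma>\<^sup>2" for t using sq[OF \<sigma>] that \<tau>0 by linarith
      have "norm (H 0 (p0 + x) (\<tau>0 - s) - H 0 p0 (\<tau>0 - s)) \<le> (C1 * \<sigma> ^ m) * norm (p0 + x - p0)"
      proof (rule field_differentiable_bound[of "{p0 - 3 * \<sigma>..p0 + 3 * \<sigma>}" "\<lambda>p. H 0 p (\<tau>0 - s)" "\<lambda>p. H (Suc 0) p (\<tau>0 - s)"])
        fix p assume "p \<in> {p0 - 3 * \<sigma>..p0 + 3 * \<sigma>}"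
        then show "norm (H (Suc 0) p (\<tau>0 - s)) \<le> C1 * \<sigma> ^ m"
          using C1(2)[OF \<sigma> _ s, of "p - p0"] by (auto simp: abs_le_iff)
      qed (use x \<sigma> s in \<open>auto intro: DERIV_subset[OF caloric_jet_deriv(1)[OF less.prems(1) pos]]\<close>)
      also have "\<dots> \<le> (C1 * \<sigma> ^ m) * (3 * \<sigma>)"
        using x C1 \<sigma> by (intro mult_left_mono) auto
      finally have 1: "\<bar>H 0 (p0 + x) (\<tau>0 - s) - H 0 p0 (\<tau>0 - s)\<bar> \<le> 3 * C1 * \<sigma> ^ n"
        by (simp add: Suc mult_ac)
      have "norm (H 0 p0 (\<tau>0 - s) - H 0 p0 \<tau>0) \<le> (C2 * \<sigma> ^ (m - 1)) * norm (\<tau>0 - s - \<tau>0)"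
      proof (rule field_differentiable_bound[of "{\<tau>0 - \<sigma>\<^sup>2..\<tau>0}" "\<lambda>\<tau>. H 0 p0 \<tau>" "\<lambda>\<tau>. H (0 + 2) p0 \<tau> / 2"])
        fix \<tau> assume \<tau>: "\<tau> \<in> {\<tau>0 - \<sigma>\<^sup>2..\<tau>0}"
        have "\<bar>H (0 + 2) p0 \<tau>\<bar> \<le> C2 * \<sigma> ^ (m - 1)"
          using C2(2)[OF \<sigma>, of 0 "\<tau>0 - \<tau>"] \<tau> \<sigma> by auto
        then show "norm (H (0 + 2) p0 \<tau> / 2) \<le> C2 * \<sigma> ^ (m - 1)" by simp
        show "((\<lambda>\<tau>. H 0 p0 \<tau>) has_field_derivative H (0 + 2) p0 \<tau> / 2) (at \<tau> within {\<tau>0 - \<sigma>\<^sup>2..\<tau>0})"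
          using pos[of "\<tau>0 - \<tau>"] \<tau> by (intro DERIV_subset[OF caloric_jet_deriv(2)[OF less.prems(1)]]) auto
      qed (use s \<sigma> in auto)
      also have "\<dots> \<le> (C2 * \<sigma> ^ (m - 1)) * \<sigma>\<^sup>2"
        using s C2 \<sigma> by (intro mult_left_mono) auto
      also have "\<dots> \<le> C2 * \<sigma> ^ n"
      proof -
        have "\<sigma> ^ (m - 1) * \<sigma>\<^sup>2 \<le> \<sigma> ^ n"
        proof (cases m)
          case 0
          then show ?thesis using \<sigma> \<sigma>0 Suc by (simp add: power2_eq_square mult_left_le)
        next
          case (Suc l)
          then show ?thesis using \<open>n = Suc m\<close> by (simp add: power2_eq_square mult_ac)
        qed
        then show ?thesis using C2(1) by (simp add: mult_left_mono mult.assoc)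
      qed
      finally have "\<bar>H 0 p0 (\<tau>0 - s) - H 0 p0 \<tau>0\<bar> \<le> C2 * \<sigma> ^ n" by simp
      moreover have "H 0 p0 \<tau>0 = 0" using less.prems Suc by simp
      ultimately have "\<bar>H 0 (p0 + x) (\<tau>0 - s)\<bar> \<le> 3 * C1 * \<sigma> ^ n + C2 * \<sigma> ^ n"
        using 1 by linarith
      then show ?thesis by (simp only: distrib_right)
    qed
    then show ?thesis using C1(1) C2(1) by (intro exI[of _ "3 * C1 + C2"]) auto
  qed
qed

text \<open>
  The vanishing order of \<open>D\<close> gives the bound. Applied to its \<open>p\<close>-derivative, whose order is one less, it gives
  the Lipschitz constant, because differentiation in \<open>P\<close> returns the missing factor \<open>\<sigma>\<close>.
\<close>

lemma caloric_rescaling: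
  assumes D: "caloric_jet D" and \<tau>0: "0 < \<tau>0" and \<sigma>0: "\<sigma>0 \<le> 1" "\<sigma>0\<^sup>2 \<le> \<tau>0 / 2"
    and van: "\<And>k. k \<le> n \<Longrightarrow> D k p0 \<tau>0 = 0"
  shows "\<exists>C\<ge>0. \<forall>\<sigma>\<in>{0<..\<sigma>0}.
    (C * \<sigma>)-lipschitz_on {-3..3} (\<lambda>P. D 0 (p0 + \<sigma> * P) (\<tau>0 - \<sigma>\<^sup>2) / \<sigma> ^ n) \<and>
    (\<forall>P\<in>{-3..3}. \<bar>D 0 (p0 + \<sigma> * P) (\<tau>0 - \<sigma>\<^sup>2) / \<sigma> ^ n\<bar> \<le> C * \<sigma>)"
proof -
  obtain C0 where C0: "0 \<le> C0" "\<And>\<sigma> x s. \<sigma> \<in> {0..\<sigma>0} \<Longrightarrow> \<bar>x\<bar> \<le> 3 * \<sigma> \<Longrightarrow> 0 \<le> s \<Longrightarrow> s \<le> \<sigma>\<^sup>2 \<Longrightarrow>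
      \<bar>D 0 (p0 + x) (\<tau>0 - s)\<bar> \<le> C0 * \<sigma> ^ Suc n"
    using parabolic_vanishing_order[OF D \<tau>0 \<sigma>0, of "Suc n" p0] van by (auto simp: less_Suc_eq_le)
  obtain C1 where C1: "0 \<le> C1" "\<And>\<sigma> x s. \<sigma> \<in> {0..\<sigma>0} \<Longrightarrow> \<bar>x\<bar> \<le> 3 * \<sigma> \<Longrightarrow> 0 \<le> s \<Longrightarrow> s \<le> \<sigma>\<^sup>2 \<Longrightarrow>
      \<bar>D (Suc 0) (p0 + x) (\<tau>0 - s)\<bar> \<le> C1 * \<sigma> ^ n"
    using parabolic_vanishing_order[OF caloric_jet_shift[OF D, of 1] \<tau>0 \<sigma>0, of n p0] van by auto
  have "(max C0 C1 * \<sigma>)-lipschitz_on {-3..3} (\<lambda>P. D 0 (p0 + \<sigma> * P) (\<tau>0 - \<sigma>\<^sup>2) / \<sigma> ^ n) \<and>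
    (\<forall>P\<in>{-3..3}. \<bar>D 0 (p0 + \<sigma> * P) (\<tau>0 - \<sigma>\<^sup>2) / \<sigma> ^ n\<bar> \<le> max C0 C1 * \<sigma>)"
    if \<sigma>: "\<sigma> \<in> {0<..\<sigma>0}" for \<sigma>
  proof (intro conjI ballI)
    have sq: "\<sigma>\<^sup>2 \<le> \<tau>0 / 2" using \<sigma> by (intro order_trans[OF power_mono \<sigma>0(2)]) auto
    have small: "\<bar>\<sigma> * P\<bar> \<le> 3 * \<sigma>" if "P \<in> {-3..3}" for P
      using that \<sigma> by (auto simp: abs_mult abs_le_iff)
    have deriv: "((\<lambda>P. D 0 (p0 + \<sigma> * P) (\<tau>0 - \<sigma>\<^sup>2) / \<sigma> ^ n) has_real_derivative
        D (Suc 0) (p0 + \<sigma> * P) (\<tau>0 - \<sigma>\<^sup>2) * \<sigma> / \<sigma> ^ n) (at P within S)" for P S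
    proof -
      have "((\<lambda>P. p0 + \<sigma> * P) has_real_derivative \<sigma>) (at P within S)"
        by (auto intro!: derivative_eq_intros)
      then have "((\<lambda>P. D 0 (p0 + \<sigma> * P) (\<tau>0 - \<sigma>\<^sup>2)) has_real_derivative
          D (Suc 0) (p0 + \<sigma> * P) (\<tau>0 - \<sigma>\<^sup>2) * \<sigma>) (at P within S)"
        using sq \<tau>0 by (intro DERIV_chain2[OF caloric_jet_deriv(1)[OF D]]) auto
      then show ?thesis by (rule DERIV_cdivide)
    qed
    have "\<bar>D (Suc 0) (p0 + \<sigma> * P) (\<tau>0 - \<sigma>\<^sup>2) * \<sigma> / \<sigma> ^ n\<bar> \<le> max C0 C1 * \<sigma>" if "P \<in> {-3..3}" for P
    proof -
      have "\<bar>D (Suc 0) (p0 + \<sigma> * P) (\<tau>0 - \<sigma>\<^sup>2)\<bar> \<le> C1 * \<sigma> ^ n"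
        using \<sigma> small[OF that] by (intro C1) auto
      then have "\<bar>D (Suc 0) (p0 + \<sigma> * P) (\<tau>0 - \<sigma>\<^sup>2)\<bar> * \<sigma> / \<sigma> ^ n \<le> (C1 * \<sigma> ^ n) * \<sigma> / \<sigma> ^ n"
        using \<sigma> by (intro divide_right_mono mult_right_mono) auto
      also have "\<dots> = C1 * \<sigma>" using \<sigma> by simp
      also have "\<dots> \<le> max C0 C1 * \<sigma>" using \<sigma> by (intro mult_right_mono) auto
      finally show ?thesis using \<sigma> by (simp add: abs_mult abs_divide)
    qed
    then show "(max C0 C1 * \<sigma>)-lipschitz_on {-3..3} (\<lambda>P. D 0 (p0 + \<sigma> * P) (\<tau>0 - \<sigma>\<^sup>2) / \<sigma> ^ n)"
      using field_differentiable_bound[OF convex_real_interval(5)[of "-3" 3] deriv, of "max C0 C1 * \<sigma>"]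
        \<sigma> C0(1)
      by (intro lipschitz_onI) (auto simp: dist_norm)
    fix P :: real assume P: "P \<in> {-3..3}"
    have "\<bar>D 0 (p0 + \<sigma> * P) (\<tau>0 - \<sigma>\<^sup>2)\<bar> \<le> C0 * \<sigma> ^ Suc n"
      using \<sigma> small[OF P] by (intro C0) auto
    then have "\<bar>D 0 (p0 + \<sigma> * P) (\<tau>0 - \<sigma>\<^sup>2)\<bar> / \<sigma> ^ n \<le> C0 * \<sigma> ^ Suc n / \<sigma> ^ n"
      using \<sigma> by (intro divide_right_mono) auto
    also have "\<dots> = C0 * \<sigma>" using \<sigma> by simp
    also have "\<dots> \<le> max C0 C1 * \<sigma>" using \<sigma> by (intro mult_right_mono) auto
    finally show "\<bar>D 0 (p0 + \<sigma> * P) (\<tau>0 - \<sigma>\<^sup>2) / \<sigma> ^ n\<bar> \<le> max C0 C1 * \<sigma>"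
      using \<sigma> by (simp add: abs_divide)
  qed
  then show ?thesis using C0(1) by (intro exI[of _ "max C0 C1"]) auto
qed

text \<open>
  The caloric polynomial \<open>A (x\<^sup>2 + t) + B (x\<^sup>3 + 3 x t)\<close> at \<open>x = p - p0\<close>, \<open>t = \<tau> - \<tau>0\<close>, and its derivatives
  in \<open>p\<close>.
\<close>

definition caloric_polynomial :: "real \<Rightarrow> real \<Rightarrow> real \<Rightarrow> real \<Rightarrow> nat \<Rightarrow> real \<Rightarrow> real \<Rightarrow> real" where
  "caloric_polynomial A B p0 \<tau>0 k p \<tau> =
    (if k = 0 then A * ((p - p0)\<^sup>2 + (\<tau> - \<tau>0)) + B * ((p - p0) ^ 3 + 3 * (p - p0) * (\<tau> - \<tau>0))
     else if k = 1 then 2 * A * (p - p0) + 3 * B * ((p - p0)\<^sup>2 + (\<tau> - \<tau>0))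
     else if k = 2 then 2 * A + 6 * B * (p - p0)
     else if k = 3 then 6 * B else 0)"

lemma caloric_jet_polynomial: "caloric_jet (caloric_polynomial A B p0 \<tau>0)"
  unfolding caloric_jet_def
proof (intro conjI allI impI)
  fix k :: nat and p \<tau> :: real
  let ?c = "caloric_polynomial A B p0 \<tau>0"
  consider "k = 0" | "k = 1" | "k = 2" | "k = 3" | "4 \<le> k" by linarith
  note cases = this
  show "((\<lambda>p. ?c k p \<tau>) has_real_derivative ?c (Suc k) p \<tau>) (at p)"
    by (cases rule: cases)
      (auto simp: caloric_polynomial_def algebra_simps intro!: derivative_eq_intros)
  show "((\<lambda>\<tau>. ?c k p \<tau>) has_real_derivative ?c (k + 2) p \<tau> / 2) (at \<tau>)"
    by (cases rule: cases)
      (auto simp: caloric_polynomial_def algebra_simps intro!: derivative_eq_intros)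
next
  fix k :: nat
  consider "k = 0" | "k = 1" | "k = 2" | "k = 3" | "4 \<le> k" by linarith
  then show "continuous_on (UNIV \<times> {0<..}) (\<lambda>(p, \<tau>). caloric_polynomial A B p0 \<tau>0 k p \<tau>)"
    unfolding caloric_polynomial_def case_prod_beta'
    by cases (auto intro!: continuous_intros)
qed

text \<open>
  At \<open>(p0 + \<sigma> P, \<tau>0 - \<sigma>\<^sup>2)\<close> the caloric polynomials become multiples of the Hermite polynomials
  \<open>P\<^sup>2 - 1\<close> and \<open>P\<^sup>3 - 3 P\<close>; the difference to \<open>H\<close> vanishes to order \<open>n + 1\<close>.
\<close>

lemma caloric_rescaling_polynomial:
  assumes H: "caloric_jet H" and \<tau>0: "0 < \<tau>0" and \<sigma>0: "\<sigma>0 \<le> 1" "\<sigma>0\<^sup>2 \<le> \<tau>0 / 2"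
    and van: "\<And>k. k \<le> n \<Longrightarrow> H k p0 \<tau>0 = caloric_polynomial A B p0 \<tau>0 k p0 \<tau>0"
  shows "\<exists>C\<ge>0. \<forall>\<sigma>\<in>{0<..\<sigma>0}.
    (C * \<sigma>)-lipschitz_on {-3..3} (\<lambda>P. (H 0 (p0 + \<sigma> * P) (\<tau>0 - \<sigma>\<^sup>2)
        - (A * \<sigma>\<^sup>2 * (P\<^sup>2 - 1) + B * \<sigma> ^ 3 * (P ^ 3 - 3 * P))) / \<sigma> ^ n) \<and>
    (\<forall>P\<in>{-3..3}. \<bar>(H 0 (p0 + \<sigma> * P) (\<tau>0 - \<sigma>\<^sup>2)
        - (A * \<sigma>\<^sup>2 * (P\<^sup>2 - 1) + B * \<sigma> ^ 3 * (P ^ 3 - 3 * P))) / \<sigma> ^ n\<bar> \<le> C * \<sigma>)"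
proof -
  have poly: "caloric_polynomial A B p0 \<tau>0 0 (p0 + \<sigma> * P) (\<tau>0 - \<sigma>\<^sup>2) =
      A * \<sigma>\<^sup>2 * (P\<^sup>2 - 1) + B * \<sigma> ^ 3 * (P ^ 3 - 3 * P)" for \<sigma> P
    by (simp add: caloric_polynomial_def power2_eq_square power3_eq_cube algebra_simps)
  show ?thesis
    using caloric_rescaling[OF caloric_jet_diff[OF H caloric_jet_polynomial[of A B p0 \<tau>0]] \<tau>0 \<sigma>0, of n p0]
      van unfolding poly by simp
qed

text \<open>
  The case \<open>s = 0\<close>, \<open>\<sigma> = \<bar>x\<bar>\<close> of \<open>parabolic_vanishing_order\<close>.
\<close>

lemma caloric_taylor:
  assumes H: "caloric_jet H" and \<tau>0: "0 < \<tau>0"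
    and van: "\<And>k. k \<le> n \<Longrightarrow> H k p0 \<tau>0 = caloric_polynomial A B p0 \<tau>0 k p0 \<tau>0"
  shows "((\<lambda>x. (H 0 (p0 + x) \<tau>0 - (A * x\<^sup>2 + B * x ^ 3)) / x ^ n) \<longlongrightarrow> 0) (at 0)"
proof -
  define \<sigma>0 where "\<sigma>0 = min 1 (sqrt (\<tau>0 / 2))"
  have \<sigma>0: "0 < \<sigma>0" "\<sigma>0 \<le> 1" "\<sigma>0\<^sup>2 \<le> \<tau>0 / 2"
  proof -
    show "0 < \<sigma>0" "\<sigma>0 \<le> 1" using \<tau>0 by (simp_all add: \<sigma>0_def)
    have "\<sigma>0\<^sup>2 \<le> (sqrt (\<tau>0 / 2))\<^sup>2" using \<tau>0 by (intro power_mono) (auto simp: \<sigma>0_def)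
    then show "\<sigma>0\<^sup>2 \<le> \<tau>0 / 2" using \<tau>0 by simp
  qed
  obtain C where C: "0 \<le> C" "\<And>\<sigma> x s. \<sigma> \<in> {0..\<sigma>0} \<Longrightarrow> \<bar>x\<bar> \<le> 3 * \<sigma> \<Longrightarrow> 0 \<le> s \<Longrightarrow> s \<le> \<sigma>\<^sup>2 \<Longrightarrow>
      \<bar>H 0 (p0 + x) (\<tau>0 - s) - caloric_polynomial A B p0 \<tau>0 0 (p0 + x) (\<tau>0 - s)\<bar> \<le> C * \<sigma> ^ Suc n"
    using parabolic_vanishing_order[OF caloric_jet_diff[OF H caloric_jet_polynomial[of A B p0 \<tau>0]]
        \<tau>0 \<sigma>0(2,3), of "Suc n" p0] van by (auto simp: less_Suc_eq_le)
  have "\<forall>\<^sub>F x in at 0. x \<in> {- \<sigma>0<..<\<sigma>0} - {0}"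
    using \<sigma>0 by (intro eventually_at_in_open) auto
  then have "\<forall>\<^sub>F x in at 0. norm ((H 0 (p0 + x) \<tau>0 - (A * x\<^sup>2 + B * x ^ 3)) / x ^ n) \<le> C * \<bar>x\<bar>"
  proof eventually_elim
    case (elim x)
    have "\<bar>H 0 (p0 + x) \<tau>0 - (A * x\<^sup>2 + B * x ^ 3)\<bar> \<le> C * \<bar>x\<bar> ^ Suc n"
      using C(2)[of "\<bar>x\<bar>" x 0] elim by (auto simp: caloric_polynomial_def)
    then have "\<bar>H 0 (p0 + x) \<tau>0 - (A * x\<^sup>2 + B * x ^ 3)\<bar> / \<bar>x\<bar> ^ n \<le> C * \<bar>x\<bar> ^ Suc n / \<bar>x\<bar> ^ n"
      by (intro divide_right_mono) auto
    then show ?case using elim by (simp add: abs_divide power_abs)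
  qed
  moreover have "((\<lambda>x. C * \<bar>x\<bar>) \<longlongrightarrow> 0) (at 0)"
    using tendsto_mult[OF tendsto_const tendsto_rabs[OF tendsto_ident_at], of C 0 UNIV] by simp
  ultimately show ?thesis by (rule Lim_null_comparison)
qed

section \<open>Natural co-ordinates and derivatives\<close>

text \<open>
  Co-ordinate functions of the smoothed path and their derivatives: \<open>v = u\<close> gives the first co-ordinate
  after rotation by \<open>u\<close>, and \<open>v = - \<i> * u\<close> the second one. The base point \<open>c\<close> affects the function itself only.
\<close>

definition heat_component :: "(real \<Rightarrow> complex) \<Rightarrow> complex \<Rightarrow> complex \<Rightarrow> nat \<Rightarrow> real \<Rightarrow> real \<Rightarrow> real" where
  "heat_component w v c k p \<tau> = Re (v * (heat_flow w k p \<tau> - (if k = 0 then c else 0)))"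

lemma caloric_jet_heat_component:
  assumes w: "integrable lborel (\<lambda>q. exp (- \<bar>q\<bar>) *\<^sub>R w q)" "w \<in> borel_measurable borel"
  shows "caloric_jet (heat_component w v c)"
  unfolding caloric_jet_def
proof (intro conjI allI impI)
  have lin: "bounded_linear (\<lambda>z. Re (v * z))"
    by (intro bounded_linear_compose[OF bounded_linear_Re] bounded_linear_mult_right)
  fix k p and \<tau> :: real assume \<tau>: "0 < \<tau>"
  have "((\<lambda>p. heat_flow w k p \<tau> - (if k = 0 then c else 0)) has_vector_derivative heat_flow w (Suc k) p \<tau> - 0) (at p)"
    by (intro has_vector_derivative_diff has_vector_derivative_const heat_flow_deriv_x[OF w \<tau>])
  from bounded_linear.has_vector_derivative[OF lin this]
  show "((\<lambda>p. heat_component w v c k p \<tau>) has_real_derivative heat_component w v c (Suc k) p \<tau>) (at p)"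
    by (simp add: heat_component_def has_real_derivative_iff_has_vector_derivative)
  have "((\<lambda>\<tau>. heat_flow w k p \<tau> - (if k = 0 then c else 0)) has_vector_derivative
      (1 / 2) *\<^sub>R heat_flow w (k + 2) p \<tau> - 0) (at \<tau>)"
    by (intro has_vector_derivative_diff has_vector_derivative_const heat_flow_deriv_t[OF w \<tau>])
  from bounded_linear.has_vector_derivative[OF lin this]
  show "((\<lambda>\<tau>. heat_component w v c k p \<tau>) has_real_derivative heat_component w v c (k + 2) p \<tau> / 2) (at \<tau>)"
    by (simp add: heat_component_def has_real_derivative_iff_has_vector_derivative)
next
  fix k
  show "continuous_on (UNIV \<times> {0<..}) (\<lambda>(p, \<tau>). heat_component w v c k p \<tau>)"
    using continuous_on_heat_flow[OF w, of k] unfolding heat_component_def case_prod_beta'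
    by (intro continuous_intros)
qed

lemma caloric_leading_coefficients:
  assumes H: "caloric_jet H" and \<tau>0: "0 < \<tau>0" and van: "H 0 p0 \<tau>0 = 0" "H 1 p0 \<tau>0 = 0"
  shows "((\<lambda>x. H 0 (p0 + x) \<tau>0 / x\<^sup>2) \<longlongrightarrow> H 2 p0 \<tau>0 / 2) (at 0)"
    and "H 2 p0 \<tau>0 = 0 \<Longrightarrow> ((\<lambda>x. H 0 (p0 + x) \<tau>0 / x ^ 3) \<longlongrightarrow> H 3 p0 \<tau>0 / 6) (at 0)"
proof -
  have le2: "k = 0 \<or> k = 1 \<or> k = 2" if "k \<le> 2" for k :: nat using that by linarith
  have le3: "k = 0 \<or> k = 1 \<or> k = 2 \<or> k = 3" if "k \<le> 3" for k :: nat using that by linarith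
  have nz: "\<forall>\<^sub>F x in at 0. x \<noteq> (0::real)" by (simp add: eventually_at_filter)
  define A where "A = H 2 p0 \<tau>0 / 2"
  have "((\<lambda>x. (H 0 (p0 + x) \<tau>0 - (A * x\<^sup>2 + 0 * x ^ 3)) / x\<^sup>2) \<longlongrightarrow> 0) (at 0)"
    using van by (intro caloric_taylor[OF H \<tau>0]) (auto simp: caloric_polynomial_def A_def dest!: le2)
  then have "((\<lambda>x. (H 0 (p0 + x) \<tau>0 - (A * x\<^sup>2 + 0 * x ^ 3)) / x\<^sup>2 + A) \<longlongrightarrow> 0 + A) (at 0)"
    by (intro tendsto_add tendsto_const)
  then have "((\<lambda>x. H 0 (p0 + x) \<tau>0 / x\<^sup>2) \<longlongrightarrow> 0 + A) (at 0)"
    by (rule Lim_transform_eventually) (use nz in eventually_elim, simp add: diff_divide_distrib)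
  then show "((\<lambda>x. H 0 (p0 + x) \<tau>0 / x\<^sup>2) \<longlongrightarrow> H 2 p0 \<tau>0 / 2) (at 0)" by (simp add: A_def)
  assume H2: "H 2 p0 \<tau>0 = 0"
  define B where "B = H 3 p0 \<tau>0 / 6"
  have "((\<lambda>x. (H 0 (p0 + x) \<tau>0 - (0 * x\<^sup>2 + B * x ^ 3)) / x ^ 3) \<longlongrightarrow> 0) (at 0)"
    using van H2 by (intro caloric_taylor[OF H \<tau>0]) (auto simp: caloric_polynomial_def B_def dest!: le3)
  then have "((\<lambda>x. (H 0 (p0 + x) \<tau>0 - (0 * x\<^sup>2 + B * x ^ 3)) / x ^ 3 + B) \<longlongrightarrow> 0 + B) (at 0)"
    by (intro tendsto_add tendsto_const)
  then have "((\<lambda>x. H 0 (p0 + x) \<tau>0 / x ^ 3) \<longlongrightarrow> 0 + B) (at 0)"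
    by (rule Lim_transform_eventually) (use nz in eventually_elim, simp add: diff_divide_distrib)
  then show "((\<lambda>x. H 0 (p0 + x) \<tau>0 / x ^ 3) \<longlongrightarrow> H 3 p0 \<tau>0 / 6) (at 0)" by (simp add: B_def)
qed

text \<open>
  Dividing the power series by their lowest power leaves series with constant terms \<open>\<alpha> 2\<close> and \<open>\<beta> 3\<close>.
\<close>

lemma natural_coordinates_limits:
  assumes "natural_coordinates \<gamma> t0 u \<alpha> \<beta>"
  shows "((\<lambda>x. Re (u * (\<gamma> (t0 + x) - \<gamma> t0)) / x\<^sup>2) \<longlongrightarrow> \<alpha> 2) (at 0)"
    and "((\<lambda>x. Im (u * (\<gamma> (t0 + x) - \<gamma> t0)) / x ^ 3) \<longlongrightarrow> \<beta> 3) (at 0)"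
proof -
  obtain d where d: "0 < d" and sums: "\<And>t. t \<in> {t0 - d..t0 + d} \<Longrightarrow>
      (\<lambda>i. \<alpha> (i + 2) * (t - t0) ^ (i + 2)) sums Re (u * (\<gamma> t - \<gamma> t0)) \<and>
      (\<lambda>i. \<beta> (i + 3) * (t - t0) ^ (i + 3)) sums Im (u * (\<gamma> t - \<gamma> t0))"
    using assms unfolding natural_coordinates_def rigid_def by blast
  have cancel: "c * x ^ (i + n) / x ^ n = c * x ^ i" if "x \<noteq> 0" for c x :: real and i n
    using that by (simp add: power_add)
  have "(\<lambda>i. \<alpha> (i + 2) * x ^ i) sums (Re (u * (\<gamma> (t0 + x) - \<gamma> t0)) / x\<^sup>2)"
    "(\<lambda>i. \<beta> (i + 3) * x ^ i) sums (Im (u * (\<gamma> (t0 + x) - \<gamma> t0)) / x ^ 3)"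
    if x: "x \<noteq> 0" "norm x < d" for x
  proof -
    have "t0 + x \<in> {t0 - d..t0 + d}" using x by auto
    from sums[OF this] have s: "(\<lambda>i. \<alpha> (i + 2) * x ^ (i + 2)) sums Re (u * (\<gamma> (t0 + x) - \<gamma> t0))"
      "(\<lambda>i. \<beta> (i + 3) * x ^ (i + 3)) sums Im (u * (\<gamma> (t0 + x) - \<gamma> t0))" by simp_all
    show "(\<lambda>i. \<alpha> (i + 2) * x ^ i) sums (Re (u * (\<gamma> (t0 + x) - \<gamma> t0)) / x\<^sup>2)"
      "(\<lambda>i. \<beta> (i + 3) * x ^ i) sums (Im (u * (\<gamma> (t0 + x) - \<gamma> t0)) / x ^ 3)"
      using sums_divide[OF s(1), of "x\<^sup>2"] sums_divide[OF s(2), of "x ^ 3"]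
      by (simp_all only: cancel[OF x(1)])
  qed
  note s = this
  show "((\<lambda>x. Re (u * (\<gamma> (t0 + x) - \<gamma> t0)) / x\<^sup>2) \<longlongrightarrow> \<alpha> 2) (at 0)"
    using powser_limit_0_strong[OF d, of "\<lambda>i. \<alpha> (i + 2)"] s(1) by (simp add: numeral_2_eq_2)
  show "((\<lambda>x. Im (u * (\<gamma> (t0 + x) - \<gamma> t0)) / x ^ 3) \<longlongrightarrow> \<beta> 3) (at 0)"
    using powser_limit_0_strong[OF d, of "\<lambda>i. \<beta> (i + 3)"] s(2) by (simp add: numeral_3_eq_3)
qed

text \<open>
  The limits of \<open>natural_coordinates_limits\<close> are compared with the Taylor expansion of the solution.
  The existence of the limit for \<open>x ^ 3\<close> forces the second derivative of the second co-ordinate to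
  vanish.
\<close>

lemma natural_coordinates_heat_flow:
  assumes w: "integrable lborel (\<lambda>q. exp (- \<bar>q\<bar>) *\<^sub>R w q)" "w \<in> borel_measurable borel"
    and \<tau>0: "0 < \<tau>0" and sing: "singularity (\<lambda>p. heat_flow w 0 p \<tau>0) p0"
    and nat: "natural_coordinates (\<lambda>p. heat_flow w 0 p \<tau>0) p0 u \<alpha> \<beta>"
  shows "heat_flow w 1 p0 \<tau>0 = 0" "u * heat_flow w 2 p0 \<tau>0 = of_real (2 * \<alpha> 2)"
    "Im (u * heat_flow w 3 p0 \<tau>0) = 6 * \<beta> 3"
proof -
  show D1: "heat_flow w 1 p0 \<tau>0 = 0"
    using sing heat_flow_deriv_x[OF w \<tau>0, of 0 p0] unfolding singularity_def
    by (simp add: vector_derivative_unique_at)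
  define c where "c = heat_flow w 0 p0 \<tau>0"
  define H where "H = heat_component w u c"
  define K where "K = heat_component w (- \<i> * u) c"
  note jets = caloric_jet_heat_component[OF w, of u c, folded H_def]
    caloric_jet_heat_component[OF w, of "- \<i> * u" c, folded K_def]
  have van: "H 0 p0 \<tau>0 = 0" "H 1 p0 \<tau>0 = 0" "K 0 p0 \<tau>0 = 0" "K 1 p0 \<tau>0 = 0"
    using D1 by (simp_all add: H_def K_def heat_component_def c_def)
  have K_Im: "K k p \<tau> = Im (u * (heat_flow w k p \<tau> - (if k = 0 then c else 0)))" for k p \<tau>
    by (simp add: K_def heat_component_def algebra_simps)
  note lim = natural_coordinates_limits[OF nat, folded c_def]
  have limH: "((\<lambda>x. H 0 (p0 + x) \<tau>0 / x\<^sup>2) \<longlongrightarrow> \<alpha> 2) (at 0)"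
    and limK: "((\<lambda>x. K 0 (p0 + x) \<tau>0 / x ^ 3) \<longlongrightarrow> \<beta> 3) (at 0)"
    using lim unfolding K_Im by (simp_all add: H_def heat_component_def)
  have "H 2 p0 \<tau>0 / 2 = \<alpha> 2"
    by (rule tendsto_unique[OF _ caloric_leading_coefficients(1)[OF jets(1) \<tau>0 van(1,2)] limH]) simp
  moreover have "K 2 p0 \<tau>0 / 2 = 0"
  proof (rule tendsto_unique[OF _ caloric_leading_coefficients(1)[OF jets(2) \<tau>0 van(3,4)]])
    have "((\<lambda>x. x * (K 0 (p0 + x) \<tau>0 / x ^ 3)) \<longlongrightarrow> 0 * \<beta> 3) (at 0)"
      by (intro tendsto_mult limK tendsto_ident_at)
    moreover have "\<forall>\<^sub>F x in at 0. x * (K 0 (p0 + x) \<tau>0 / x ^ 3) = K 0 (p0 + x) \<tau>0 / x\<^sup>2"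
      by (simp add: eventually_at_filter power2_eq_square power3_eq_cube)
    ultimately have "((\<lambda>x. K 0 (p0 + x) \<tau>0 / x\<^sup>2) \<longlongrightarrow> 0 * \<beta> 3) (at 0)"
      by (rule Lim_transform_eventually)
    then show "((\<lambda>x. K 0 (p0 + x) \<tau>0 / x\<^sup>2) \<longlongrightarrow> 0) (at 0)" by simp
  qed simp
  ultimately show "u * heat_flow w 2 p0 \<tau>0 = of_real (2 * \<alpha> 2)"
    unfolding K_Im by (simp add: complex_eq_iff H_def heat_component_def)
  have "K 3 p0 \<tau>0 / 6 = \<beta> 3"
    using \<open>K 2 p0 \<tau>0 / 2 = 0\<close>
    by (intro tendsto_unique[OF _ caloric_leading_coefficients(2)[OF jets(2) \<tau>0 van(3,4)] limK]) simp_all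
  then show "Im (u * heat_flow w 3 p0 \<tau>0) = 6 * \<beta> 3" unfolding K_Im by simp
qed

section \<open>The rescaled curve near a cusp\<close>

text \<open>
  The rescaled curve at time \<open>\<tau>0 - \<sigma>\<^sup>2\<close>, normalised by the coefficients \<open>A\<close>, \<open>B\<close> of the cusp. Its values do not change
  when \<open>u\<close>, \<open>A\<close>, \<open>B\<close> all change sign.
\<close>

definition unfolding_curve ::
  "(real \<Rightarrow> real \<Rightarrow> complex) \<Rightarrow> complex \<Rightarrow> real \<Rightarrow> real \<Rightarrow> real \<Rightarrow> real \<Rightarrow> real \<Rightarrow> real \<Rightarrow> real \<times> real" where
  "unfolding_curve f u A B p0 \<tau>0 \<sigma> P =
     (let z = u * (f (p0 + \<sigma> * P) (\<tau>0 - \<sigma>\<^sup>2) - f p0 \<tau>0)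
      in (Re z / (A * \<sigma>\<^sup>2), Im z / (B * \<sigma> ^ 3)))"

lemma lipschitz_on_affine_image:
  fixes r :: "real \<Rightarrow> real"
  assumes "C-lipschitz_on S r" "A \<noteq> 0" "C / \<bar>A\<bar> \<le> C'" "\<And>P. P \<in> S \<Longrightarrow> x P = r P / A + d"
  shows "C'-lipschitz_on S x"
proof (rule lipschitz_onI)
  fix P Q assume PQ: "P \<in> S" "Q \<in> S"
  have "dist (x P) (x Q) = dist (r P) (r Q) / \<bar>A\<bar>"
    using assms(4) PQ by (simp add: dist_real_def abs_divide flip: diff_divide_distrib)
  also have "\<dots> \<le> C * dist P Q / \<bar>A\<bar>"
    using lipschitz_onD[OF assms(1) PQ] by (intro divide_right_mono) auto
  also have "\<dots> = C / \<bar>A\<bar> * dist P Q" by simp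
  also have "\<dots> \<le> C' * dist P Q" using assms(3) by (intro mult_right_mono) auto
  finally show "dist (x P) (x Q) \<le> C' * dist P Q" .
next
  have "0 \<le> C / \<bar>A\<bar>" using lipschitz_on_nonneg[OF assms(1)] by simp
  with assms(3) show "0 \<le> C'" by linarith
qed

text \<open>
  The first co-ordinate is matched with \<open>A (x\<^sup>2 + t)\<close> through order two and the second one with
  \<open>B (x\<^sup>3 + 3 x t)\<close> through order three, so both errors are \<open>O(\<sigma>)\<close> after division.
\<close>

lemma unfolding_curve_converges:
  assumes w: "integrable lborel (\<lambda>q. exp (- \<bar>q\<bar>) *\<^sub>R w q)" "w \<in> borel_measurable borel"
    and f: "\<And>p \<tau>. 0 < \<tau> \<Longrightarrow> f p \<tau> = heat_flow w 0 p \<tau>"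
    and \<tau>0: "0 < \<tau>0" and AB: "A \<noteq> 0" "B \<noteq> 0"
    and D: "heat_flow w 1 p0 \<tau>0 = 0" "u * heat_flow w 2 p0 \<tau>0 = of_real (2 * A)"
      "Im (u * heat_flow w 3 p0 \<tau>0) = 6 * B"
  obtains C \<sigma>0 where "0 < C" "0 < \<sigma>0" "\<sigma>0\<^sup>2 \<le> \<tau>0 / 2"
    "\<And>\<sigma>. \<sigma> \<in> {0<..\<sigma>0} \<Longrightarrow>
       (C * \<sigma>)-lipschitz_on {-3..3} (\<lambda>P. fst (unfolding_curve f u A B p0 \<tau>0 \<sigma> P) - P\<^sup>2)"
    "\<And>\<sigma>. \<sigma> \<in> {0<..\<sigma>0} \<Longrightarrow>
       (C * \<sigma>)-lipschitz_on {-3..3} (\<lambda>P. snd (unfolding_curve f u A B p0 \<tau>0 \<sigma> P) - (P ^ 3 - 3 * P))"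
    "\<And>\<sigma> P. \<sigma> \<in> {0<..\<sigma>0} \<Longrightarrow> P \<in> {-3..3} \<Longrightarrow>
       \<bar>fst (unfolding_curve f u A B p0 \<tau>0 \<sigma> P) - (P\<^sup>2 - 1)\<bar> \<le> C * \<sigma>"
    "\<And>\<sigma> P. \<sigma> \<in> {0<..\<sigma>0} \<Longrightarrow> P \<in> {-3..3} \<Longrightarrow>
       \<bar>snd (unfolding_curve f u A B p0 \<tau>0 \<sigma> P) - (P ^ 3 - 3 * P)\<bar> \<le> C * \<sigma>"
proof -
  define c where "c = heat_flow w 0 p0 \<tau>0"
  define H where "H = heat_component w u c"
  define K where "K = heat_component w (- \<i> * u) c"
  note jets = caloric_jet_heat_component[OF w, of u c, folded H_def]
    caloric_jet_heat_component[OF w, of "- \<i> * u" c, folded K_def]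
  define \<sigma>0 where "\<sigma>0 = min 1 (sqrt (\<tau>0 / 2))"
  have \<sigma>0: "0 < \<sigma>0" "\<sigma>0 \<le> 1" "\<sigma>0\<^sup>2 \<le> \<tau>0 / 2"
  proof -
    show "0 < \<sigma>0" "\<sigma>0 \<le> 1" using \<tau>0 by (simp_all add: \<sigma>0_def)
    have "\<sigma>0\<^sup>2 \<le> (sqrt (\<tau>0 / 2))\<^sup>2" using \<tau>0 by (intro power_mono) (auto simp: \<sigma>0_def)
    then show "\<sigma>0\<^sup>2 \<le> \<tau>0 / 2" using \<tau>0 by simp
  qed
  have le2: "k = 0 \<or> k = 1 \<or> k = 2" if "k \<le> 2" for k :: nat using that by linarith
  have le3: "k = 0 \<or> k = 1 \<or> k = 2 \<or> k = 3" if "k \<le> 3" for k :: nat using that by linarith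
  have K_Im: "K k p \<tau> = Im (u * (heat_flow w k p \<tau> - (if k = 0 then c else 0)))" for k p \<tau>
    by (simp add: K_def heat_component_def algebra_simps)
  have H_Re: "H k p \<tau> = Re (u * (heat_flow w k p \<tau> - (if k = 0 then c else 0)))" for k p \<tau>
    by (simp add: H_def heat_component_def)
  have H_val: "H 0 p0 \<tau>0 = 0" "H 1 p0 \<tau>0 = 0" "H 2 p0 \<tau>0 = 2 * A"
    using D unfolding H_Re by (simp_all add: c_def)
  have K_val: "K 0 p0 \<tau>0 = 0" "K 1 p0 \<tau>0 = 0" "K 2 p0 \<tau>0 = 0" "K 3 p0 \<tau>0 = 6 * B"
    using D unfolding K_Im by (simp_all add: c_def)
  have "H k p0 \<tau>0 = caloric_polynomial A 0 p0 \<tau>0 k p0 \<tau>0" if "k \<le> 2" for k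
    using le2[OF that] H_val by (elim disjE) (simp_all add: caloric_polynomial_def)
  from caloric_rescaling_polynomial[OF jets(1) \<tau>0 \<sigma>0(2,3) this]
  obtain C1 where C1: "0 \<le> C1" "\<And>\<sigma>. \<sigma> \<in> {0<..\<sigma>0} \<Longrightarrow>
      (C1 * \<sigma>)-lipschitz_on {-3..3} (\<lambda>P. (H 0 (p0 + \<sigma> * P) (\<tau>0 - \<sigma>\<^sup>2)
        - (A * \<sigma>\<^sup>2 * (P\<^sup>2 - 1) + 0 * \<sigma> ^ 3 * (P ^ 3 - 3 * P))) / \<sigma>\<^sup>2)"
    "\<And>\<sigma> P. \<sigma> \<in> {0<..\<sigma>0} \<Longrightarrow> P \<in> {-3..3} \<Longrightarrow> \<bar>(H 0 (p0 + \<sigma> * P) (\<tau>0 - \<sigma>\<^sup>2)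
        - (A * \<sigma>\<^sup>2 * (P\<^sup>2 - 1) + 0 * \<sigma> ^ 3 * (P ^ 3 - 3 * P))) / \<sigma>\<^sup>2\<bar> \<le> C1 * \<sigma>" by blast
  have "K k p0 \<tau>0 = caloric_polynomial 0 B p0 \<tau>0 k p0 \<tau>0" if "k \<le> 3" for k
    using le3[OF that] K_val by (elim disjE) (simp_all add: caloric_polynomial_def)
  from caloric_rescaling_polynomial[OF jets(2) \<tau>0 \<sigma>0(2,3) this]
  obtain C2 where C2: "0 \<le> C2" "\<And>\<sigma>. \<sigma> \<in> {0<..\<sigma>0} \<Longrightarrow>
      (C2 * \<sigma>)-lipschitz_on {-3..3} (\<lambda>P. (K 0 (p0 + \<sigma> * P) (\<tau>0 - \<sigma>\<^sup>2)
        - (0 * \<sigma>\<^sup>2 * (P\<^sup>2 - 1) + B * \<sigma> ^ 3 * (P ^ 3 - 3 * P))) / \<sigma> ^ 3)"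
    "\<And>\<sigma> P. \<sigma> \<in> {0<..\<sigma>0} \<Longrightarrow> P \<in> {-3..3} \<Longrightarrow> \<bar>(K 0 (p0 + \<sigma> * P) (\<tau>0 - \<sigma>\<^sup>2)
        - (0 * \<sigma>\<^sup>2 * (P\<^sup>2 - 1) + B * \<sigma> ^ 3 * (P ^ 3 - 3 * P))) / \<sigma> ^ 3\<bar> \<le> C2 * \<sigma>" by blast
  define C where "C = C1 / \<bar>A\<bar> + C2 / \<bar>B\<bar> + 1"
  have C: "0 < C" "C1 / \<bar>A\<bar> \<le> C" "C2 / \<bar>B\<bar> \<le> C"
    using C1(1) C2(1) by (auto simp: C_def add_nonneg_pos)
  have curve: "fst (unfolding_curve f u A B p0 \<tau>0 \<sigma> P) = (H 0 (p0 + \<sigma> * P) (\<tau>0 - \<sigma>\<^sup>2)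
        - (A * \<sigma>\<^sup>2 * (P\<^sup>2 - 1) + 0 * \<sigma> ^ 3 * (P ^ 3 - 3 * P))) / \<sigma>\<^sup>2 / A + (P\<^sup>2 - 1)"
    "snd (unfolding_curve f u A B p0 \<tau>0 \<sigma> P) = (K 0 (p0 + \<sigma> * P) (\<tau>0 - \<sigma>\<^sup>2)
        - (0 * \<sigma>\<^sup>2 * (P\<^sup>2 - 1) + B * \<sigma> ^ 3 * (P ^ 3 - 3 * P))) / \<sigma> ^ 3 / B + (P ^ 3 - 3 * P)"
    if "\<sigma> \<in> {0<..\<sigma>0}" for \<sigma> P
  proof -
    have "\<sigma>\<^sup>2 \<le> \<tau>0 / 2" using that by (intro order_trans[OF power_mono \<sigma>0(3)]) auto
    then have eq: "u * (f (p0 + \<sigma> * P) (\<tau>0 - \<sigma>\<^sup>2) - f p0 \<tau>0) =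
        u * (heat_flow w 0 (p0 + \<sigma> * P) (\<tau>0 - \<sigma>\<^sup>2) - c)" using f \<tau>0 by (simp add: c_def)
    have "unfolding_curve f u A B p0 \<tau>0 \<sigma> P =
        (H 0 (p0 + \<sigma> * P) (\<tau>0 - \<sigma>\<^sup>2) / (A * \<sigma>\<^sup>2), K 0 (p0 + \<sigma> * P) (\<tau>0 - \<sigma>\<^sup>2) / (B * \<sigma> ^ 3))"
      unfolding unfolding_curve_def Let_def H_Re K_Im eq by simp
    then show "fst (unfolding_curve f u A B p0 \<tau>0 \<sigma> P) = (H 0 (p0 + \<sigma> * P) (\<tau>0 - \<sigma>\<^sup>2)
        - (A * \<sigma>\<^sup>2 * (P\<^sup>2 - 1) + 0 * \<sigma> ^ 3 * (P ^ 3 - 3 * P))) / \<sigma>\<^sup>2 / A + (P\<^sup>2 - 1)"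
      "snd (unfolding_curve f u A B p0 \<tau>0 \<sigma> P) = (K 0 (p0 + \<sigma> * P) (\<tau>0 - \<sigma>\<^sup>2)
        - (0 * \<sigma>\<^sup>2 * (P\<^sup>2 - 1) + B * \<sigma> ^ 3 * (P ^ 3 - 3 * P))) / \<sigma> ^ 3 / B + (P ^ 3 - 3 * P)"
      using that AB by (simp_all add: diff_divide_distrib mult.commute)
  qed
  have scale: "C1 * \<sigma> / \<bar>A\<bar> \<le> C * \<sigma>" "C2 * \<sigma> / \<bar>B\<bar> \<le> C * \<sigma>" if "\<sigma> \<in> {0<..\<sigma>0}" for \<sigma>
    using C that mult_right_mono[of _ C \<sigma>] by (simp_all flip: times_divide_eq_left)
  show ?thesis
  proof (rule that[OF C(1) \<sigma>0(1,3)])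
    fix \<sigma> assume \<sigma>: "\<sigma> \<in> {0<..\<sigma>0}"
    show "(C * \<sigma>)-lipschitz_on {-3..3} (\<lambda>P. fst (unfolding_curve f u A B p0 \<tau>0 \<sigma> P) - P\<^sup>2)"
    proof (rule lipschitz_on_affine_image[OF C1(2)[OF \<sigma>] AB(1) scale(1)[OF \<sigma>], of _ "-1"])
      fix P show "fst (unfolding_curve f u A B p0 \<tau>0 \<sigma> P) - P\<^sup>2 = (H 0 (p0 + \<sigma> * P) (\<tau>0 - \<sigma>\<^sup>2)
        - (A * \<sigma>\<^sup>2 * (P\<^sup>2 - 1) + 0 * \<sigma> ^ 3 * (P ^ 3 - 3 * P))) / \<sigma>\<^sup>2 / A + - 1"
        unfolding curve(1)[OF \<sigma>] by linarith
    qed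
    show "(C * \<sigma>)-lipschitz_on {-3..3} (\<lambda>P. snd (unfolding_curve f u A B p0 \<tau>0 \<sigma> P) - (P ^ 3 - 3 * P))"
    proof (rule lipschitz_on_affine_image[OF C2(2)[OF \<sigma>] AB(2) scale(2)[OF \<sigma>], of _ 0])
      fix P show "snd (unfolding_curve f u A B p0 \<tau>0 \<sigma> P) - (P ^ 3 - 3 * P) =
        (K 0 (p0 + \<sigma> * P) (\<tau>0 - \<sigma>\<^sup>2)
          - (0 * \<sigma>\<^sup>2 * (P\<^sup>2 - 1) + B * \<sigma> ^ 3 * (P ^ 3 - 3 * P))) / \<sigma> ^ 3 / B + 0"
        unfolding curve(2)[OF \<sigma>] by linarith
    qed
    fix P :: real assume P: "P \<in> {-3..3}"
    show "\<bar>fst (unfolding_curve f u A B p0 \<tau>0 \<sigma> P) - (P\<^sup>2 - 1)\<bar> \<le> C * \<sigma>"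
      unfolding curve(1)[OF \<sigma>] add_diff_cancel_right' abs_divide[of _ A]
      by (rule order_trans[OF divide_right_mono[OF C1(3)[OF \<sigma> P] abs_ge_zero] scale(1)[OF \<sigma>]])
    show "\<bar>snd (unfolding_curve f u A B p0 \<tau>0 \<sigma> P) - (P ^ 3 - 3 * P)\<bar> \<le> C * \<sigma>"
      unfolding curve(2)[OF \<sigma>] add_diff_cancel_right' abs_divide[of _ B]
      by (rule order_trans[OF divide_right_mono[OF C2(3)[OF \<sigma> P] abs_ge_zero] scale(2)[OF \<sigma>]])
  qed
qed

text \<open>
  In natural co-ordinates the second derivative of the curve is a nonzero real number, which fixes the
  rotation up to a real factor. The third derivative then scales by the same factor.
\<close>

lemma natural_coordinates_unique_up_to_sign:
  fixes u u' d2 d3 :: complex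
  assumes "norm u = 1" "norm u' = 1" "A \<noteq> 0"
    and "u * d2 = of_real (2 * A)" "u' * d2 = of_real (2 * A')"
    and "Im (u * d3) = 6 * B" "Im (u' * d3) = 6 * B'"
  obtains \<rho> :: real where "\<bar>\<rho>\<bar> = 1" "u' = of_real \<rho> * u" "A' = \<rho> * A" "B' = \<rho> * B"
proof -
  define \<rho> where "\<rho> = A' / A"
  have A': "A' = \<rho> * A" using assms(3) by (simp add: \<rho>_def)
  have "d2 \<noteq> 0" using assms(3,4) by auto
  moreover have "u' * d2 = (of_real \<rho> * u) * d2"
    unfolding mult.assoc assms(4,5) A' by simp
  ultimately have u': "u' = of_real \<rho> * u" by simp
  moreover have "\<bar>\<rho>\<bar> = 1" using assms(1,2) unfolding u' by (simp add: norm_mult)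
  moreover have "6 * B' = \<rho> * (6 * B)" unfolding assms(6,7)[symmetric] u' by (simp add: mult.assoc)
  ultimately show ?thesis using A' by (intro that[of \<rho>]) auto
qed

lemma uniform_limit_of_joint_continuity:
  fixes g :: "'a::topological_space \<Rightarrow> 'b::topological_space \<Rightarrow> 'c::metric_space"
  assumes "continuous_on (U \<times> C) (\<lambda>z. g (fst z) (snd z))" "compact C" "x \<in> U" "S \<subseteq> U"
  shows "uniform_limit C g (g x) (at x within S)"
proof (rule uniform_limitI)
  fix e :: real assume e: "0 < e"
  obtain X0 where X0: "x \<in> X0" "open X0" "\<forall>y\<in>X0 \<inter> U. \<forall>t\<in>C. dist (g y t) (g x t) \<le> e / 2"
    using continuous_on_prod_compactE[OF assms(1,2,3), of "e / 2"] e by auto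
  have "\<forall>\<^sub>F y in at x within S. y \<in> X0 \<inter> U"
    unfolding eventually_at_topological using X0(1,2) assms(4) by blast
  then show "\<forall>\<^sub>F y in at x within S. \<forall>t\<in>C. dist (g y t) (g x t) < e"
  proof eventually_elim
    case (elim y)
    then have "\<forall>t\<in>C. dist (g y t) (g x t) \<le> e / 2" using X0(3) by blast
    moreover have "e / 2 < e" using e by simp
    ultimately show ?case by (meson le_less_trans)
  qed
qed

definition limit_loop :: "real \<Rightarrow> real \<Rightarrow> path" where
  "limit_loop x y = restr (\<lambda>P. Complex (x * (P\<^sup>2 - 1)) (y * (P ^ 3 - 3 * P))) (- sqrt 3) (sqrt 3)"

text \<open>
  The limiting curve is the perturbed curve of \<open>unique_double_point\<close> with error \<open>0\<close>.
\<close>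

lemma is_loop_limit_loop:
  assumes "x \<noteq> 0" "y \<noteq> 0" shows "is_loop (limit_loop x y)"
proof -
  let ?g = "\<lambda>P. Complex (x * (P\<^sup>2 - 1)) (y * (P ^ 3 - 3 * P))"
  let ?h = "\<lambda>P::real. (P\<^sup>2 - 1, P ^ 3 - 3 * P)"
  have "0-lipschitz_on {-3..3} (\<lambda>P::real. (P\<^sup>2 - 1) - P\<^sup>2)"
    "0-lipschitz_on {-3..3} (\<lambda>P::real. (P ^ 3 - 3 * P) - (P ^ 3 - 3 * P))"
    by (auto intro!: lipschitz_onI)
  from unique_double_point[OF this] obtain a b where
    uniq: "\<And>s t. double_point ?h {-3..3} s t \<Longrightarrow> s = a \<and> t = b" by auto
  have eq: "double_point ?g {-3..3} s t \<longleftrightarrow> double_point ?h {-3..3} s t" for s t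
    using assms by (auto simp: double_point_def)
  have "sqrt 3 \<le> sqrt (3\<^sup>2)" by (subst real_sqrt_le_iff) simp
  moreover have "0 \<le> sqrt (3 :: real)" by simp
  ultimately have root3: "sqrt 3 \<le> 3" "- sqrt 3 \<le> 3" "- 3 \<le> sqrt 3" by (simp, linarith+)
  have cube: "sqrt 3 ^ 3 = 3 * sqrt 3" by (simp add: power3_eq_cube)
  have dp: "double_point ?g {-3..3} (- sqrt 3) (sqrt 3)"
    using root3 cube by (simp add: double_point_def)
  have "loops_in ?g {-3..3} = {restr ?g (- sqrt 3) (sqrt 3)}"
  proof (rule loops_in_unique_double_point[OF _ _ dp])
    show "continuous_on {-3..3} ?g" by (intro continuous_intros)
    show "s = - sqrt 3 \<and> t = sqrt 3" if "double_point ?g {-3..3} s t" for s t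
      using uniq[of s t] uniq[of "- sqrt 3" "sqrt 3"] that dp unfolding eq by metis
  qed (rule is_interval_cc)
  then show ?thesis unfolding limit_loop_def loops_in_def by blast
qed

section \<open>Integrability of Brownian paths\<close>

lemma measurable_extend_by_zero:
  assumes "continuous_on {0..} w" shows "extend_by_zero w \<in> borel_measurable borel"
proof -
  have "(\<lambda>s. indicator {0<..} s *\<^sub>R w s) \<in> borel_measurable borel"
    using assms by (intro borel_measurable_continuous_on_indicator) (auto elim: continuous_on_subset)
  also have "(\<lambda>s. indicator {0<..} s *\<^sub>R w s) = extend_by_zero w"
    by (auto simp: extend_by_zero_def indicator_def)
  finally show ?thesis .
qed

context planar_brownian_motion
begin

lemma nn_integral_normal_square:
  assumes X: "distributed M lborel X (normal_density 0 (sqrt t))" and t: "0 < t"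
  shows "(\<integral>\<^sup>+\<omega>. ennreal ((X \<omega>)\<^sup>2) \<partial>M) = ennreal t"
proof -
  have m: "has_bochner_integral lborel (\<lambda>x. normal_density 0 (sqrt t) x * x\<^sup>2) t"
    using normal_moment_even[of "sqrt t" 0 1] t by (simp add: power_divide)
  have "(\<integral>\<^sup>+\<omega>. ennreal ((X \<omega>)\<^sup>2) \<partial>M) = (\<integral>\<^sup>+x. ennreal (normal_density 0 (sqrt t) x) * ennreal (x\<^sup>2) \<partial>lborel)"
    by (rule distributed_nn_integral[OF X, symmetric]) simp
  also have "\<dots> = (\<integral>\<^sup>+x. ennreal (normal_density 0 (sqrt t) x * x\<^sup>2) \<partial>lborel)"
    by (simp add: ennreal_mult)
  also have "\<dots> = ennreal t"
    using m by (subst nn_integral_eq_integral) (auto simp: has_bochner_integral_iff)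
  finally show ?thesis .
qed

text \<open>
  Only finite first moments that grow moderately in \<open>t\<close> are wanted, so \<open>\<bar>x\<bar> \<le> 1 + x\<^sup>2\<close> and the variances of
  the co-ordinates are enough.
\<close>

lemma nn_integral_norm_W_le:
  assumes "0 \<le> t" shows "(\<integral>\<^sup>+\<omega>. ennreal (norm (W t \<omega>)) \<partial>M) \<le> ennreal (2 + 2 * t)"
proof (cases "t = 0")
  case True
  have "(\<integral>\<^sup>+\<omega>. ennreal (norm (W t \<omega>)) \<partial>M) = (\<integral>\<^sup>+\<omega>. 0 \<partial>M)"
    using start_zero True by (intro nn_integral_cong_AE) auto
  then show ?thesis by simp
next
  case False
  then have t: "0 < t" using assms by simp
  define U where "U \<omega> = Re (W t \<omega> - W 0 \<omega>)" for \<omega>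
  define V where "V \<omega> = Im (W t \<omega> - W 0 \<omega>)" for \<omega>
  have [measurable]: "W t \<in> borel_measurable M" "W 0 \<in> borel_measurable M"
    using measurable_W assms by auto
  have [measurable]: "U \<in> borel_measurable M" "V \<in> borel_measurable M"
    unfolding U_def[abs_def] V_def[abs_def] by measurable
  have "distributed M lborel U (normal_density 0 (sqrt t))" "distributed M lborel V (normal_density 0 (sqrt t))"
    using increment_Re[of 0 t] increment_Im[of 0 t] t unfolding U_def[abs_def] V_def[abs_def] by auto
  note UV = this[THEN nn_integral_normal_square, OF t]
  have "(\<integral>\<^sup>+\<omega>. ennreal (norm (W t \<omega>)) \<partial>M) \<le> (\<integral>\<^sup>+\<omega>. 2 + ennreal ((U \<omega>)\<^sup>2) + ennreal ((V \<omega>)\<^sup>2) \<partial>M)"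
  proof (rule nn_integral_mono_AE)
    have abs_le: "\<bar>x\<bar> \<le> 1 + x\<^sup>2" for x :: real
      using zero_le_power2[of "\<bar>x\<bar> - 1"] by (simp add: power2_diff)
    show "AE \<omega> in M. ennreal (norm (W t \<omega>)) \<le> 2 + ennreal ((U \<omega>)\<^sup>2) + ennreal ((V \<omega>)\<^sup>2)"
      using start_zero
    proof eventually_elim
      case (elim \<omega>)
      have "norm (W t \<omega>) \<le> \<bar>U \<omega>\<bar> + \<bar>V \<omega>\<bar>" using elim cmod_le[of "W t \<omega>"] by (simp add: U_def V_def)
      also have "\<dots> \<le> 2 + (U \<omega>)\<^sup>2 + (V \<omega>)\<^sup>2" using abs_le[of "U \<omega>"] abs_le[of "V \<omega>"] by linarith
      finally have "ennreal (norm (W t \<omega>)) \<le> ennreal (2 + (U \<omega>)\<^sup>2 + (V \<omega>)\<^sup>2)" by (rule ennreal_leI)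
      then show ?case by (simp add: ennreal_plus)
    qed
  qed
  also have "\<dots> = 2 + ennreal t + ennreal t"
    using UV by (simp add: nn_integral_add emeasure_space_1)
  also have "\<dots> = ennreal (2 + 2 * t)"
    using t by (simp flip: ennreal_plus ennreal_numeral)
  finally show ?thesis .
qed

text \<open>
  By Tonelli's theorem it suffices that \<open>\<integral> E \<bar>W t\<bar> e\<^sup>-\<^sup>t dt\<close> is finite. Joint measurability in \<open>(\<omega>, t)\<close>
  comes from replacing \<open>t\<close> by the largest point of the grid \<open>\<nat> / (n + 1)\<close> below it; continuity
  of the paths and Fatou's lemma remove the grid.
\<close>

theorem AE_exp_integrable:
  "AE \<omega> in M. integrable lborel (\<lambda>q. exp (- \<bar>q\<bar>) *\<^sub>R extend_by_zero (\<lambda>t. W t \<omega>) q)"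
proof -
  define grid where "grid n t = real (nat \<lfloor>real (Suc n) * t\<rfloor>) / real (Suc n)" for n t
  have grid_le: "0 \<le> grid n t" "grid n t \<le> t" "t - 1 / real (Suc n) \<le> grid n t" if "0 < t" for n t
  proof -
    have fl: "real (nat \<lfloor>real (Suc n) * t\<rfloor>) = of_int \<lfloor>real (Suc n) * t\<rfloor>"
      using that by (simp add: of_nat_nat)
    show "0 \<le> grid n t" by (simp add: grid_def)
    show "grid n t \<le> t"
      unfolding grid_def fl using of_int_floor_le[of "real (Suc n) * t"]
      by (simp add: divide_le_eq mult.commute)
    have "real (Suc n) * t - 1 \<le> of_int \<lfloor>real (Suc n) * t\<rfloor>" by linarith
    then have "(real (Suc n) * t - 1) / real (Suc n) \<le> grid n t"
      unfolding grid_def fl by (intro divide_right_mono) auto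
    then show "t - 1 / real (Suc n) \<le> grid n t" by (simp add: diff_divide_distrib)
  qed
  have grid_lim: "(\<lambda>n. grid n t) \<longlonglongrightarrow> t" if "0 < t" for t
  proof (rule tendsto_sandwich[of "\<lambda>n. t - 1 / real (Suc n)" _ _ "\<lambda>_. t"])
    show "(\<lambda>n. t - 1 / real (Suc n)) \<longlonglongrightarrow> t"
      using tendsto_diff[OF tendsto_const LIMSEQ_inverse_real_of_nat, of t] by (simp add: inverse_eq_divide)
  qed (use grid_le[OF that] in auto)
  define g where "g n \<omega> t = ennreal (norm (W (grid n t) \<omega>)) * (ennreal (exp (- t)) * indicator {0<..} t)" for n \<omega> t
  have W_meas: "(\<lambda>z. W (grid n (snd z)) (fst z)) \<in> borel_measurable (M \<Otimes>\<^sub>M lborel)" for n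
    unfolding grid_def
  proof (rule measurable_compose_countable[of "\<lambda>i z. W (real i / real (Suc n)) (fst z)"])
    show "(\<lambda>z. W (real i / real (Suc n)) (fst z)) \<in> borel_measurable (M \<Otimes>\<^sub>M lborel)" for i :: nat
      by (rule measurable_compose[OF measurable_fst measurable_W]) simp
  qed measurable
  have g_meas [measurable]: "case_prod (g n) \<in> borel_measurable (M \<Otimes>\<^sub>M lborel)" for n
    unfolding g_def case_prod_beta' using W_meas[of n] by measurable
  interpret P: pair_sigma_finite M lborel ..
  have "(\<integral>\<^sup>+\<omega>. \<integral>\<^sup>+t. liminf (\<lambda>n. g n \<omega> t) \<partial>lborel \<partial>M) = (\<integral>\<^sup>+t. \<integral>\<^sup>+\<omega>. liminf (\<lambda>n. g n \<omega> t) \<partial>M \<partial>lborel)"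
    by (rule P.Fubini'[symmetric]) measurable
  also have "\<dots> \<le> (\<integral>\<^sup>+t. 2 * (ennreal (t ^ 0 * exp (- t)) * indicator {0..} t) +
      2 * (ennreal (t ^ 1 * exp (- t)) * indicator {0..} t) \<partial>lborel)"
  proof (rule nn_integral_mono)
    fix t :: real
    have "(\<integral>\<^sup>+\<omega>. liminf (\<lambda>n. g n \<omega> t) \<partial>M) \<le> liminf (\<lambda>n. \<integral>\<^sup>+\<omega>. g n \<omega> t \<partial>M)"
      by (rule nn_integral_liminf) measurable
    also have "\<dots> \<le> 2 * (ennreal (t ^ 0 * exp (- t)) * indicator {0..} t) +
      2 * (ennreal (t ^ 1 * exp (- t)) * indicator {0..} t)"
    proof (cases "0 < t")
      case True
      have "(\<integral>\<^sup>+\<omega>. g n \<omega> t \<partial>M) \<le> ennreal (2 + 2 * t) * ennreal (exp (- t))" for n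
      proof -
        have [measurable]: "W (grid n t) \<in> borel_measurable M"
          by (rule measurable_W) (use grid_le True in auto)
        have "(\<integral>\<^sup>+\<omega>. g n \<omega> t \<partial>M) = (\<integral>\<^sup>+\<omega>. ennreal (norm (W (grid n t) \<omega>)) \<partial>M) * ennreal (exp (- t))"
          using True unfolding g_def by (subst nn_integral_multc) (auto simp: nn_integral_multc)
        also have "\<dots> \<le> ennreal (2 + 2 * t) * ennreal (exp (- t))"
          using grid_le[OF True, of n] by (intro mult_right_mono order_trans[OF nn_integral_norm_W_le] ennreal_leI) auto
        finally show ?thesis .
      qed
      then have "liminf (\<lambda>n. \<integral>\<^sup>+\<omega>. g n \<omega> t \<partial>M) \<le> liminf (\<lambda>n. ennreal (2 + 2 * t) * ennreal (exp (- t)))"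
        by (intro Liminf_mono always_eventually allI)
      also have "\<dots> = ennreal (2 + 2 * t) * ennreal (exp (- t))"
        by (rule Liminf_const[OF sequentially_bot])
      also have "\<dots> = 2 * ennreal (exp (- t)) + 2 * ennreal (t * exp (- t))"
        using True by (simp add: ennreal_mult' ennreal_plus distrib_right mult.assoc)
      finally show ?thesis using True by simp
    next
      case False
      then show ?thesis by (simp add: g_def Liminf_const)
    qed
    finally show "(\<integral>\<^sup>+\<omega>. liminf (\<lambda>n. g n \<omega> t) \<partial>M) \<le> 2 * (ennreal (t ^ 0 * exp (- t)) * indicator {0..} t) +
      2 * (ennreal (t ^ 1 * exp (- t)) * indicator {0..} t)" .
  qed
  also have "\<dots> = (\<integral>\<^sup>+t. 2 * (ennreal (t ^ 0 * exp (- t)) * indicator {0..} t) \<partial>lborel) +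
      (\<integral>\<^sup>+t. 2 * (ennreal (t ^ 1 * exp (- t)) * indicator {0..} t) \<partial>lborel)"
    by (rule nn_integral_add) measurable
  also have "\<dots> = 2 * (\<integral>\<^sup>+t. ennreal (t ^ 0 * exp (- t)) * indicator {0..} t \<partial>lborel) +
      2 * (\<integral>\<^sup>+t. ennreal (t ^ 1 * exp (- t)) * indicator {0..} t \<partial>lborel)"
    by (intro arg_cong2[where f = "(+)"] nn_integral_cmult) measurable
  also have "\<dots> = 2 * ennreal (fact 0) + 2 * ennreal (fact 1)"
    unfolding nn_intergal_power_times_exp_Ici by simp
  also have "\<dots> < \<infinity>" by (simp add: ennreal_mult_less_top)
  finally have "AE \<omega> in M. (\<integral>\<^sup>+t. liminf (\<lambda>n. g n \<omega> t) \<partial>lborel) \<noteq> \<infinity>"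
    by (intro nn_integral_PInf_AE) auto
  with continuous_paths show ?thesis
  proof eventually_elim
    case (elim \<omega>)
    let ?w = "extend_by_zero (\<lambda>t. W t \<omega>)"
    have "ennreal (norm (exp (- \<bar>t\<bar>) *\<^sub>R ?w t)) = liminf (\<lambda>n. g n \<omega> t)" for t
    proof (cases "0 < t")
      case True
      have "(\<lambda>n. W (grid n t) \<omega>) \<longlonglongrightarrow> W t \<omega>"
        using True grid_le[OF True] continuous_on_tendsto_compose[OF elim(1) grid_lim[OF True]] by simp
      then have "(\<lambda>n. ennreal (norm (W (grid n t) \<omega>) * exp (- t))) \<longlonglongrightarrow> ennreal (norm (W t \<omega>) * exp (- t))"
        by (intro tendsto_intros)
      then have "(\<lambda>n. g n \<omega> t) \<longlonglongrightarrow> ennreal (norm (W t \<omega>) * exp (- t))"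
        using True by (simp add: g_def ennreal_mult')
      then have "liminf (\<lambda>n. g n \<omega> t) = ennreal (norm (W t \<omega>) * exp (- t))"
        by (rule lim_imp_Liminf[OF sequentially_bot])
      then show ?thesis using True by (simp add: extend_by_zero_def mult.commute)
    next
      case False
      then show ?thesis by (simp add: extend_by_zero_def g_def Liminf_const)
    qed
    then have "(\<integral>\<^sup>+t. ennreal (norm (exp (- \<bar>t\<bar>) *\<^sub>R ?w t)) \<partial>lborel) < \<infinity>"
      using elim(2) by (simp add: less_top)
    then show ?case
      using measurable_extend_by_zero[OF elim(1)] by (intro integrableI_bounded) auto
  qed
qed

end

section \<open>Loops near a cusp\<close>

lemma continuous_on_positive_time:
  fixes f :: "real \<Rightarrow> real \<Rightarrow> complex"
  assumes "continuous_on (UNIV \<times> {0<..}) (\<lambda>z. f (fst z) (snd z))"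
    and "continuous_on X g" "continuous_on X h" "\<And>x. x \<in> X \<Longrightarrow> 0 < h x"
  shows "continuous_on X (\<lambda>x. f (g x) (h x))"
  using continuous_on_compose2[OF assms(1) continuous_on_Pair[OF assms(2,3)]] assms(4) by force

text \<open>
  The whole assertion for a single path. All natural co-ordinates at the cusp yield the same
  \<open>unfolding_curve\<close>, so that one \<open>\<delta>\<close>, found with one choice of them, serves all others.
\<close>

lemma cusp_unfolds_into_loop:
  assumes w: "integrable lborel (\<lambda>q. exp (- \<bar>q\<bar>) *\<^sub>R w q)" "w \<in> borel_measurable borel"
    and f: "\<And>p \<tau>. 0 < \<tau> \<Longrightarrow> f p \<tau> = heat_flow w 0 p \<tau>"
    and \<tau>0: "0 < \<tau>\<^sub>0" and p0: "0 < p\<^sub>0" and cusp: "cusp_singularity (\<lambda>p. f p \<tau>\<^sub>0) p\<^sub>0"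
  shows "\<exists>\<delta>>0. \<delta> < \<tau>\<^sub>0 \<and>
        (\<exists>(I :: real \<Rightarrow> real set) a b L.
          (\<forall>\<tau>\<in>{\<tau>\<^sub>0 - \<delta>..<\<tau>\<^sub>0}.
            is_interval (I \<tau>) \<and> p\<^sub>0 \<in> I \<tau> \<and> I \<tau> \<subseteq> {0<..} \<and>
            L \<tau> = restr (\<lambda>p. f p \<tau>) (a \<tau>) (b \<tau>) \<and>
            loops_in (\<lambda>p. f p \<tau>) (I \<tau>) = {L \<tau>}) \<and>
          (\<forall>\<epsilon>>0. \<forall>\<^sub>F \<tau> in at_left \<tau>\<^sub>0. I \<tau> \<subseteq> ball p\<^sub>0 \<epsilon>) \<and>
          loop_evolution_of f a b (\<tau>\<^sub>0 - \<delta>) \<tau>\<^sub>0 L) \<and>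
        (\<forall>u \<alpha> \<beta>. natural_coordinates (\<lambda>p. f p \<tau>\<^sub>0) p\<^sub>0 u \<alpha> \<beta> \<longrightarrow>
          (\<exists>K>0. \<exists>Lh :: real \<Rightarrow> path.
            sqrt \<delta> * K < p\<^sub>0 \<and>
            (\<forall>s\<in>{0<..\<delta>}. loops_in (rescaled f u p\<^sub>0 \<tau>\<^sub>0 s) {-K..K} = {Lh s}) \<and>
            tends_to_path Lh (limit_loop (\<alpha> 2) (\<beta> 3)) (at_right 0)))"
proof -
  have f0: "(\<lambda>p. f p \<tau>\<^sub>0) = (\<lambda>p. heat_flow w 0 p \<tau>\<^sub>0)" using f \<tau>0 by auto
  note nat_jets = natural_coordinates_heat_flow[OF w \<tau>0, of p\<^sub>0, folded f0]
  have sing: "singularity (\<lambda>p. f p \<tau>\<^sub>0) p\<^sub>0" using cusp by (simp add: cusp_singularity_def)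
  obtain u \<alpha> \<beta> where nat: "natural_coordinates (\<lambda>p. f p \<tau>\<^sub>0) p\<^sub>0 u \<alpha> \<beta>"
    using cusp by (auto simp: cusp_singularity_def)
  define A where "A = \<alpha> 2"
  define B where "B = \<beta> 3"
  have u: "norm u = 1" and AB: "A \<noteq> 0" "B \<noteq> 0"
    using nat by (simp_all add: natural_coordinates_def A_def B_def)
  note jets = nat_jets[OF sing nat, folded A_def B_def]
  define N where "N = unfolding_curve f u A B p\<^sub>0 \<tau>\<^sub>0"
  obtain C \<sigma>0 where C: "0 < C" "0 < \<sigma>0" "\<sigma>0\<^sup>2 \<le> \<tau>\<^sub>0 / 2"
    and lip: "\<And>\<sigma>. \<sigma> \<in> {0<..\<sigma>0} \<Longrightarrow> (C * \<sigma>)-lipschitz_on {-3..3} (\<lambda>P. fst (N \<sigma> P) - P\<^sup>2)"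
      "\<And>\<sigma>. \<sigma> \<in> {0<..\<sigma>0} \<Longrightarrow> (C * \<sigma>)-lipschitz_on {-3..3} (\<lambda>P. snd (N \<sigma> P) - (P ^ 3 - 3 * P))"
    and close: "\<And>\<sigma> P. \<sigma> \<in> {0<..\<sigma>0} \<Longrightarrow> P \<in> {-3..3} \<Longrightarrow> \<bar>fst (N \<sigma> P) - (P\<^sup>2 - 1)\<bar> \<le> C * \<sigma>"
      "\<And>\<sigma> P. \<sigma> \<in> {0<..\<sigma>0} \<Longrightarrow> P \<in> {-3..3} \<Longrightarrow> \<bar>snd (N \<sigma> P) - (P ^ 3 - 3 * P)\<bar> \<le> C * \<sigma>"
    unfolding N_def using unfolding_curve_converges[OF w f \<tau>0 AB jets] by blast
  \<comment> \<open>The Lipschitz constant \<open>C \<sigma>\<close> of the error must be at most \<open>1 / 10\<close> for \<open>unique_double_point\<close>, and the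
    interval \<open>[p\<^sub>0 - 3 \<sigma>, p\<^sub>0 + 3 \<sigma>]\<close> must stay to the right of \<open>0\<close>.\<close>
  define \<eta> where "\<eta> = min \<sigma>0 (min (1 / (10 * C)) (p\<^sub>0 / 4))"
  define \<delta> where "\<delta> = \<eta>\<^sup>2"
  have \<eta>: "0 < \<eta>" "\<eta> \<le> \<sigma>0" "\<eta> \<le> 1 / (10 * C)" "\<eta> \<le> p\<^sub>0 / 4"
    using C p0 by (simp_all add: \<eta>_def)
  have "\<eta>\<^sup>2 \<le> \<tau>\<^sub>0 / 2" using \<eta> by (intro order_trans[OF power_mono C(3)]) auto
  then have \<delta>: "0 < \<delta>" "\<delta> < \<tau>\<^sub>0" "sqrt \<delta> = \<eta>" using \<eta>(1) \<tau>0 by (simp_all add: \<delta>_def)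
  have root: "sqrt s \<in> {0<..\<sigma>0}" "C * sqrt s \<le> 1 / 10" "(sqrt s)\<^sup>2 = s" "sqrt s \<le> \<eta>" "0 < sqrt s"
    if "s \<in> {0<..\<delta>}" for s
  proof -
    show le: "sqrt s \<le> \<eta>" using that real_sqrt_le_mono[of s \<delta>] \<delta>(3) by simp
    show "0 < sqrt s" "(sqrt s)\<^sup>2 = s" using that by simp_all
    then show "sqrt s \<in> {0<..\<sigma>0}" using le \<eta>(2) by simp
    have "sqrt s \<le> 1 / (10 * C)" using le \<eta>(3) by linarith
    then show "C * sqrt s \<le> 1 / 10" using C(1) by (simp add: field_simps)
  qed
  define dp where "dp s = double_point (N (sqrt s)) {-3..3}" for s
  have dp_pair: "dp s = double_point (\<lambda>P. (fst (N (sqrt s) P), snd (N (sqrt s) P))) {-3..3}" for s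
    by (simp add: dp_def)
  have "\<forall>s\<in>{0<..\<delta>}. \<exists>z. dp s (fst z) (snd z) \<and> (\<forall>a b. dp s a b \<longrightarrow> (a, b) = z)"
  proof
    fix s assume s: "s \<in> {0<..\<delta>}"
    from unique_double_point[OF lip[OF root(1)[OF s]] root(2)[OF s]] obtain a b where
      "dp s a b" "\<forall>a' b'. dp s a' b' \<longrightarrow> a' = a \<and> b' = b"
      unfolding dp_pair by blast
    then have "dp s (fst (a, b)) (snd (a, b)) \<and> (\<forall>a' b'. dp s a' b' \<longrightarrow> (a', b') = (a, b))"
      unfolding fst_conv snd_conv prod.inject by blast
    then show "\<exists>z. dp s (fst z) (snd z) \<and> (\<forall>a b. dp s a b \<longrightarrow> (a, b) = z)" by (rule exI)
  qed
  from bchoice[OF this] obtain Z where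
    Z: "\<And>s. s \<in> {0<..\<delta>} \<Longrightarrow> dp s (fst (Z s)) (snd (Z s))" and
    Z_uniq: "\<And>s a b. s \<in> {0<..\<delta>} \<Longrightarrow> dp s a b \<Longrightarrow> (a, b) = Z s" by blast
  have Z_bounds: "\<bar>fst (Z s) + sqrt 3\<bar> \<le> 2 * (C * sqrt s)" "\<bar>snd (Z s) - sqrt 3\<bar> \<le> 2 * (C * sqrt s)"
    "3 \<le> snd (Z s) - fst (Z s)" if s: "s \<in> {0<..\<delta>}" for s
    using double_point_bounds[OF lip[OF root(1)[OF s]] root(2)[OF s] Z[OF s, unfolded dp_pair]] by blast+
  have Z_range: "fst (Z s) \<in> {-3..3}" "snd (Z s) \<in> {-3..3}" "fst (Z s) < snd (Z s)" if "s \<in> {0<..\<delta>}" for s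
    using Z[OF that] by (simp_all add: dp_def double_point_def)
  have N_eq: "N (sqrt s) P = N (sqrt s) Q \<longleftrightarrow>
      f (p\<^sub>0 + sqrt s * P) (\<tau>\<^sub>0 - s) = f (p\<^sub>0 + sqrt s * Q) (\<tau>\<^sub>0 - s)" if s: "s \<in> {0<..\<delta>}" for s P Q
  proof -
    have "u \<noteq> 0" using u by auto
    have "N (sqrt s) P = N (sqrt s) Q \<longleftrightarrow> u * (f (p\<^sub>0 + sqrt s * P) (\<tau>\<^sub>0 - s) - f p\<^sub>0 \<tau>\<^sub>0) =
        u * (f (p\<^sub>0 + sqrt s * Q) (\<tau>\<^sub>0 - s) - f p\<^sub>0 \<tau>\<^sub>0)"
      using AB root(5)[OF s] unfolding N_def unfolding_curve_def Let_def root(3)[OF s] complex_eq_iff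
      by (simp only: prod.inject divide_cancel_right mult_eq_0_iff) (use s in simp)
    also have "\<dots> \<longleftrightarrow> f (p\<^sub>0 + sqrt s * P) (\<tau>\<^sub>0 - s) = f (p\<^sub>0 + sqrt s * Q) (\<tau>\<^sub>0 - s)"
      using \<open>u \<noteq> 0\<close> by simp
    finally show ?thesis .
  qed
  have cont_f: "continuous_on (UNIV \<times> {0<..}) (\<lambda>z. f (fst z) (snd z))"
    using continuous_on_heat_flow[OF w, of 0]
    by (rule continuous_on_eq) (auto simp: f)
  have cont_f_slice: "continuous_on S (\<lambda>p. f p \<tau>)" if "0 < \<tau>" for \<tau> S
    using that by (intro continuous_on_positive_time[OF cont_f] continuous_intros)

  \<comment> \<open>The double point depends continuously on time: its graph is closed, being the solution set of an
    equation between continuous functions, and its values lie in the compact set \<open>T\<close>. The condition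
    \<open>3 \<le> b - a\<close> keeps the trivial solutions \<open>a = b\<close> away.\<close>
  define T where "T = {z \<in> {-3..3} \<times> {-3..3}. (3::real) \<le> snd z - fst z}"
  have "compact T"
  proof -
    have "T = ({-3..3} \<times> {-3..3}) \<inter> {z. 3 \<le> snd z - fst z}" by (auto simp: T_def)
    moreover have "closed {z :: real \<times> real. 3 \<le> snd z - fst z}"
      by (intro closed_Collect_le continuous_intros)
    ultimately show ?thesis by (simp add: compact_Int_closed compact_Times)
  qed
  have Z_T: "Z \<in> {0<..\<delta>} \<rightarrow> T"
    using Z_range Z_bounds(3) by (auto simp: T_def mem_Times_iff)
  have cont_Z: "continuous_on {0<..\<delta>} Z"
  proof (subst continuous_closed_graph_eq[OF \<open>compact T\<close> Z_T])
    let ?D = "\<lambda>z :: real \<times> real \<times> real. f (p\<^sub>0 + sqrt (fst z) * fst (snd z)) (\<tau>\<^sub>0 - fst z)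
        - f (p\<^sub>0 + sqrt (fst z) * snd (snd z)) (\<tau>\<^sub>0 - fst z)"
    have "continuous_on ({0<..\<delta>} \<times> T) ?D"
      using \<delta>(2)
      by (intro continuous_on_diff continuous_on_positive_time[OF cont_f] continuous_intros) auto
    then have "closedin (top_of_set ({0<..\<delta>} \<times> T)) {z \<in> {0<..\<delta>} \<times> T. ?D z = 0}"
      by (rule continuous_closedin_preimage_constant)
    also have "{z \<in> {0<..\<delta>} \<times> T. ?D z = 0} = (\<lambda>s. (s, Z s)) ` {0<..\<delta>}"
    proof (intro equalityI subsetI)
      fix z assume z: "z \<in> {z \<in> {0<..\<delta>} \<times> T. ?D z = 0}"
      obtain s a b where z_eq: "z = (s, a, b)" by (cases z) auto
      have s: "s \<in> {0<..\<delta>}" using z by (simp add: z_eq)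
      have "dp s a b"
        using z unfolding dp_def double_point_def N_eq[OF s] by (auto simp: z_eq T_def)
      then have "(a, b) = Z s" by (rule Z_uniq[OF s])
      then show "z \<in> (\<lambda>s. (s, Z s)) ` {0<..\<delta>}" using s by (auto simp: z_eq)
    next
      fix z assume "z \<in> (\<lambda>s. (s, Z s)) ` {0<..\<delta>}"
      then obtain s where s: "s \<in> {0<..\<delta>}" "z = (s, Z s)" by auto
      have "Z s \<in> T" using Z_T s(1) by auto
      moreover have "f (p\<^sub>0 + sqrt s * fst (Z s)) (\<tau>\<^sub>0 - s) = f (p\<^sub>0 + sqrt s * snd (Z s)) (\<tau>\<^sub>0 - s)"
        using Z[OF s(1)] unfolding dp_def double_point_def N_eq[OF s(1)] by simp
      ultimately show "z \<in> {z \<in> {0<..\<delta>} \<times> T. ?D z = 0}" using s by simp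
    qed
    finally show "closedin (top_of_set ({0<..\<delta>} \<times> T)) ((\<lambda>s. (s, Z s)) ` {0<..\<delta>})" .
  qed

  \<comment> \<open>Back from the rescaled parameter \<open>P\<close> to \<open>p = p\<^sub>0 + sqrt (\<tau>\<^sub>0 - \<tau>) * P\<close>.\<close>
  define S where "S = {\<tau>\<^sub>0 - \<delta>..<\<tau>\<^sub>0}"
  define I where "I \<tau> = {p\<^sub>0 - sqrt (\<tau>\<^sub>0 - \<tau>) * 3..p\<^sub>0 + sqrt (\<tau>\<^sub>0 - \<tau>) * 3}" for \<tau>
  define a where "a \<tau> = p\<^sub>0 + sqrt (\<tau>\<^sub>0 - \<tau>) * fst (Z (\<tau>\<^sub>0 - \<tau>))" for \<tau>
  define b where "b \<tau> = p\<^sub>0 + sqrt (\<tau>\<^sub>0 - \<tau>) * snd (Z (\<tau>\<^sub>0 - \<tau>))" for \<tau>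
  define L where "L \<tau> = restr (\<lambda>p. f p \<tau>) (a \<tau>) (b \<tau>)" for \<tau>
  have S: "\<tau>\<^sub>0 - \<tau> \<in> {0<..\<delta>}" "0 < \<tau>" if "\<tau> \<in> S" for \<tau>
    using that \<delta>(2) by (auto simp: S_def)
  have I_mem: "p\<^sub>0 + sqrt (\<tau>\<^sub>0 - \<tau>) * P \<in> I \<tau> \<longleftrightarrow> P \<in> {-3..3}" if "\<tau> \<in> S" for \<tau> P
  proof -
    have "0 < sqrt (\<tau>\<^sub>0 - \<tau>)" by (rule root(5)[OF S(1)[OF that]])
    then have "sqrt (\<tau>\<^sub>0 - \<tau>) * (-3) \<le> sqrt (\<tau>\<^sub>0 - \<tau>) * P \<longleftrightarrow> -3 \<le> P"
      "sqrt (\<tau>\<^sub>0 - \<tau>) * P \<le> sqrt (\<tau>\<^sub>0 - \<tau>) * 3 \<longleftrightarrow> P \<le> 3"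
      by (simp_all only: mult_le_cancel_left_pos)
    then show ?thesis by (auto simp: I_def)
  qed
  have ab: "double_point (\<lambda>p. f p \<tau>) (I \<tau>) (a \<tau>) (b \<tau>)" if "\<tau> \<in> S" for \<tau>
    using Z_range[OF S(1)[OF that]] I_mem[OF that] root(5)[OF S(1)[OF that]] Z[OF S(1)[OF that]]
    unfolding dp_def double_point_def N_eq[OF S(1)[OF that]] by (simp add: a_def b_def)
  have loops: "loops_in (\<lambda>p. f p \<tau>) (I \<tau>) = {L \<tau>}" if \<tau>: "\<tau> \<in> S" for \<tau>
    unfolding L_def
  proof (rule loops_in_unique_double_point[OF _ cont_f_slice[OF S(2)[OF \<tau>]] ab[OF \<tau>]])
    show "is_interval (I \<tau>)" unfolding I_def by (rule is_interval_cc)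
    fix p q assume pq: "double_point (\<lambda>p. f p \<tau>) (I \<tau>) p q"
    let ?s = "\<tau>\<^sub>0 - \<tau>"
    have r: "0 < sqrt ?s" by (rule root(5)[OF S(1)[OF \<tau>]])
    define P Q where "P = (p - p\<^sub>0) / sqrt ?s" and "Q = (q - p\<^sub>0) / sqrt ?s"
    have PQ: "p = p\<^sub>0 + sqrt ?s * P" "q = p\<^sub>0 + sqrt ?s * Q" using r by (simp_all add: P_def Q_def)
    have "dp ?s P Q"
      using pq r I_mem[OF \<tau>] unfolding dp_def double_point_def N_eq[OF S(1)[OF \<tau>]] PQ by simp
    from Z_uniq[OF S(1)[OF \<tau>] this] show "p = a \<tau> \<and> q = b \<tau>"
      unfolding a_def b_def PQ by (metis fst_conv snd_conv)
  qed
  have I_pos: "I \<tau> \<subseteq> {0<..}" "I \<tau> \<subseteq> {p\<^sub>0 - \<eta> * 3..p\<^sub>0 + \<eta> * 3}" if "\<tau> \<in> S" for \<tau>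
    using root(4)[OF S(1)[OF that]] \<eta>(4) p0 by (auto simp: I_def)
  have I_shrinks: "\<forall>\<^sub>F \<tau> in at_left \<tau>\<^sub>0. I \<tau> \<subseteq> ball p\<^sub>0 \<epsilon>" if "0 < \<epsilon>" for \<epsilon>
  proof -
    have "((\<lambda>\<tau>. sqrt (\<tau>\<^sub>0 - \<tau>) * 3) \<longlongrightarrow> sqrt (\<tau>\<^sub>0 - \<tau>\<^sub>0) * 3) (at_left \<tau>\<^sub>0)"
      by (intro tendsto_intros)
    then have "\<forall>\<^sub>F \<tau> in at_left \<tau>\<^sub>0. sqrt (\<tau>\<^sub>0 - \<tau>) * 3 < \<epsilon>"
      using that by (intro order_tendstoD(2)) simp_all
    then show ?thesis
      by eventually_elim (auto simp: I_def dist_real_def)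
  qed
  have ends: "a \<tau> \<in> I \<tau>" "b \<tau> \<in> I \<tau>" "a \<tau> < b \<tau>" if "\<tau> \<in> S" for \<tau>
    using ab[OF that] by (simp_all add: double_point_def)
  have evolution: "tends_to_path L (L \<tau>) (at \<tau> within S)" if \<tau>: "\<tau> \<in> S" for \<tau>
    unfolding L_def
  proof (rule tends_to_path_restr[where A = "p\<^sub>0 - \<eta> * 3" and B = "p\<^sub>0 + \<eta> * 3"])
    have "continuous_on ({0<..} \<times> {p\<^sub>0 - \<eta> * 3..p\<^sub>0 + \<eta> * 3}) (\<lambda>z. f (snd z) (fst z))"
      by (intro continuous_on_positive_time[OF cont_f] continuous_intros) auto
    then show "uniform_limit {p\<^sub>0 - \<eta> * 3..p\<^sub>0 + \<eta> * 3} (\<lambda>\<tau> p. f p \<tau>) (\<lambda>p. f p \<tau>) (at \<tau> within S)"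
      using S(2) \<tau> by (intro uniform_limit_of_joint_continuity[of "{0<..}"]) auto
    have "continuous_on S (\<lambda>\<tau>. Z (\<tau>\<^sub>0 - \<tau>))"
      by (rule continuous_on_compose2[OF cont_Z]) (use S(1) in \<open>auto intro!: continuous_intros\<close>)
    then have "continuous_on S a" "continuous_on S b"
      unfolding a_def[abs_def] b_def[abs_def] by (intro continuous_intros; assumption)+
    then show "(a \<longlongrightarrow> a \<tau>) (at \<tau> within S)" "(b \<longlongrightarrow> b \<tau>) (at \<tau> within S)"
      using \<tau> by (simp_all add: continuous_on_def)
    have in_I: "p\<^sub>0 - \<eta> * 3 \<le> a t \<and> a t < b t \<and> b t \<le> p\<^sub>0 + \<eta> * 3" if "t \<in> S" for t
      using ends[OF that] I_pos(2)[OF that] by auto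
    have "\<forall>\<^sub>F t in at \<tau> within S. t \<in> S" by (simp add: eventually_at_filter)
    then show "\<forall>\<^sub>F t in at \<tau> within S. p\<^sub>0 - \<eta> * 3 \<le> a t \<and> a t < b t \<and> b t \<le> p\<^sub>0 + \<eta> * 3"
      by eventually_elim (rule in_I)
    show "p\<^sub>0 - \<eta> * 3 \<le> a \<tau>" "a \<tau> < b \<tau>" "b \<tau> \<le> p\<^sub>0 + \<eta> * 3" using in_I[OF \<tau>] by auto
  qed (rule cont_f_slice[OF S(2)[OF \<tau>]])
  have "is_loop (L \<tau>)" if "\<tau> \<in> S" for \<tau>
    using loops[OF that] unfolding loops_in_def by blast
  then have "loop_evolution_of f a b (\<tau>\<^sub>0 - \<delta>) \<tau>\<^sub>0 L"
    using evolution unfolding loop_evolution_of_def loop_evolution_def S_def[symmetric]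
    by (simp add: L_def)
  moreover have "p\<^sub>0 \<in> I \<tau>" if "\<tau> \<in> S" for \<tau> using I_mem[OF that, of 0] by simp
  moreover have "is_interval (I \<tau>)" for \<tau> unfolding I_def by (rule is_interval_cc)
  ultimately have part1: "\<exists>(I :: real \<Rightarrow> real set) a b L.
      (\<forall>\<tau>\<in>{\<tau>\<^sub>0 - \<delta>..<\<tau>\<^sub>0}. is_interval (I \<tau>) \<and> p\<^sub>0 \<in> I \<tau> \<and> I \<tau> \<subseteq> {0<..} \<and>
        L \<tau> = restr (\<lambda>p. f p \<tau>) (a \<tau>) (b \<tau>) \<and> loops_in (\<lambda>p. f p \<tau>) (I \<tau>) = {L \<tau>}) \<and>
      (\<forall>\<epsilon>>0. \<forall>\<^sub>F \<tau> in at_left \<tau>\<^sub>0. I \<tau> \<subseteq> ball p\<^sub>0 \<epsilon>) \<and>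
      loop_evolution_of f a b (\<tau>\<^sub>0 - \<delta>) \<tau>\<^sub>0 L"
    using I_pos(1) loops I_shrinks unfolding S_def[symmetric]
    by (intro exI[of _ I] exI[of _ a] exI[of _ b] exI[of _ L]) (simp add: L_def)

  have part2: "\<exists>K>0. \<exists>Lh :: real \<Rightarrow> path. sqrt \<delta> * K < p\<^sub>0 \<and>
      (\<forall>s\<in>{0<..\<delta>}. loops_in (rescaled f u' p\<^sub>0 \<tau>\<^sub>0 s) {-K..K} = {Lh s}) \<and>
      tends_to_path Lh (limit_loop (\<alpha>' 2) (\<beta>' 3)) (at_right 0)"
    if nat': "natural_coordinates (\<lambda>p. f p \<tau>\<^sub>0) p\<^sub>0 u' \<alpha>' \<beta>'" for u' \<alpha>' \<beta>'
  proof -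
    define A' where "A' = \<alpha>' 2"
    define B' where "B' = \<beta>' 3"
    have u': "norm u' = 1" and AB': "A' \<noteq> 0" "B' \<noteq> 0"
      using nat' by (simp_all add: natural_coordinates_def A'_def B'_def)
    note jets' = nat_jets[OF sing nat', folded A'_def B'_def]
    \<comment> \<open>The factor \<open>\<rho>\<close> cancels in the unfolding curve, so \<open>Z s\<close> is also the double point in the co-ordinates
      given by \<open>u'\<close>.\<close>
    obtain \<rho> where \<rho>: "\<bar>\<rho>\<bar> = 1" "u' = of_real \<rho> * u" "A' = \<rho> * A" "B' = \<rho> * B"
      by (rule natural_coordinates_unique_up_to_sign[OF u u' AB(1) jets(2) jets'(2) jets(3) jets'(3)])
    have resc: "rescaled f u' p\<^sub>0 \<tau>\<^sub>0 s P = Complex (A' * fst (N (sqrt s) P)) (B' * snd (N (sqrt s) P))"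
      if s: "s \<in> {0<..\<delta>}" for s P
    proof -
      have "s powr (- 3 / 2) = 1 / sqrt s ^ 3"
      proof -
        have "s powr (- 3 / 2) = (s powr (1 / 2)) powr (- 3)" by (simp add: powr_powr)
        also have "\<dots> = 1 / sqrt s ^ 3" using s by (simp add: powr_half_sqrt powr_minus_divide)
        finally show ?thesis .
      qed
      moreover have "s powr - 1 = 1 / s" using s by (simp add: powr_minus_divide)
      ultimately show ?thesis
        using AB root(3)[OF s] s
        by (simp add: rescaled_def rigid_def N_def unfolding_curve_def Let_def \<rho>(2-4) mult.assoc)
    qed
    have loops': "loops_in (rescaled f u' p\<^sub>0 \<tau>\<^sub>0 s) {-3..3} =
        {restr (rescaled f u' p\<^sub>0 \<tau>\<^sub>0 s) (fst (Z s)) (snd (Z s))}" if s: "s \<in> {0<..\<delta>}" for s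
    proof (rule loops_in_unique_double_point)
      have dp': "double_point (rescaled f u' p\<^sub>0 \<tau>\<^sub>0 s) {-3..3} = dp s"
        using AB' by (intro ext) (simp add: dp_def double_point_def resc[OF s] prod_eq_iff)
      show "double_point (rescaled f u' p\<^sub>0 \<tau>\<^sub>0 s) {-3..3} (fst (Z s)) (snd (Z s))"
        unfolding dp' by (rule Z[OF s])
      show "x = fst (Z s) \<and> y = snd (Z s)" if "double_point (rescaled f u' p\<^sub>0 \<tau>\<^sub>0 s) {-3..3} x y" for x y
        using Z_uniq[OF s that[unfolded dp']] by (metis fst_conv snd_conv)
      have "0 < \<tau>\<^sub>0 - s" using s \<delta>(2) by simp
      then have "continuous_on {-3..3} (\<lambda>P. f (p\<^sub>0 + sqrt s * P) (\<tau>\<^sub>0 - s))"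
        by (intro continuous_on_positive_time[OF cont_f] continuous_intros)
      then show "continuous_on {-3..3} (rescaled f u' p\<^sub>0 \<tau>\<^sub>0 s)"
        unfolding rescaled_def[abs_def] rigid_def Let_def by (intro continuous_intros)
    qed (rule is_interval_cc)
    have small: "\<forall>\<^sub>F s in at_right 0. s \<in> {0<..\<delta>}"
      using \<delta>(1) eventually_at_right_real[of 0 \<delta>] by (auto elim!: eventually_mono)
    have root0: "((\<lambda>s. K * sqrt s) \<longlongrightarrow> 0) (at_right 0)" for K
      using tendsto_mult[OF tendsto_const tendsto_real_sqrt[OF tendsto_ident_at], of K 0 "{0<..}"] by simp
    have "tends_to_path (\<lambda>s. restr (rescaled f u' p\<^sub>0 \<tau>\<^sub>0 s) (fst (Z s)) (snd (Z s)))
        (limit_loop A' B') (at_right 0)"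
      unfolding limit_loop_def
    proof (rule tends_to_path_restr[where A = "- 3" and B = 3])
      show "uniform_limit {-3..3} (rescaled f u' p\<^sub>0 \<tau>\<^sub>0)
          (\<lambda>P. Complex (A' * (P\<^sup>2 - 1)) (B' * (P ^ 3 - 3 * P))) (at_right 0)"
      proof (rule uniform_limitI)
        fix e :: real assume "0 < e"
        then have "\<forall>\<^sub>F s in at_right 0. ((\<bar>A'\<bar> + \<bar>B'\<bar>) * C) * sqrt s < e"
          by (intro order_tendstoD(2)[OF root0])
        with small show "\<forall>\<^sub>F s in at_right 0. \<forall>P\<in>{-3..3}. dist (rescaled f u' p\<^sub>0 \<tau>\<^sub>0 s P)
            (Complex (A' * (P\<^sup>2 - 1)) (B' * (P ^ 3 - 3 * P))) < e"
        proof eventually_elim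
          case (elim s)
          show ?case
          proof
            fix P :: real assume P: "P \<in> {-3..3}"
            note c = close[OF root(1)[OF elim(1)] P]
            have "dist (rescaled f u' p\<^sub>0 \<tau>\<^sub>0 s P) (Complex (A' * (P\<^sup>2 - 1)) (B' * (P ^ 3 - 3 * P))) \<le>
                \<bar>A' * (fst (N (sqrt s) P) - (P\<^sup>2 - 1))\<bar> + \<bar>B' * (snd (N (sqrt s) P) - (P ^ 3 - 3 * P))\<bar>"
              unfolding resc[OF elim(1)] dist_norm by (rule order_trans[OF cmod_le]) (simp add: algebra_simps)
            also have "\<dots> \<le> \<bar>A'\<bar> * (C * sqrt s) + \<bar>B'\<bar> * (C * sqrt s)"
              unfolding abs_mult using c by (intro add_mono mult_left_mono) auto
            also have "\<dots> = ((\<bar>A'\<bar> + \<bar>B'\<bar>) * C) * sqrt s" by (simp add: algebra_simps)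
            also note elim(2)
            finally show "dist (rescaled f u' p\<^sub>0 \<tau>\<^sub>0 s P)
              (Complex (A' * (P\<^sup>2 - 1)) (B' * (P ^ 3 - 3 * P))) < e" .
          qed
        qed
      qed
      show "continuous_on {-3..3} (\<lambda>P. Complex (A' * (P\<^sup>2 - 1)) (B' * (P ^ 3 - 3 * P)))"
        by (intro continuous_intros)
      have "((\<lambda>s. fst (Z s) - (- sqrt 3)) \<longlongrightarrow> 0) (at_right 0)"
        by (rule Lim_null_comparison[OF eventually_mono[OF small] root0[of "2 * C"]])
          (use Z_bounds(1) in \<open>simp add: mult.assoc\<close>)
      then show "((\<lambda>s. fst (Z s)) \<longlongrightarrow> - sqrt 3) (at_right 0)" by (rule LIM_zero_cancel)
      have "((\<lambda>s. snd (Z s) - sqrt 3) \<longlongrightarrow> 0) (at_right 0)"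
        by (rule Lim_null_comparison[OF eventually_mono[OF small] root0[of "2 * C"]])
          (use Z_bounds(2) in \<open>simp add: mult.assoc\<close>)
      then show "((\<lambda>s. snd (Z s)) \<longlongrightarrow> sqrt 3) (at_right 0)" by (rule LIM_zero_cancel)
      show "\<forall>\<^sub>F s in at_right 0. - 3 \<le> fst (Z s) \<and> fst (Z s) < snd (Z s) \<and> snd (Z s) \<le> 3"
        using small by eventually_elim (use Z_range in simp)
      have "sqrt 3 \<le> sqrt (3\<^sup>2)" by (subst real_sqrt_le_iff) simp
      then show "- 3 \<le> - sqrt 3" "- sqrt 3 < sqrt 3" "sqrt 3 \<le> 3" by simp_all
    qed
    moreover have "sqrt \<delta> * 3 < p\<^sub>0" using \<delta>(3) \<eta>(4) p0 by simp
    ultimately show ?thesis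
      using loops' unfolding A'_def B'_def
      by (intro exI[of _ 3] conjI exI[of _ "\<lambda>s. restr (rescaled f u' p\<^sub>0 \<tau>\<^sub>0 s) (fst (Z s)) (snd (Z s))"]) auto
  qed
  show ?thesis using \<delta>(1,2) part1 part2 by (intro exI[of _ \<delta>]) blast
qed

theorem theorem8:
  fixes M :: "'w measure" and W :: "real \<Rightarrow> 'w \<Rightarrow> complex"
  assumes "planar_brownian_motion M W"
  shows "\<exists>L\<^sub>0 :: real \<Rightarrow> real \<Rightarrow> path.
    (\<forall>x y. x \<noteq> 0 \<longrightarrow> y \<noteq> 0 \<longrightarrow> is_loop (L\<^sub>0 x y)) \<and>
    (AE \<omega> in M. let f = smoothed (\<lambda>t. W t \<omega>) in
      \<forall>\<tau>\<^sub>0>0. \<forall>p\<^sub>0>0. cusp_singularity (\<lambda>p. f p \<tau>\<^sub>0) p\<^sub>0 \<longrightarrow>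
      (\<exists>\<delta>>0. \<delta> < \<tau>\<^sub>0 \<and>
        (\<exists>(I :: real \<Rightarrow> real set) a b L.
          (\<forall>\<tau>\<in>{\<tau>\<^sub>0 - \<delta>..<\<tau>\<^sub>0}.
            is_interval (I \<tau>) \<and> p\<^sub>0 \<in> I \<tau> \<and> I \<tau> \<subseteq> {0<..} \<and>
            L \<tau> = restr (\<lambda>p. f p \<tau>) (a \<tau>) (b \<tau>) \<and>
            loops_in (\<lambda>p. f p \<tau>) (I \<tau>) = {L \<tau>}) \<and>
          (\<forall>\<epsilon>>0. \<forall>\<^sub>F \<tau> in at_left \<tau>\<^sub>0. I \<tau> \<subseteq> ball p\<^sub>0 \<epsilon>) \<and>
          loop_evolution_of f a b (\<tau>\<^sub>0 - \<delta>) \<tau>\<^sub>0 L) \<and>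
        (\<forall>u \<alpha> \<beta>. natural_coordinates (\<lambda>p. f p \<tau>\<^sub>0) p\<^sub>0 u \<alpha> \<beta> \<longrightarrow>
          (\<exists>K>0. \<exists>Lh :: real \<Rightarrow> path.
            sqrt \<delta> * K < p\<^sub>0 \<and>
            (\<forall>s\<in>{0<..\<delta>}. loops_in (rescaled f u p\<^sub>0 \<tau>\<^sub>0 s) {-K..K} = {Lh s}) \<and>
            tends_to_path Lh (L\<^sub>0 (\<alpha> 2) (\<beta> 3)) (at_right 0)))))"
proof -
  interpret planar_brownian_motion M W by (rule assms)
  have good: "AE \<omega> in M.
      integrable lborel (\<lambda>q. exp (- \<bar>q\<bar>) *\<^sub>R extend_by_zero (\<lambda>t. W t \<omega>) q) \<and>
      extend_by_zero (\<lambda>t. W t \<omega>) \<in> borel_measurable borel"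
    using AE_exp_integrable continuous_paths
    by eventually_elim (simp add: measurable_extend_by_zero)
  show ?thesis
  proof (rule exI[of _ limit_loop], intro conjI allI impI)
    show "is_loop (limit_loop x y)" if "x \<noteq> 0" "y \<noteq> 0" for x y
      using that by (rule is_loop_limit_loop)
  qed (rule eventually_mono[OF good], unfold Let_def, intro allI impI, elim conjE,
       rule cusp_unfolds_into_loop, assumption+, rule smoothed_eq_heat_flow, assumption+)
qed

end
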